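(* Let $R$ be a noetherian, commutative ring and let $\mathcal{T}$ be a regular, Karoubian triangulated category proper over $R$. Let $\mathcal{S}\subset\mathcal{T}$ be a triangulated subcategory (in particular full). If the inclusion functor $I:\mathcal{S}\to\mathcal{T}$ has either a right or a left adjoint then it has both adjoints, and $\mathcal{S}$ is also Karoubian, regular and proper over $R$.
   Context: A triangulated category is Karoubian if idempotents split in it. An $R$-linear triangulated category $\mathcal{T}$ (Hom-sets are $R$-modules, and composition is $R$-bilinear) is proper over $R$ if, for each pair of objects $X,Y\in\mathcal{T}$, the direct sum $\bigoplus_{i=-\infty}^{\infty}\mathrm{Hom}_{\mathcal{T}}(X,\Sigma^iY)$ is a finite (finitely generated) $R$-module. For an object $G\in\mathcal{T}$ let $\langle G\rangle_1\subset\mathcal{T}$ be the full subcategory of all direct summands of finite coproducts of suspensions $\Sigma^iG$ ($i\in\mathbb{Z}$); inductively, an object lies in $\langle G\rangle_{n+1}$ if it is a direct summand of an object $y$ admitting a distinguished triangle $x\to y\to z\to\Sigma x$ with $x\in\langle G\rangle_1$ and $z\in\langle G\rangle_n$. The object $G$ is a strong generator if $\mathcal{T}=\langle G\rangle_n$ for some $n\ge1$, and $\mathcal{T}$ is regular if it has a strong generator. *)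

theory Defs
  imports "HOL-Algebra.Ring_Divisibility" "HOL-Algebra.Module"
begin

section \<open>Categories, functors, adjunctions\<close>

record ('o, 'm) cat =
  Obj :: "'o set"
  Arr :: "'m set"
  Dom :: "'m \<Rightarrow> 'o"
  Cod :: "'m \<Rightarrow> 'o"
  Ident :: "'o \<Rightarrow> 'm"
  Comp :: "'m \<Rightarrow> 'm \<Rightarrow> 'm" (infixr \<open>\<cdot>\<index>\<close> 75)

definition Hom :: "('o, 'm, 'x) cat_scheme \<Rightarrow> 'o \<Rightarrow> 'o \<Rightarrow> 'm set" where
  "Hom C X Y = {f \<in> Arr C. Dom C f = X \<and> Cod C f = Y}"

locale category =
  fixes C :: "('o, 'm, 'x) cat_scheme" (structure)
  assumes Dom_Obj: "f \<in> Arr C \<Longrightarrow> Dom C f \<in> Obj C"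
    and Cod_Obj: "f \<in> Arr C \<Longrightarrow> Cod C f \<in> Obj C"
    and Ident_Hom: "X \<in> Obj C \<Longrightarrow> Ident C X \<in> Hom C X X"
    and Comp_Hom: "f \<in> Hom C X Y \<Longrightarrow> g \<in> Hom C Y Z \<Longrightarrow> g \<cdot> f \<in> Hom C X Z"
    and Comp_Ident_right: "f \<in> Hom C X Y \<Longrightarrow> f \<cdot> Ident C X = f"
    and Comp_Ident_left: "f \<in> Hom C X Y \<Longrightarrow> Ident C Y \<cdot> f = f"
    and Comp_assoc: "f \<in> Hom C W X \<Longrightarrow> g \<in> Hom C X Y \<Longrightarrow> h \<in> Hom C Y Z \<Longrightarrow>
      h \<cdot> (g \<cdot> f) = (h \<cdot> g) \<cdot> f"

record ('o1, 'm1, 'o2, 'm2) fctr =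
  on_obj :: "'o1 \<Rightarrow> 'o2"
  on_arr :: "'m1 \<Rightarrow> 'm2"

definition is_functor ::
    "('o1, 'm1, 'x) cat_scheme \<Rightarrow> ('o2, 'm2, 'y) cat_scheme \<Rightarrow> ('o1, 'm1, 'o2, 'm2) fctr \<Rightarrow> bool"
  where
  "is_functor C D F \<longleftrightarrow>
     (\<forall>X \<in> Obj C. on_obj F X \<in> Obj D \<and> on_arr F (Ident C X) = Ident D (on_obj F X)) \<and>
     (\<forall>X \<in> Obj C. \<forall>Y \<in> Obj C. \<forall>f \<in> Hom C X Y. on_arr F f \<in> Hom D (on_obj F X) (on_obj F Y)) \<and>
     (\<forall>X \<in> Obj C. \<forall>Y \<in> Obj C. \<forall>Z \<in> Obj C. \<forall>f \<in> Hom C X Y. \<forall>g \<in> Hom C Y Z.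
        on_arr F (g \<cdot>\<^bsub>C\<^esub> f) = on_arr F g \<cdot>\<^bsub>D\<^esub> on_arr F f)"

text \<open>The functor \<open>F\<close> from \<open>C\<close> to \<open>D\<close> is left adjoint to the functor \<open>G\<close> from \<open>D\<close> to \<open>C\<close>:
  there are bijections from \<open>Hom(F X, Y)\<close> to \<open>Hom(X, G Y)\<close>, natural in both variables.\<close>

definition adjoint ::
    "('o1, 'm1, 'x) cat_scheme \<Rightarrow> ('o2, 'm2, 'y) cat_scheme \<Rightarrow>
     ('o1, 'm1, 'o2, 'm2) fctr \<Rightarrow> ('o2, 'm2, 'o1, 'm1) fctr \<Rightarrow> bool" where
  "adjoint C D F G \<longleftrightarrow>
     is_functor C D F \<and> is_functor D C G \<and>
     (\<exists>\<phi>. (\<forall>X \<in> Obj C. \<forall>Y \<in> Obj D. bij_betw (\<phi> X Y) (Hom D (on_obj F X) Y) (Hom C X (on_obj G Y))) \<and>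
          (\<forall>X \<in> Obj C. \<forall>X' \<in> Obj C. \<forall>Y \<in> Obj D. \<forall>a \<in> Hom C X' X. \<forall>f \<in> Hom D (on_obj F X) Y.
             \<phi> X' Y (f \<cdot>\<^bsub>D\<^esub> on_arr F a) = \<phi> X Y f \<cdot>\<^bsub>C\<^esub> a) \<and>
          (\<forall>X \<in> Obj C. \<forall>Y \<in> Obj D. \<forall>Y' \<in> Obj D. \<forall>b \<in> Hom D Y Y'. \<forall>f \<in> Hom D (on_obj F X) Y.
             \<phi> X Y' (b \<cdot>\<^bsub>D\<^esub> f) = on_arr G b \<cdot>\<^bsub>C\<^esub> \<phi> X Y f))"

definition has_right_adjoint where
  "has_right_adjoint C D F \<longleftrightarrow> (\<exists>G. adjoint C D F G)"

definition has_left_adjoint where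
  "has_left_adjoint C D F \<longleftrightarrow> (\<exists>L. adjoint D C L F)"

definition iso_in :: "('o, 'm, 'x) cat_scheme \<Rightarrow> 'o \<Rightarrow> 'o \<Rightarrow> 'm \<Rightarrow> bool" where
  "iso_in C X Y f \<longleftrightarrow> f \<in> Hom C X Y \<and>
     (\<exists>g \<in> Hom C Y X. g \<cdot>\<^bsub>C\<^esub> f = Ident C X \<and> f \<cdot>\<^bsub>C\<^esub> g = Ident C Y)"

definition zero_object :: "('o, 'm, 'x) cat_scheme \<Rightarrow> 'o \<Rightarrow> bool" where
  "zero_object C Z \<longleftrightarrow> Z \<in> Obj C \<and>
     (\<forall>X \<in> Obj C. (\<exists>!f. f \<in> Hom C Z X) \<and> (\<exists>!f. f \<in> Hom C X Z))"

definition is_coproduct ::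
    "('o, 'm, 'x) cat_scheme \<Rightarrow> 'i set \<Rightarrow> ('i \<Rightarrow> 'o) \<Rightarrow> 'o \<Rightarrow> ('i \<Rightarrow> 'm) \<Rightarrow> bool" where
  "is_coproduct C I A Y \<iota> \<longleftrightarrow>
     Y \<in> Obj C \<and> (\<forall>i \<in> I. A i \<in> Obj C \<and> \<iota> i \<in> Hom C (A i) Y) \<and>
     (\<forall>Z \<in> Obj C. \<forall>f. (\<forall>i \<in> I. f i \<in> Hom C (A i) Z) \<longrightarrow>
        (\<exists>!u. u \<in> Hom C Y Z \<and> (\<forall>i \<in> I. u \<cdot>\<^bsub>C\<^esub> \<iota> i = f i)))"

text \<open>The case \<open>n = 0\<close> provides an initial object.\<close>

definition has_finite_coproducts :: "('o, 'm, 'x) cat_scheme \<Rightarrow> bool" where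
  "has_finite_coproducts C \<longleftrightarrow>
     (\<forall>n::nat. \<forall>A. (\<forall>i<n. A i \<in> Obj C) \<longrightarrow> (\<exists>Y \<iota>. is_coproduct C {..<n} A Y \<iota>))"

text \<open>\<open>X\<close> is a direct summand of \<open>Y\<close> if \<open>Y\<close> is the coproduct of \<open>X\<close> and some \<open>X'\<close>.\<close>

definition direct_summand :: "('o, 'm, 'x) cat_scheme \<Rightarrow> 'o \<Rightarrow> 'o \<Rightarrow> bool" where
  "direct_summand C X Y \<longleftrightarrow>
     (\<exists>X' \<iota>. is_coproduct C (UNIV :: bool set) (\<lambda>b. if b then X else X') Y \<iota>)"

definition karoubian :: "('o, 'm, 'x) cat_scheme \<Rightarrow> bool" where
  "karoubian C \<longleftrightarrow>
     (\<forall>X \<in> Obj C. \<forall>e \<in> Hom C X X. e \<cdot>\<^bsub>C\<^esub> e = e \<longrightarrow>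
        (\<exists>Y \<in> Obj C. \<exists>p \<in> Hom C X Y. \<exists>i \<in> Hom C Y X. i \<cdot>\<^bsub>C\<^esub> p = e \<and> p \<cdot>\<^bsub>C\<^esub> i = Ident C Y))"

section \<open>Linear categories\<close>

record ('o, 'm, 'r) lin_cat = "('o, 'm) cat" +
  Zero :: "'o \<Rightarrow> 'o \<Rightarrow> 'm"
  Add :: "'m \<Rightarrow> 'm \<Rightarrow> 'm"
  Scale :: "'r \<Rightarrow> 'm \<Rightarrow> 'm"

text \<open>The record type \<^typ>\<open>('a, 'b) module\<close> extends that of rings; the ring multiplication and
  unit play no role for modules and are left unspecified.\<close>

definition hom_module :: "('o, 'm, 'r, 'x) lin_cat_scheme \<Rightarrow> 'o \<Rightarrow> 'o \<Rightarrow> ('r, 'm) module" where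
  "hom_module C X Y =
     \<lparr>carrier = Hom C X Y, mult = undefined, one = undefined,
      zero = Zero C X Y, add = Add C, smult = Scale C\<rparr>"

locale linear_category = category C for R :: "'r ring" and C :: "('o, 'm, 'r, 'x) lin_cat_scheme" +
  assumes hom_module: "X \<in> Obj C \<Longrightarrow> Y \<in> Obj C \<Longrightarrow> module R (hom_module C X Y)"
    and Comp_Add_right: "f \<in> Hom C X Y \<Longrightarrow> f' \<in> Hom C X Y \<Longrightarrow> g \<in> Hom C Y Z \<Longrightarrow>
      g \<cdot>\<^bsub>C\<^esub> Add C f f' = Add C (g \<cdot>\<^bsub>C\<^esub> f) (g \<cdot>\<^bsub>C\<^esub> f')"
    and Comp_Add_left: "f \<in> Hom C X Y \<Longrightarrow> g \<in> Hom C Y Z \<Longrightarrow> g' \<in> Hom C Y Z \<Longrightarrow>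
      Add C g g' \<cdot>\<^bsub>C\<^esub> f = Add C (g \<cdot>\<^bsub>C\<^esub> f) (g' \<cdot>\<^bsub>C\<^esub> f)"
    and Comp_Scale_right: "r \<in> carrier R \<Longrightarrow> f \<in> Hom C X Y \<Longrightarrow> g \<in> Hom C Y Z \<Longrightarrow>
      g \<cdot>\<^bsub>C\<^esub> Scale C r f = Scale C r (g \<cdot>\<^bsub>C\<^esub> f)"
    and Comp_Scale_left: "r \<in> carrier R \<Longrightarrow> f \<in> Hom C X Y \<Longrightarrow> g \<in> Hom C Y Z \<Longrightarrow>
      Scale C r g \<cdot>\<^bsub>C\<^esub> f = Scale C r (g \<cdot>\<^bsub>C\<^esub> f)"

definition finitely_generated_module :: "'r ring \<Rightarrow> ('r, 'm) module \<Rightarrow> bool" where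
  "finitely_generated_module R M \<longleftrightarrow>
     (\<exists>A. finite A \<and> A \<subseteq> carrier M \<and>
        (\<forall>x \<in> carrier M. \<exists>c. c \<in> A \<rightarrow> carrier R \<and> x = (\<Oplus>\<^bsub>M\<^esub>a\<in>A. c a \<odot>\<^bsub>M\<^esub> a)))"

definition direct_sum_module :: "('i \<Rightarrow> ('r, 'm) module) \<Rightarrow> ('r, 'i \<Rightarrow> 'm) module" where
  "direct_sum_module M =
     \<lparr>carrier = {x. (\<forall>i. x i \<in> carrier (M i)) \<and> finite {i. x i \<noteq> \<zero>\<^bsub>M i\<^esub>}},
      mult = undefined, one = undefined,
      zero = (\<lambda>i. \<zero>\<^bsub>M i\<^esub>),
      add = (\<lambda>x y i. x i \<oplus>\<^bsub>M i\<^esub> y i),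
      smult = (\<lambda>r x i. r \<odot>\<^bsub>M i\<^esub> x i)\<rparr>"

section \<open>Triangulated categories\<close>

text \<open>A triangle \<open>X \<rightarrow> Y \<rightarrow> Z \<rightarrow> \<Sigma>X\<close> is recorded as the triple of its arrows.  As in Neeman's and
  Verdier's conventions the suspension \<open>\<Sigma>\<close> is an automorphism (not merely an equivalence),
  so that \<open>\<Sigma>\<^sup>i\<close> makes sense for all integers \<open>i\<close>.  It is additive, but its action on
  Hom-modules is not required to be \<open>R\<close>-linear.\<close>

record ('o, 'm, 'r) tri_cat = "('o, 'm, 'r) lin_cat" +
  Susp :: "('o, 'm, 'o, 'm) fctr"
  Dist :: "('m \<times> 'm \<times> 'm) set"

abbreviation susp_obj :: "('o, 'm, 'r, 'x) tri_cat_scheme \<Rightarrow> 'o \<Rightarrow> 'o" where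
  "susp_obj T \<equiv> on_obj (Susp T)"

abbreviation susp_arr :: "('o, 'm, 'r, 'x) tri_cat_scheme \<Rightarrow> 'm \<Rightarrow> 'm" where
  "susp_arr T \<equiv> on_arr (Susp T)"

definition triangle ::
    "('o, 'm, 'r, 'x) tri_cat_scheme \<Rightarrow> 'o \<Rightarrow> 'o \<Rightarrow> 'o \<Rightarrow> 'm \<Rightarrow> 'm \<Rightarrow> 'm \<Rightarrow> bool" where
  "triangle T X Y Z f g h \<longleftrightarrow> f \<in> Hom T X Y \<and> g \<in> Hom T Y Z \<and> h \<in> Hom T Z (susp_obj T X)"

definition dist_triangle ::
    "('o, 'm, 'r, 'x) tri_cat_scheme \<Rightarrow> 'o \<Rightarrow> 'o \<Rightarrow> 'o \<Rightarrow> 'm \<Rightarrow> 'm \<Rightarrow> 'm \<Rightarrow> bool" where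
  "dist_triangle T X Y Z f g h \<longleftrightarrow> triangle T X Y Z f g h \<and> (f, g, h) \<in> Dist T"

locale linear_triangulated_category = linear_category R T
  for R :: "'r ring" and T :: "('o, 'm, 'r, 'x) tri_cat_scheme" (structure) +
  assumes finite_coproducts: "has_finite_coproducts T"
    and Susp_functor: "is_functor T T (Susp T)"
    and Susp_bij_Obj: "bij_betw (susp_obj T) (Obj T) (Obj T)"
    and Susp_bij_Arr: "bij_betw (susp_arr T) (Arr T) (Arr T)"
    and Susp_Add: "f \<in> Hom T X Y \<Longrightarrow> g \<in> Hom T X Y \<Longrightarrow>
      susp_arr T (Add T f g) = Add T (susp_arr T f) (susp_arr T g)"
    and Dist_triangle: "(f, g, h) \<in> Dist T \<Longrightarrow> \<exists>X Y Z. triangle T X Y Z f g h"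
    and TR1_iso: "dist_triangle T X Y Z f g h \<Longrightarrow> triangle T X' Y' Z' f' g' h' \<Longrightarrow>
      iso_in T X X' a \<Longrightarrow> iso_in T Y Y' b \<Longrightarrow> iso_in T Z Z' c \<Longrightarrow>
      b \<cdot> f = f' \<cdot> a \<Longrightarrow> c \<cdot> g = g' \<cdot> b \<Longrightarrow> susp_arr T a \<cdot> h = h' \<cdot> c \<Longrightarrow>
      dist_triangle T X' Y' Z' f' g' h'"
    and TR1_Ident: "X \<in> Obj T \<Longrightarrow> zero_object T Z \<Longrightarrow>
      dist_triangle T X X Z (Ident T X) (Zero T X Z) (Zero T Z (susp_obj T X))"
    and TR1_cone: "f \<in> Hom T X Y \<Longrightarrow> \<exists>Z g h. dist_triangle T X Y Z f g h"
    and TR2: "triangle T X Y Z f g h \<Longrightarrow>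
      dist_triangle T X Y Z f g h \<longleftrightarrow>
      dist_triangle T Y Z (susp_obj T X) g h
        (\<ominus>\<^bsub>hom_module T (susp_obj T X) (susp_obj T Y)\<^esub> susp_arr T f)"
    and TR3: "dist_triangle T X Y Z f g h \<Longrightarrow> dist_triangle T X' Y' Z' f' g' h' \<Longrightarrow>
      a \<in> Hom T X X' \<Longrightarrow> b \<in> Hom T Y Y' \<Longrightarrow> b \<cdot> f = f' \<cdot> a \<Longrightarrow>
      \<exists>c \<in> Hom T Z Z'. c \<cdot> g = g' \<cdot> b \<and> susp_arr T a \<cdot> h = h' \<cdot> c"
    and TR4: "dist_triangle T X Y Q1 f p1 d1 \<Longrightarrow> dist_triangle T Y Z Q3 g p3 d3 \<Longrightarrow>
      dist_triangle T X Z Q2 (g \<cdot> f) p2 d2 \<Longrightarrow>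
      \<exists>a b. dist_triangle T Q1 Q2 Q3 a b (susp_arr T p1 \<cdot> d3) \<and>
        a \<cdot> p1 = p2 \<cdot> g \<and> d2 \<cdot> a = d1 \<and> b \<cdot> p2 = p3 \<and> d3 \<cdot> b = susp_arr T f \<cdot> d2"

definition susp_pow :: "('o, 'm, 'r, 'x) tri_cat_scheme \<Rightarrow> int \<Rightarrow> 'o \<Rightarrow> 'o" where
  "susp_pow T i X =
     (if 0 \<le> i then (susp_obj T ^^ nat i) X
      else (inv_into (Obj T) (susp_obj T) ^^ nat (- i)) X)"

definition proper_over :: "'r ring \<Rightarrow> ('o, 'm, 'r, 'x) tri_cat_scheme \<Rightarrow> bool" where
  "proper_over R T \<longleftrightarrow>
     (\<forall>X \<in> Obj T. \<forall>Y \<in> Obj T.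
        finitely_generated_module R (direct_sum_module (\<lambda>i::int. hom_module T X (susp_pow T i Y))))"

definition suspension_coproduct :: "('o, 'm, 'r, 'x) tri_cat_scheme \<Rightarrow> 'o \<Rightarrow> 'o \<Rightarrow> bool" where
  "suspension_coproduct T G Y \<longleftrightarrow>
     (\<exists>(n::nat) k \<iota>. is_coproduct T {..<n} (\<lambda>j. susp_pow T (k j) G) Y \<iota>)"

text \<open>The set of objects of \<open>\<langle>G\<rangle>\<^sub>n\<close>; only \<open>n \<ge> 1\<close> is meaningful.\<close>

fun gen_in :: "('o, 'm, 'r, 'x) tri_cat_scheme \<Rightarrow> 'o \<Rightarrow> nat \<Rightarrow> 'o set" where
  "gen_in T G 0 = {}"
| "gen_in T G (Suc 0) =
     {X \<in> Obj T. \<exists>Y. suspension_coproduct T G Y \<and> direct_summand T X Y}"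
| "gen_in T G (Suc (Suc n)) =
     {X \<in> Obj T. \<exists>x y z f g h. x \<in> gen_in T G (Suc 0) \<and> z \<in> gen_in T G (Suc n) \<and>
        dist_triangle T x y z f g h \<and> direct_summand T X y}"

definition strong_generator :: "('o, 'm, 'r, 'x) tri_cat_scheme \<Rightarrow> 'o \<Rightarrow> bool" where
  "strong_generator T G \<longleftrightarrow> G \<in> Obj T \<and> (\<exists>n\<ge>1. Obj T = gen_in T G n)"

definition regular :: "('o, 'm, 'r, 'x) tri_cat_scheme \<Rightarrow> bool" where
  "regular T \<longleftrightarrow> (\<exists>G. strong_generator T G)"

section \<open>Triangulated subcategories\<close>

text \<open>The full subcategory on a set \<open>S\<close> of objects, with the inherited linear structure,
  suspension and distinguished triangles.\<close>

definition full_sub :: "('o, 'm, 'r, 'x) tri_cat_scheme \<Rightarrow> 'o set \<Rightarrow> ('o, 'm, 'r, 'x) tri_cat_scheme"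
  where
  "full_sub T S = T
     \<lparr>Obj := S,
      Arr := {f \<in> Arr T. Dom T f \<in> S \<and> Cod T f \<in> S},
      Dist := {(f, g, h) \<in> Dist T. Dom T f \<in> S \<and> Cod T f \<in> S \<and> Cod T g \<in> S}\<rparr>"

text \<open>These are the conditions under which \<^term>\<open>full_sub T S\<close> is triangulated (see the last lemma
  below).  Closure of \<open>S\<close> under isomorphism is not required; if \<open>S\<close> is so closed, the last
  condition says that \<open>S\<close> contains the third object of each distinguished triangle whose first
  two objects lie in \<open>S\<close>.\<close>

definition triangulated_subcategory :: "('o, 'm, 'r, 'x) tri_cat_scheme \<Rightarrow> 'o set \<Rightarrow> bool" where
  "triangulated_subcategory T S \<longleftrightarrow>
     S \<subseteq> Obj T \<and> has_finite_coproducts (full_sub T S) \<and> susp_obj T ` S = S \<and>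
     (\<forall>X \<in> S. \<forall>Y \<in> S. \<forall>f \<in> Hom T X Y. \<exists>Z \<in> S. \<exists>g h. dist_triangle T X Y Z f g h)"

definition inclusion :: "('o, 'm, 'o, 'm) fctr" where
  "inclusion = \<lparr>on_obj = (\<lambda>X. X), on_arr = (\<lambda>f. f)\<rparr>"

lemma Hom_full_sub: "X \<in> S \<Longrightarrow> Y \<in> S \<Longrightarrow> Hom (full_sub T S) X Y = Hom T X Y"
  by (auto simp: Hom_def full_sub_def)

lemma Hom_full_subD:
  "f \<in> Hom (full_sub T S) X Y \<Longrightarrow> f \<in> Hom T X Y \<and> X \<in> S \<and> Y \<in> S"
  by (auto simp: Hom_def full_sub_def)

lemma full_sub_simps [simp]:
  "Obj (full_sub T S) = S" "Dom (full_sub T S) = Dom T" "Cod (full_sub T S) = Cod T"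
  "Ident (full_sub T S) = Ident T" "Comp (full_sub T S) = Comp T"
  "Zero (full_sub T S) = Zero T" "Add (full_sub T S) = Add T" "Scale (full_sub T S) = Scale T"
  "Susp (full_sub T S) = Susp T"
  by (auto simp: full_sub_def)

lemma hom_module_full_sub:
  "X \<in> S \<Longrightarrow> Y \<in> S \<Longrightarrow> hom_module (full_sub T S) X Y = hom_module T X Y"
  by (simp add: hom_module_def Hom_full_sub)

lemma triangle_full_sub:
  assumes "susp_obj T ` S = S"
  shows "triangle (full_sub T S) X Y Z f g h \<longleftrightarrow>
    X \<in> S \<and> Y \<in> S \<and> Z \<in> S \<and> triangle T X Y Z f g h"
proof -
  have "susp_obj T X \<in> S" if "X \<in> S" for X
    using imageI[OF that, of "susp_obj T"] assms by simp
  then have eq: "triangle (full_sub T S) X Y Z f g h \<longleftrightarrow> triangle T X Y Z f g h"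
    if "X \<in> S" "Y \<in> S" "Z \<in> S"
    using that by (simp add: triangle_def Hom_full_sub)
  have "X \<in> S \<and> Y \<in> S \<and> Z \<in> S" if "triangle (full_sub T S) X Y Z f g h"
    using that Hom_full_subD unfolding triangle_def by fast
  with eq show ?thesis by blast
qed

lemma dist_triangle_full_sub:
  assumes "susp_obj T ` S = S"
  shows "dist_triangle (full_sub T S) X Y Z f g h \<longleftrightarrow>
    X \<in> S \<and> Y \<in> S \<and> Z \<in> S \<and> dist_triangle T X Y Z f g h"
  unfolding dist_triangle_def triangle_full_sub[OF assms]
  by (auto simp: full_sub_def triangle_def Hom_def)

lemma iso_in_full_sub:
  "iso_in (full_sub T S) X Y f \<longleftrightarrow> X \<in> S \<and> Y \<in> S \<and> iso_in T X Y f"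
  unfolding iso_in_def by (auto simp: Hom_full_sub dest: Hom_full_subD)

lemma (in linear_category) zero_object_iff:
  "zero_object C Z \<longleftrightarrow> Z \<in> Obj C \<and> Ident C Z = Zero C Z Z"
proof (intro iffI conjI)
  assume "zero_object C Z"
  then have Z: "Z \<in> Obj C" "\<exists>!f. f \<in> Hom C Z Z" by (auto simp: zero_object_def)
  then show "Z \<in> Obj C" by simp
  interpret M: module R "hom_module C Z Z" using hom_module Z by blast
  have "Zero C Z Z \<in> Hom C Z Z"
    using M.M.zero_closed by (simp add: hom_module_def)
  then show "Ident C Z = Zero C Z Z" using Z Ident_Hom by blast
next
  assume a: "Z \<in> Obj C \<and> Ident C Z = Zero C Z Z"
  have comp0: "f \<cdot>\<^bsub>C\<^esub> Zero C Z Z = Zero C Z X" if "f \<in> Hom C Z X" "X \<in> Obj C" for f X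
  proof -
    interpret M: module R "hom_module C Z Z" using hom_module a by blast
    interpret N: module R "hom_module C Z X" using hom_module a that by blast
    have z: "Zero C Z Z \<in> Hom C Z Z" "Add C (Zero C Z Z) (Zero C Z Z) = Zero C Z Z"
      using M.M.zero_closed M.M.l_zero[OF M.M.zero_closed] by (simp_all add: hom_module_def)
    have c: "f \<cdot>\<^bsub>C\<^esub> Zero C Z Z \<in> Hom C Z X" using Comp_Hom z that by blast
    have "f \<cdot>\<^bsub>C\<^esub> Zero C Z Z = Add C (f \<cdot>\<^bsub>C\<^esub> Zero C Z Z) (f \<cdot>\<^bsub>C\<^esub> Zero C Z Z)"
      using Comp_Add_right[OF z(1) z(1) that(1)] z(2) by simp
    then show ?thesis
      using N.M.add.l_cancel_one'[of "f \<cdot>\<^bsub>C\<^esub> Zero C Z Z" "f \<cdot>\<^bsub>C\<^esub> Zero C Z Z"] c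
      by (simp add: hom_module_def)
  qed
  have comp0': "Zero C Z Z \<cdot>\<^bsub>C\<^esub> f = Zero C X Z" if "f \<in> Hom C X Z" "X \<in> Obj C" for f X
  proof -
    interpret M: module R "hom_module C Z Z" using hom_module a by blast
    interpret N: module R "hom_module C X Z" using hom_module a that by blast
    have z: "Zero C Z Z \<in> Hom C Z Z" "Add C (Zero C Z Z) (Zero C Z Z) = Zero C Z Z"
      using M.M.zero_closed M.M.l_zero[OF M.M.zero_closed] by (simp_all add: hom_module_def)
    have c: "Zero C Z Z \<cdot>\<^bsub>C\<^esub> f \<in> Hom C X Z" using Comp_Hom z that by blast
    have "Zero C Z Z \<cdot>\<^bsub>C\<^esub> f = Add C (Zero C Z Z \<cdot>\<^bsub>C\<^esub> f) (Zero C Z Z \<cdot>\<^bsub>C\<^esub> f)"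
      using Comp_Add_left[OF that(1) z(1) z(1)] z(2) by simp
    then show ?thesis
      using N.M.add.l_cancel_one'[of "Zero C Z Z \<cdot>\<^bsub>C\<^esub> f" "Zero C Z Z \<cdot>\<^bsub>C\<^esub> f"] c
      by (simp add: hom_module_def)
  qed
  have ex: "Zero C X Y \<in> Hom C X Y" if "X \<in> Obj C" "Y \<in> Obj C" for X Y
  proof -
    interpret M: module R "hom_module C X Y" using hom_module that by blast
    show ?thesis using M.M.zero_closed by (simp add: hom_module_def)
  qed
  show "zero_object C Z"
    unfolding zero_object_def
  proof (intro conjI ballI)
    fix X assume X: "X \<in> Obj C"
    show "\<exists>!f. f \<in> Hom C Z X"
      using ex a X comp0 Comp_Ident_right by metis
    show "\<exists>!f. f \<in> Hom C X Z"
      using ex a X comp0' Comp_Ident_left by metis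
  qed (use a in auto)
qed

lemma full_sub_linear_triangulated:
  assumes T: "linear_triangulated_category R T" and S: "triangulated_subcategory T S"
  shows "linear_triangulated_category R (full_sub T S)"
proof -
  interpret linear_triangulated_category R T by (rule T)
  have SO: "X \<in> Obj T" if "X \<in> S" for X
    using S that unfolding triangulated_subcategory_def by (elim conjE) (rule subsetD)
  have coprod: "has_finite_coproducts (full_sub T S)" and SS: "susp_obj T ` S = S"
    and cone: "\<And>X Y f. X \<in> S \<Longrightarrow> Y \<in> S \<Longrightarrow> f \<in> Hom T X Y \<Longrightarrow>
      \<exists>Z \<in> S. \<exists>g h. dist_triangle T X Y Z f g h"
    using S unfolding triangulated_subcategory_def by simp_all
  have Ss: "susp_obj T X \<in> S" if "X \<in> S" for X
    using imageI[OF that, of "susp_obj T"] SS by simp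
  note dt = dist_triangle_full_sub[OF SS] and tr = triangle_full_sub[OF SS]
  have lin: "linear_category R (full_sub T S)"
  proof (intro linear_category.intro category.intro linear_category_axioms.intro, goal_cases)
    case (1 f) then show ?case by (simp add: full_sub_def)
  next
    case (2 f) then show ?case by (simp add: full_sub_def)
  next
    case (3 X) then show ?case using Ident_Hom SO by (simp add: Hom_full_sub)
  next
    case (4 f X Y g Z)
    then show ?case using Comp_Hom[of f X Y g Z] Hom_full_sub[of X S Z T]
      by (auto dest!: Hom_full_subD)
  next
    case (5 f X Y) then show ?case using Comp_Ident_right by (auto dest!: Hom_full_subD)
  next
    case (6 f X Y) then show ?case using Comp_Ident_left by (auto dest!: Hom_full_subD)
  next
    case (7 f W X g Y h Z)
    then show ?case using Comp_assoc[of f W X g Y h Z] by (auto dest!: Hom_full_subD)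
  next
    case (8 X Y) then show ?case using hom_module SO by (simp add: hom_module_full_sub)
  next
    case (9 f X Y f' g Z)
    then show ?case using Comp_Add_right[of f X Y f' g Z] by (auto dest!: Hom_full_subD)
  next
    case (10 f X Y g Z g')
    then show ?case using Comp_Add_left[of f X Y g Z g'] by (auto dest!: Hom_full_subD)
  next
    case (11 r f X Y g Z)
    then show ?case using Comp_Scale_right[of r f X Y g Z] by (auto dest!: Hom_full_subD)
  next
    case (12 r f X Y g Z)
    then show ?case using Comp_Scale_left[of r f X Y g Z] by (auto dest!: Hom_full_subD)
  qed
  interpret L: linear_category R "full_sub T S" by (rule lin)
  show ?thesis
  proof (unfold_locales, goal_cases)
    case 1 show ?case by (rule coprod)
  next
    case 2
    have "is_functor T T (Susp T)" by (rule Susp_functor)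
    then show ?case unfolding is_functor_def
      by (simp add: Hom_full_sub SO Ss) (use SO in blast)
  next
    case 3 show ?case
      using inj_on_subset[OF bij_betw_imp_inj_on[OF Susp_bij_Obj], of S] SO SS
      by (simp add: bij_betw_def subset_iff)
  next
    case 4
    have dom: "Dom T (susp_arr T f) = susp_obj T (Dom T f)"
      and cod: "Cod T (susp_arr T f) = susp_obj T (Cod T f)" if "f \<in> Arr T" for f
    proof -
      have "f \<in> Hom T (Dom T f) (Cod T f)" using that by (simp add: Hom_def)
      then have "susp_arr T f \<in> Hom T (susp_obj T (Dom T f)) (susp_obj T (Cod T f))"
        using Susp_functor Dom_Obj[OF that] Cod_Obj[OF that] unfolding is_functor_def by blast
      then show "Dom T (susp_arr T f) = susp_obj T (Dom T f)"
        "Cod T (susp_arr T f) = susp_obj T (Cod T f)" by (auto simp: Hom_def)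
    qed
    have refl_S: "X \<in> S" if X: "susp_obj T X \<in> S" "X \<in> Obj T" for X
    proof -
      obtain X' where "X' \<in> S" "susp_obj T X' = susp_obj T X"
        using equalityD2[OF SS, THEN subsetD, OF X(1)] by (elim imageE) simp
      then show ?thesis using X SO Susp_bij_Obj unfolding bij_betw_def inj_on_def by metis
    qed
    have "inj_on (susp_arr T) (Arr (full_sub T S))"
      using Susp_bij_Arr unfolding bij_betw_def
      by (auto simp: full_sub_def intro: inj_on_subset)
    moreover have "susp_arr T ` Arr (full_sub T S) = Arr (full_sub T S)"
    proof (intro equalityI subsetI)
      fix g assume "g \<in> susp_arr T ` Arr (full_sub T S)"
      then obtain f where "f \<in> Arr T" "Dom T f \<in> S" "Cod T f \<in> S" "g = susp_arr T f"
        by (auto simp: full_sub_def)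
      then show "g \<in> Arr (full_sub T S)"
        using Susp_bij_Arr dom cod Ss by (auto simp: full_sub_def bij_betw_def)
    next
      fix g assume g: "g \<in> Arr (full_sub T S)"
      then have "g \<in> Arr T" by (simp add: full_sub_def)
      then obtain f where f: "f \<in> Arr T" "g = susp_arr T f"
        using Susp_bij_Arr unfolding bij_betw_def by blast
      with g show "g \<in> susp_arr T ` Arr (full_sub T S)"
        using dom cod refl_S Dom_Obj Cod_Obj by (auto simp: full_sub_def)
    qed
    ultimately show ?case by (simp add: bij_betw_def)
  next
    case 5 then show ?case using Susp_Add by (auto dest!: Hom_full_subD)
  next
    case (6 f g h)
    then have "(f, g, h) \<in> Dist T" "Dom T f \<in> S" "Cod T f \<in> S" "Cod T g \<in> S"
      by (auto simp: full_sub_def)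
    moreover from this obtain X Y Z where "triangle T X Y Z f g h" using Dist_triangle by blast
    moreover from this have "Dom T f = X" "Cod T f = Y" "Cod T g = Z"
      by (auto simp: triangle_def Hom_def)
    ultimately have "triangle (full_sub T S) X Y Z f g h" by (simp add: tr)
    then show ?case by blast
  next
    case (7 X Y Z f g h X' Y' Z' f' g' h' a b c)
    then show ?case unfolding dt tr iso_in_full_sub full_sub_simps
      using TR1_iso[of X Y Z f g h X' Y' Z' f' g' h' a b c] by blast
  next
    case (8 X Z)
    then have "zero_object T Z" using SO zero_object_iff L.zero_object_iff by simp
    moreover have "Z \<in> S" using 8 by (simp add: zero_object_def)
    ultimately show ?case using TR1_Ident 8 SO dt by simp
  next
    case (9 f X Y)
    then have "f \<in> Hom T X Y" "X \<in> S" "Y \<in> S" by (auto dest: Hom_full_subD)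
    with cone[of X Y f] show ?case by (auto simp: dt)
  next
    case (10 X Y Z f g h)
    then have x: "triangle T X Y Z f g h" "X \<in> S" "Y \<in> S" "Z \<in> S" by (simp_all add: tr)
    show ?case using TR2[OF x(1)] x Ss by (simp add: dt hom_module_full_sub)
  next
    case (11 X Y Z f g h X' Y' Z' f' g' h' a b)
    then have x: "dist_triangle T X Y Z f g h" "dist_triangle T X' Y' Z' f' g' h'"
      "a \<in> Hom T X X'" "b \<in> Hom T Y Y'" "b \<cdot>\<^bsub>T\<^esub> f = f' \<cdot>\<^bsub>T\<^esub> a" "Z \<in> S" "Z' \<in> S"
      by (auto simp: dt dest: Hom_full_subD)
    show ?case using TR3[OF x(1-5)] x(6,7) by (simp add: Hom_full_sub)
  next
    case (12 X Y Q1 f p1 d1 Z Q3 g p3 d3 Q2 p2 d2)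
    then have x: "dist_triangle T X Y Q1 f p1 d1" "dist_triangle T Y Z Q3 g p3 d3"
      "dist_triangle T X Z Q2 (g \<cdot>\<^bsub>T\<^esub> f) p2 d2" "Q1 \<in> S" "Q2 \<in> S" "Q3 \<in> S"
      by (auto simp: dt)
    show ?case using TR4[OF x(1-3)] x(4-6) by (simp add: dt)
  qed
qed

end

theory Submission
  imports Defs
begin

text \<open>
  Write \<open>\<Sigma>\<close> for the suspension.  Call \<open>a: A \<rightarrow> t\<close> a cover of \<open>t\<close> relative to a class of objects if
  every arrow to \<open>t\<close> from an object of the class lifts along \<open>a\<close>, and a coreflection of \<open>t\<close> in \<open>S\<close> if
  \<open>A\<close> lies in \<open>S\<close> and arrows from objects of \<open>S\<close> lift uniquely.  The inclusion of \<open>S\<close> has a right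
  adjoint if and only if every object has a coreflection, and a left adjoint if and only if the
  same holds in the opposite category (\<open>adjoints_iff\<close>).

  Suppose that one of the adjoints exists, say coreflections do.  An idempotent of an object of \<open>S\<close>
  splits through some object of \<open>T\<close>, hence also through the coreflection of that object
  (\<open>karoubian_subcategory\<close>).  The coreflection \<open>G'\<close> of a strong generator \<open>G\<close> of \<open>T\<close> is a strong
  generator of \<open>S\<close>: by induction on \<open>n\<close>, a coreflection of an object of \<open>\<langle>G\<rangle>\<^sub>n\<close> lies in
  \<open>\<langle>G'\<rangle>\<^sub>n\<close>, because \<open>S\<close>-covers of the outer terms of a triangle extend to an \<open>S\<close>-cover of the
  middle term (\<open>covers_middle\<close>), because the coreflection of a summand of \<open>y\<close> is a retract of any
  \<open>S\<close>-cover of \<open>y\<close> that lies in \<open>S\<close>, and because the objects of \<open>S\<close> are their own coreflections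
  (\<open>regular_subcategory\<close>).

  It remains to see that a Karoubian \<open>S\<close> with a strong generator \<open>G'\<close> inside a proper \<open>T\<close> has
  coreflections and reflections (\<open>coreflections_exist\<close>); this is a form of the representability
  theorem of Bondal and Van den Bergh, proved here inside \<open>T\<close>.  Let \<open>t\<close> be an object of \<open>T\<close>.
  Properness says that the modules \<open>Hom(\<Sigma>\<^sup>kG', t)\<close> are finitely generated and almost all zero, so a
  finite coproduct of suspensions of \<open>G'\<close> covers \<open>t\<close> relative to all of them.  If all objects of \<open>T\<close> have
  covers in \<open>S\<close> relative to \<open>P\<close> and relative to \<open>Q\<close>, then they have covers in \<open>S\<close> relative to extensions of
  objects of \<open>Q\<close> by objects of \<open>P\<close> (\<open>covers_extension\<close>).  After finitely many steps \<open>t\<close> has a cover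
  \<open>F \<rightarrow> t\<close> relative to \<open>\<langle>G'\<rangle>\<^sub>n = S\<close>.  Killing the kernel of this cover by a second one produces an
  object of \<open>S\<close> of which the functor \<open>Hom(-, t)\<close> on \<open>S\<close> is a retract, and splitting the resulting
  idempotent gives the coreflection (\<open>coreflection_if_covers\<close>).

  Half of these statements concern the opposite category.  The arguments about triangles are
  therefore carried out in a locale \<open>triangle_pair\<close> whose assumptions are invariant under reversing
  all arrows.
\<close>

section \<open>Sums of arrows in linear categories\<close>

definition arrow_sum ::
    "('o, 'm, 'r, 'x) lin_cat_scheme \<Rightarrow> 'o \<Rightarrow> 'o \<Rightarrow> ('i \<Rightarrow> 'm) \<Rightarrow> 'i set \<Rightarrow> 'm" where
  "arrow_sum C X Y f I = finsum (hom_module C X Y) f I"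

context linear_category
begin

lemma Hom_Obj: "f \<in> Hom C X Y \<Longrightarrow> X \<in> Obj C \<and> Y \<in> Obj C"
  using Dom_Obj Cod_Obj by (auto simp: Hom_def)

lemma hom_abelian_group: "X \<in> Obj C \<Longrightarrow> Y \<in> Obj C \<Longrightarrow> abelian_group (hom_module C X Y)"
  using hom_module by (auto simp: module_def)

lemma Zero_Hom: "X \<in> Obj C \<Longrightarrow> Y \<in> Obj C \<Longrightarrow> Zero C X Y \<in> Hom C X Y"
  using abelian_group.axioms(1)[OF hom_abelian_group, THEN abelian_monoid.zero_closed]
  by (simp add: hom_module_def)

lemma Add_Hom: "f \<in> Hom C X Y \<Longrightarrow> g \<in> Hom C X Y \<Longrightarrow> Add C f g \<in> Hom C X Y"
  using abelian_monoid.a_closed[OF abelian_group.axioms(1)[OF hom_abelian_group], of X Y f g] Hom_Obj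
  by (simp add: hom_module_def)

lemma Scale_Hom: "r \<in> carrier R \<Longrightarrow> f \<in> Hom C X Y \<Longrightarrow> Scale C r f \<in> Hom C X Y"
  using module.smult_closed[OF hom_module, of X Y r f] Hom_Obj
  by (simp add: hom_module_def)

lemma Add_Zero:
  assumes "f \<in> Hom C X Y"
  shows "Add C (Zero C X Y) f = f" "Add C f (Zero C X Y) = f"
proof -
  interpret M: abelian_group "hom_module C X Y" using hom_abelian_group Hom_Obj assms by blast
  show "Add C (Zero C X Y) f = f" "Add C f (Zero C X Y) = f"
    using M.l_zero[of f] M.r_zero[of f] assms by (simp_all add: hom_module_def)
qed

lemma Add_idem_Zero:
  assumes f: "f \<in> Hom C X Y" and "Add C f f = f"
  shows "f = Zero C X Y"
proof -
  interpret M: abelian_group "hom_module C X Y" using hom_abelian_group Hom_Obj f by blast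
  show ?thesis using M.add.l_cancel_one'[of f f] assms by (simp add: hom_module_def)
qed

lemma Comp_Zero_right:
  assumes "g \<in> Hom C Y Z" "X \<in> Obj C"
  shows "g \<cdot>\<^bsub>C\<^esub> Zero C X Y = Zero C X Z"
proof -
  have z: "Zero C X Y \<in> Hom C X Y" using Zero_Hom Hom_Obj assms by blast
  show ?thesis
    using Comp_Add_right[OF z z assms(1)] Add_Zero[OF z] Comp_Hom[OF z assms(1)]
      Add_idem_Zero by simp
qed

lemma Comp_Zero_left:
  assumes "f \<in> Hom C X Y" "Z \<in> Obj C"
  shows "Zero C Y Z \<cdot>\<^bsub>C\<^esub> f = Zero C X Z"
proof -
  have z: "Zero C Y Z \<in> Hom C Y Z" using Zero_Hom Hom_Obj assms by blast
  show ?thesis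
    using Comp_Add_left[OF assms(1) z z] Add_Zero[OF z] Comp_Hom[OF assms(1) z]
      Add_idem_Zero by simp
qed

text \<open>Diagram chases subtract parallel arrows; this packages the difference \<open>d\<close> of \<open>f\<close> and \<open>f'\<close>
  together with the two ways in which it vanishes.\<close>

lemma difference:
  assumes "f \<in> Hom C X Y" "f' \<in> Hom C X Y"
  obtains d where "d \<in> Hom C X Y" "f = Add C f' d"
    "\<And>Z g. g \<in> Hom C Y Z \<Longrightarrow> g \<cdot>\<^bsub>C\<^esub> f = g \<cdot>\<^bsub>C\<^esub> f' \<Longrightarrow> g \<cdot>\<^bsub>C\<^esub> d = Zero C X Z"
    "\<And>W g. g \<in> Hom C W X \<Longrightarrow> f \<cdot>\<^bsub>C\<^esub> g = f' \<cdot>\<^bsub>C\<^esub> g \<Longrightarrow> d \<cdot>\<^bsub>C\<^esub> g = Zero C W Y"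
proof -
  interpret M: abelian_group "hom_module C X Y" using hom_abelian_group Hom_Obj assms by blast
  define d where "d = (\<ominus>\<^bsub>hom_module C X Y\<^esub> f') \<oplus>\<^bsub>hom_module C X Y\<^esub> f"
  have carr: "f \<in> carrier (hom_module C X Y)" "f' \<in> carrier (hom_module C X Y)"
    using assms by (simp_all add: hom_module_def)
  then have "d \<in> carrier (hom_module C X Y)" by (simp add: d_def)
  then have d: "d \<in> Hom C X Y" by (simp add: hom_module_def)
  have "f' \<oplus>\<^bsub>hom_module C X Y\<^esub> d = f" using carr by (simp add: d_def M.r_neg2)
  then have f: "f = Add C f' d" by (simp add: hom_module_def)
  show thesis
  proof (rule that[OF d f])
    fix Z g assume g: "g \<in> Hom C Y Z" and eq: "g \<cdot>\<^bsub>C\<^esub> f = g \<cdot>\<^bsub>C\<^esub> f'"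
    interpret N: abelian_group "hom_module C X Z" using hom_abelian_group Hom_Obj assms g by blast
    have "Add C (g \<cdot>\<^bsub>C\<^esub> f') (g \<cdot>\<^bsub>C\<^esub> d) = g \<cdot>\<^bsub>C\<^esub> f'"
      using Comp_Add_right[OF assms(2) d g] eq f by simp
    then show "g \<cdot>\<^bsub>C\<^esub> d = Zero C X Z"
      using N.add.l_cancel_one[of "g \<cdot>\<^bsub>C\<^esub> f'" "g \<cdot>\<^bsub>C\<^esub> d"] Comp_Hom[OF d g] Comp_Hom[OF assms(2) g]
      by (simp add: hom_module_def)
  next
    fix W g assume g: "g \<in> Hom C W X" and eq: "f \<cdot>\<^bsub>C\<^esub> g = f' \<cdot>\<^bsub>C\<^esub> g"
    interpret N: abelian_group "hom_module C W Y" using hom_abelian_group Hom_Obj assms g by blast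
    have "Add C (f' \<cdot>\<^bsub>C\<^esub> g) (d \<cdot>\<^bsub>C\<^esub> g) = f' \<cdot>\<^bsub>C\<^esub> g"
      using Comp_Add_left[OF g assms(2) d] eq f by simp
    then show "d \<cdot>\<^bsub>C\<^esub> g = Zero C W Y"
      using N.add.l_cancel_one[of "f' \<cdot>\<^bsub>C\<^esub> g" "d \<cdot>\<^bsub>C\<^esub> g"] Comp_Hom[OF g d] Comp_Hom[OF g assms(2)]
      by (simp add: hom_module_def)
  qed
qed

lemma difference_left:
  assumes "f \<in> Hom C X Y" "f' \<in> Hom C X Y" "g \<in> Hom C Y Z" "g \<cdot>\<^bsub>C\<^esub> f = g \<cdot>\<^bsub>C\<^esub> f'"
  obtains d where "d \<in> Hom C X Y" "f = Add C f' d" "g \<cdot>\<^bsub>C\<^esub> d = Zero C X Z"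
proof (rule difference[OF assms(1,2)])
  fix d assume "d \<in> Hom C X Y" "f = Add C f' d"
    "\<And>Z g. g \<in> Hom C Y Z \<Longrightarrow> g \<cdot>\<^bsub>C\<^esub> f = g \<cdot>\<^bsub>C\<^esub> f' \<Longrightarrow> g \<cdot>\<^bsub>C\<^esub> d = Zero C X Z"
  then show thesis using that assms(3,4) by simp
qed

lemma arrow_sum_empty:
  assumes "X \<in> Obj C" "Y \<in> Obj C"
  shows "arrow_sum C X Y f {} = Zero C X Y"
proof -
  interpret M: abelian_group "hom_module C X Y" using hom_abelian_group assms by blast
  show ?thesis by (simp add: arrow_sum_def) (simp add: hom_module_def)
qed

lemma arrow_sum_insert:
  assumes "finite I" "i \<notin> I" "\<And>j. j \<in> insert i I \<Longrightarrow> f j \<in> Hom C X Y"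
  shows "arrow_sum C X Y f (insert i I) = Add C (f i) (arrow_sum C X Y f I)"
proof -
  have "f i \<in> Hom C X Y" using assms(3) by simp
  then interpret M: abelian_group "hom_module C X Y" using hom_abelian_group Hom_Obj by blast
  show ?thesis
    using M.finsum_insert[of I i f] assms by (simp add: arrow_sum_def hom_module_def)
qed

lemma arrow_sum_Hom:
  assumes "X \<in> Obj C" "Y \<in> Obj C" "\<And>j. j \<in> I \<Longrightarrow> f j \<in> Hom C X Y"
  shows "arrow_sum C X Y f I \<in> Hom C X Y"
proof -
  interpret M: abelian_group "hom_module C X Y" using hom_abelian_group assms by blast
  show ?thesis
    using M.finsum_closed[of f I] assms by (simp add: arrow_sum_def hom_module_def Pi_def)
qed

lemma arrow_sum_cong:
  assumes "X \<in> Obj C" "Y \<in> Obj C" "\<And>j. j \<in> I \<Longrightarrow> f j = g j" "\<And>j. j \<in> I \<Longrightarrow> g j \<in> Hom C X Y"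
  shows "arrow_sum C X Y f I = arrow_sum C X Y g I"
proof -
  interpret M: abelian_group "hom_module C X Y" using hom_abelian_group assms by blast
  show ?thesis
    using M.finsum_cong'[of I I g f] assms by (simp add: arrow_sum_def hom_module_def Pi_def)
qed

lemma Comp_arrow_sum_right:
  assumes "finite I" "X \<in> Obj C" "g \<in> Hom C Y Z" "\<And>j. j \<in> I \<Longrightarrow> f j \<in> Hom C X Y"
  shows "g \<cdot>\<^bsub>C\<^esub> arrow_sum C X Y f I = arrow_sum C X Z (\<lambda>j. g \<cdot>\<^bsub>C\<^esub> f j) I"
  using assms(1,4)
proof induction
  case empty
  then show ?case using assms Hom_Obj[OF assms(3)] by (simp add: arrow_sum_empty Comp_Zero_right)
next
  case (insert i I)
  have "arrow_sum C X Y f I \<in> Hom C X Y"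
    using insert.prems assms(2,3) Hom_Obj by (intro arrow_sum_Hom) auto
  moreover have "f j \<in> Hom C X Y" "g \<cdot>\<^bsub>C\<^esub> f j \<in> Hom C X Z" if "j \<in> insert i I" for j
    using insert.prems[OF that] Comp_Hom[OF insert.prems[OF that] assms(3)] .
  ultimately show ?case
    using insert.hyps insert.IH assms(3) arrow_sum_insert[of I i f X Y]
      arrow_sum_insert[of I i "\<lambda>j. g \<cdot>\<^bsub>C\<^esub> f j" X Z] Comp_Add_right[of "f i" X Y "arrow_sum C X Y f I" g Z]
    by simp
qed

lemma Comp_arrow_sum_left:
  assumes "finite I" "Z \<in> Obj C" "f \<in> Hom C X Y" "\<And>j. j \<in> I \<Longrightarrow> g j \<in> Hom C Y Z"
  shows "arrow_sum C Y Z g I \<cdot>\<^bsub>C\<^esub> f = arrow_sum C X Z (\<lambda>j. g j \<cdot>\<^bsub>C\<^esub> f) I"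
  using assms(1,4)
proof induction
  case empty
  then show ?case using assms Hom_Obj[OF assms(3)] by (simp add: arrow_sum_empty Comp_Zero_left)
next
  case (insert i I)
  have "arrow_sum C Y Z g I \<in> Hom C Y Z"
    using insert.prems assms(2,3) Hom_Obj by (intro arrow_sum_Hom) auto
  moreover have "g j \<in> Hom C Y Z" "g j \<cdot>\<^bsub>C\<^esub> f \<in> Hom C X Z" if "j \<in> insert i I" for j
    using insert.prems[OF that] Comp_Hom[OF assms(3) insert.prems[OF that]] .
  ultimately show ?case
    using insert.hyps insert.IH assms(3) arrow_sum_insert[of I i g Y Z]
      arrow_sum_insert[of I i "\<lambda>j. g j \<cdot>\<^bsub>C\<^esub> f" X Z] Comp_Add_left[of f X Y "g i" Z "arrow_sum C Y Z g I"]
    by simp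
qed

lemma arrow_sum_Zero:
  assumes "finite I" "X \<in> Obj C" "Y \<in> Obj C" "\<And>j. j \<in> I \<Longrightarrow> f j = Zero C X Y"
  shows "arrow_sum C X Y f I = Zero C X Y"
  using assms(1,4)
proof induction
  case (insert i I)
  then show ?case
    using Zero_Hom[OF assms(2,3)] by (subst arrow_sum_insert) (auto simp: Add_Zero)
qed (simp add: arrow_sum_empty assms)

lemma arrow_sum_single:
  assumes "finite I" "i \<in> I" "f i \<in> Hom C X Y" "\<And>j. j \<in> I \<Longrightarrow> j \<noteq> i \<Longrightarrow> f j = Zero C X Y"
  shows "arrow_sum C X Y f I = f i"
proof -
  have o: "X \<in> Obj C" "Y \<in> Obj C" using assms(3) Hom_Obj by blast+
  have "arrow_sum C X Y f (insert i (I - {i})) = Add C (f i) (arrow_sum C X Y f (I - {i}))"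
    using assms o Zero_Hom by (intro arrow_sum_insert) (auto, metis)
  also have "arrow_sum C X Y f (I - {i}) = Zero C X Y" using assms o by (intro arrow_sum_Zero) auto
  finally show ?thesis using assms by (simp add: insert_absorb Add_Zero)
qed

end

section \<open>Opposite categories\<close>

definition opposite :: "('o, 'm, 'r, 'x) lin_cat_scheme \<Rightarrow> ('o, 'm, 'r, 'x) lin_cat_scheme" where
  "opposite C = C\<lparr>Dom := Cod C, Cod := Dom C, Comp := (\<lambda>g f. f \<cdot>\<^bsub>C\<^esub> g), Zero := (\<lambda>X Y. Zero C Y X)\<rparr>"

lemma opposite_simps [simp]:
  "Obj (opposite C) = Obj C" "Arr (opposite C) = Arr C"
  "Ident (opposite C) = Ident C" "g \<cdot>\<^bsub>opposite C\<^esub> f = f \<cdot>\<^bsub>C\<^esub> g"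
  "Zero (opposite C) X Y = Zero C Y X" "Add (opposite C) = Add C" "Scale (opposite C) = Scale C"
  "Hom (opposite C) X Y = Hom C Y X" "hom_module (opposite C) X Y = hom_module C Y X"
  by (auto simp: opposite_def Hom_def hom_module_def)

lemma arrow_sum_opposite [simp]: "arrow_sum (opposite C) X Y = arrow_sum C Y X"
  by (simp add: arrow_sum_def fun_eq_iff)

lemma (in linear_category) linear_category_opposite: "linear_category R (opposite C)"
proof (intro linear_category.intro category.intro linear_category_axioms.intro, goal_cases)
  case (1 f) then show ?case using Cod_Obj by (simp add: opposite_def)
next
  case (2 f) then show ?case using Dom_Obj by (simp add: opposite_def)
next
  case (7 f W X g Y h Z) then show ?case using Comp_assoc[of h Z Y g X f W] by simp
next
  case (12 r f X Y g Z) then show ?case using Comp_Scale_right by simp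
qed (auto simp: Ident_Hom Comp_Hom Comp_Ident_left Comp_Ident_right hom_module
    Comp_Add_left Comp_Add_right Comp_Scale_left)

section \<open>Covers, coreflections and biproducts\<close>

text \<open>In the opposite category a cover is an arrow \<open>t \<rightarrow> A\<close> through which all arrows from \<open>t\<close> to the
  objects of the class factor, and a coreflection is a reflection of \<open>t\<close> in \<open>S\<close>.  The object \<open>A\<close> of a
  cover is arbitrary; membership in \<open>S\<close> is required separately.\<close>

definition covers :: "('o, 'm, 'x) cat_scheme \<Rightarrow> 'o set \<Rightarrow> 'o \<Rightarrow> 'o \<Rightarrow> 'm \<Rightarrow> bool" where
  "covers C P A t a \<longleftrightarrow>
     a \<in> Hom C A t \<and> (\<forall>p \<in> P. \<forall>f \<in> Hom C p t. \<exists>l \<in> Hom C p A. a \<cdot>\<^bsub>C\<^esub> l = f)"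

definition coreflection :: "('o, 'm, 'x) cat_scheme \<Rightarrow> 'o set \<Rightarrow> 'o \<Rightarrow> 'o \<Rightarrow> 'm \<Rightarrow> bool" where
  "coreflection C S A t a \<longleftrightarrow> A \<in> S \<and> covers C S A t a \<and>
     (\<forall>s \<in> S. \<forall>k \<in> Hom C s A. \<forall>l \<in> Hom C s A. a \<cdot>\<^bsub>C\<^esub> k = a \<cdot>\<^bsub>C\<^esub> l \<longrightarrow> k = l)"

definition retract :: "('o, 'm, 'x) cat_scheme \<Rightarrow> 'o \<Rightarrow> 'o \<Rightarrow> bool" where
  "retract C x y \<longleftrightarrow> (\<exists>i \<in> Hom C x y. \<exists>r \<in> Hom C y x. r \<cdot>\<^bsub>C\<^esub> i = Ident C x)"

text \<open>The equational description makes the notion visibly self-dual: in the opposite category the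
  injections and the projections change places.\<close>

definition biproduct ::
    "('o, 'm, 'r, 'x) lin_cat_scheme \<Rightarrow> 'i set \<Rightarrow> ('i \<Rightarrow> 'o) \<Rightarrow> 'o \<Rightarrow> ('i \<Rightarrow> 'm) \<Rightarrow> ('i \<Rightarrow> 'm) \<Rightarrow> bool"
  where
  "biproduct C I A Y \<iota> \<pi> \<longleftrightarrow>
     Y \<in> Obj C \<and> (\<forall>i \<in> I. \<iota> i \<in> Hom C (A i) Y \<and> \<pi> i \<in> Hom C Y (A i)) \<and>
     (\<forall>i \<in> I. \<forall>j \<in> I. \<pi> j \<cdot>\<^bsub>C\<^esub> \<iota> i = (if i = j then Ident C (A i) else Zero C (A i) (A j))) \<and>
     arrow_sum C Y Y (\<lambda>i. \<iota> i \<cdot>\<^bsub>C\<^esub> \<pi> i) I = Ident C Y"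

lemma retract_opposite [simp]: "retract (opposite C) x y \<longleftrightarrow> retract C x y"
  unfolding retract_def by auto

lemma biproduct_opposite: "biproduct C I A Y \<iota> \<pi> \<Longrightarrow> biproduct (opposite C) I A Y \<pi> \<iota>"
  unfolding biproduct_def by auto

lemma coversE:
  assumes "covers C P A t a" "p \<in> P" "f \<in> Hom C p t"
  obtains l where "l \<in> Hom C p A" "a \<cdot>\<^bsub>C\<^esub> l = f"
  using assms unfolding covers_def by blast

lemma covers_Hom: "covers C P A t a \<Longrightarrow> a \<in> Hom C A t"
  by (simp add: covers_def)

lemma coreflection_cancel:
  assumes "coreflection C S A t a" "s \<in> S" "k \<in> Hom C s A" "l \<in> Hom C s A"
    "a \<cdot>\<^bsub>C\<^esub> k = a \<cdot>\<^bsub>C\<^esub> l"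
  shows "k = l"
  using assms unfolding coreflection_def by blast

context category
begin

text \<open>To lift an arrow from a retract of \<open>y\<close>, extend it to \<open>y\<close>, lift and restrict.\<close>

lemma covers_retracts:
  assumes a: "covers C P A t a" and Q: "\<And>x. x \<in> Q \<Longrightarrow> \<exists>y \<in> P. retract C x y"
  shows "covers C Q A t a"
  unfolding covers_def
proof (intro conjI ballI)
  show "a \<in> Hom C A t" by (rule covers_Hom[OF a])
next
  fix x f assume x: "x \<in> Q" and f: "f \<in> Hom C x t"
  obtain y i r where y: "y \<in> P" and i: "i \<in> Hom C x y" and r: "r \<in> Hom C y x"
    and ri: "r \<cdot> i = Ident C x"
    using Q[OF x] unfolding retract_def by blast
  obtain l where l: "l \<in> Hom C y A" and al: "a \<cdot> l = f \<cdot> r"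
    by (rule coversE[OF a y Comp_Hom[OF r f]])
  have "a \<cdot> (l \<cdot> i) = f"
    using Comp_assoc[OF i l covers_Hom[OF a]] Comp_assoc[OF i r f] al ri Comp_Ident_right[OF f]
    by simp
  then show "\<exists>l \<in> Hom C x A. a \<cdot> l = f" using Comp_Hom[OF i l] by blast
qed

text \<open>Mapping the coreflection to a retract \<open>x\<close> of \<open>y\<close> back and forth through a cover of \<open>y\<close>
  produces an endomorphism over \<open>x\<close>, which must be the identity.\<close>

lemma coreflection_retract:
  assumes c: "coreflection C S x' x c" and "retract C x y" and m: "covers C S M y m" and M: "M \<in> S"
  shows "retract C x' M"
proof -
  obtain i r where i: "i \<in> Hom C x y" and r: "r \<in> Hom C y x" and ri: "r \<cdot> i = Ident C x"
    using assms(2) unfolding retract_def by blast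
  have x': "x' \<in> S" and cov: "covers C S x' x c" using c by (simp_all add: coreflection_def)
  note cH = covers_Hom[OF cov] and mH = covers_Hom[OF m]
  have x'O: "x' \<in> Obj C" using Dom_Obj cH by (auto simp: Hom_def)
  obtain j where j: "j \<in> Hom C x' M" and mj: "m \<cdot> j = i \<cdot> c"
    by (rule coversE[OF m x' Comp_Hom[OF cH i]])
  obtain q where q: "q \<in> Hom C M x'" and cq: "c \<cdot> q = r \<cdot> m"
    by (rule coversE[OF cov M Comp_Hom[OF mH r]])
  have "c \<cdot> (q \<cdot> j) = (r \<cdot> m) \<cdot> j" using Comp_assoc[OF j q cH] cq by simp
  also have "\<dots> = r \<cdot> (i \<cdot> c)" using Comp_assoc[OF j mH r] mj by simp
  also have "\<dots> = c" using Comp_assoc[OF cH i r] ri Comp_Ident_left[OF cH] by simp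
  also have "\<dots> = c \<cdot> Ident C x'" using Comp_Ident_right[OF cH] by simp
  finally have "q \<cdot> j = Ident C x'"
    by (rule coreflection_cancel[OF c x' Comp_Hom[OF j q] Ident_Hom[OF x'O]])
  then show ?thesis using j q unfolding retract_def by blast
qed

text \<open>A splitting of an idempotent of an object of \<open>S\<close> is a retract of that object, so that its
  coreflection splits the same idempotent.\<close>

lemma coreflection_splits_idempotent:
  assumes c: "coreflection C S A y c" and X: "X \<in> S"
    and i: "i \<in> Hom C y X" and p: "p \<in> Hom C X y" and pi: "p \<cdot> i = Ident C y"
  shows "\<exists>p' \<in> Hom C X A. \<exists>i' \<in> Hom C A X. i' \<cdot> p' = i \<cdot> p \<and> p' \<cdot> i' = Ident C A"
proof -
  have A: "A \<in> S" and cov: "covers C S A y c" using c by (simp_all add: coreflection_def)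
  note cH = covers_Hom[OF cov]
  have AO: "A \<in> Obj C" using Dom_Obj cH by (auto simp: Hom_def)
  obtain p' where p': "p' \<in> Hom C X A" and cp': "c \<cdot> p' = p"
    by (rule coversE[OF cov X p])
  have i': "i \<cdot> c \<in> Hom C A X" by (rule Comp_Hom[OF cH i])
  have "(i \<cdot> c) \<cdot> p' = i \<cdot> p" using Comp_assoc[OF p' cH i] cp' by simp
  moreover have "c \<cdot> (p' \<cdot> (i \<cdot> c)) = (p \<cdot> i) \<cdot> c"
    using Comp_assoc[OF i' p' cH] Comp_assoc[OF cH i p] cp' by simp
  then have "c \<cdot> (p' \<cdot> (i \<cdot> c)) = c \<cdot> Ident C A"
    using pi Comp_Ident_left[OF cH] Comp_Ident_right[OF cH] by simp
  then have "p' \<cdot> (i \<cdot> c) = Ident C A"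
    by (rule coreflection_cancel[OF c A Comp_Hom[OF i' p'] Ident_Hom[OF AO]])
  ultimately show ?thesis using p' i' by blast
qed

end

context linear_category
begin

lemma biproductD:
  assumes "biproduct C I A Y \<iota> \<pi>"
  shows "Y \<in> Obj C" "i \<in> I \<Longrightarrow> \<iota> i \<in> Hom C (A i) Y" "i \<in> I \<Longrightarrow> \<pi> i \<in> Hom C Y (A i)"
    "i \<in> I \<Longrightarrow> \<pi> i \<cdot>\<^bsub>C\<^esub> \<iota> i = Ident C (A i)"
    "i \<in> I \<Longrightarrow> j \<in> I \<Longrightarrow> i \<noteq> j \<Longrightarrow> \<pi> j \<cdot>\<^bsub>C\<^esub> \<iota> i = Zero C (A i) (A j)"
    "arrow_sum C Y Y (\<lambda>i. \<iota> i \<cdot>\<^bsub>C\<^esub> \<pi> i) I = Ident C Y"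
  using assms unfolding biproduct_def by auto

text \<open>The universal property gives the projections, and its uniqueness part the decomposition of the
  identity.  Since the resulting equations refer only to \<open>Y\<close> and the summands, coproducts in a full
  subcategory are coproducts in the ambient category, and products as well.\<close>

lemma coproduct_biproduct:
  assumes I: "finite I" and c: "is_coproduct C I A Y \<iota>"
  shows "\<exists>\<pi>. biproduct C I A Y \<iota> \<pi>"
proof -
  have Y: "Y \<in> Obj C" and \<iota>: "\<And>i. i \<in> I \<Longrightarrow> A i \<in> Obj C" "\<And>i. i \<in> I \<Longrightarrow> \<iota> i \<in> Hom C (A i) Y"
    and UP: "\<And>Z f. Z \<in> Obj C \<Longrightarrow> (\<And>i. i \<in> I \<Longrightarrow> f i \<in> Hom C (A i) Z) \<Longrightarrow>
      \<exists>!u. u \<in> Hom C Y Z \<and> (\<forall>i \<in> I. u \<cdot>\<^bsub>C\<^esub> \<iota> i = f i)"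
    using c unfolding is_coproduct_def by auto
  define \<delta> where "\<delta> i j = (if i = j then Ident C (A i) else Zero C (A i) (A j))" for i j
  have \<delta>: "\<delta> i j \<in> Hom C (A i) (A j)" if "i \<in> I" "j \<in> I" for i j
    using that \<iota> Ident_Hom Zero_Hom by (simp add: \<delta>_def)
  have "\<exists>u. u \<in> Hom C Y (A j) \<and> (\<forall>i \<in> I. u \<cdot>\<^bsub>C\<^esub> \<iota> i = \<delta> i j)" if "j \<in> I" for j
    using UP[of "A j" "\<lambda>i. \<delta> i j"] \<delta> \<iota> that by blast
  then obtain \<pi> where "\<forall>j \<in> I. \<pi> j \<in> Hom C Y (A j) \<and> (\<forall>i \<in> I. \<pi> j \<cdot>\<^bsub>C\<^esub> \<iota> i = \<delta> i j)"
    using bchoice[of I "\<lambda>j u. u \<in> Hom C Y (A j) \<and> (\<forall>i \<in> I. u \<cdot>\<^bsub>C\<^esub> \<iota> i = \<delta> i j)"] by blast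
  then have \<pi>: "\<And>j. j \<in> I \<Longrightarrow> \<pi> j \<in> Hom C Y (A j)"
    "\<And>i j. j \<in> I \<Longrightarrow> i \<in> I \<Longrightarrow> \<pi> j \<cdot>\<^bsub>C\<^esub> \<iota> i = \<delta> i j" by blast+
  have s: "\<iota> i \<cdot>\<^bsub>C\<^esub> \<pi> i \<in> Hom C Y Y" if "i \<in> I" for i
    using Comp_Hom[OF \<pi>(1)[OF that] \<iota>(2)[OF that]] .
  let ?s = "arrow_sum C Y Y (\<lambda>i. \<iota> i \<cdot>\<^bsub>C\<^esub> \<pi> i) I"
  have sH: "?s \<in> Hom C Y Y" by (rule arrow_sum_Hom[OF Y Y s])
  have "?s \<cdot>\<^bsub>C\<^esub> \<iota> j = \<iota> j" if j: "j \<in> I" for j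
  proof -
    have "?s \<cdot>\<^bsub>C\<^esub> \<iota> j = arrow_sum C (A j) Y (\<lambda>i. (\<iota> i \<cdot>\<^bsub>C\<^esub> \<pi> i) \<cdot>\<^bsub>C\<^esub> \<iota> j) I"
      by (rule Comp_arrow_sum_left[OF I Y \<iota>(2)[OF j] s])
    also have "\<dots> = arrow_sum C (A j) Y (\<lambda>i. \<iota> i \<cdot>\<^bsub>C\<^esub> \<delta> j i) I"
    proof (rule arrow_sum_cong[OF \<iota>(1)[OF j] Y])
      fix i assume i: "i \<in> I"
      show "(\<iota> i \<cdot>\<^bsub>C\<^esub> \<pi> i) \<cdot>\<^bsub>C\<^esub> \<iota> j = \<iota> i \<cdot>\<^bsub>C\<^esub> \<delta> j i"
        using Comp_assoc[OF \<iota>(2)[OF j] \<pi>(1)[OF i] \<iota>(2)[OF i]] \<pi>(2)[OF i j] by simp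
      show "\<iota> i \<cdot>\<^bsub>C\<^esub> \<delta> j i \<in> Hom C (A j) Y" by (rule Comp_Hom[OF \<delta>[OF j i] \<iota>(2)[OF i]])
    qed
    also have "\<dots> = \<iota> j \<cdot>\<^bsub>C\<^esub> \<delta> j j"
    proof (rule arrow_sum_single[where f = "\<lambda>i. \<iota> i \<cdot>\<^bsub>C\<^esub> \<delta> j i", OF I j Comp_Hom[OF \<delta>[OF j j] \<iota>(2)[OF j]]])
      fix i assume "i \<in> I" "i \<noteq> j"
      then show "\<iota> i \<cdot>\<^bsub>C\<^esub> \<delta> j i = Zero C (A j) Y"
        using Comp_Zero_right[OF \<iota>(2) \<iota>(1)[OF j]] by (auto simp: \<delta>_def)
    qed
    also have "\<dots> = \<iota> j" using Comp_Ident_right[OF \<iota>(2)[OF j]] by (simp add: \<delta>_def)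
    finally show ?thesis .
  qed
  then have 1: "?s \<in> Hom C Y Y \<and> (\<forall>i \<in> I. ?s \<cdot>\<^bsub>C\<^esub> \<iota> i = \<iota> i)" using sH by simp
  have 2: "Ident C Y \<in> Hom C Y Y \<and> (\<forall>i \<in> I. Ident C Y \<cdot>\<^bsub>C\<^esub> \<iota> i = \<iota> i)"
    using Ident_Hom[OF Y] Comp_Ident_left[OF \<iota>(2)] by simp
  have "?s = Ident C Y" using UP[of Y \<iota>, OF Y \<iota>(2)] 1 2 by blast
  then have "biproduct C I A Y \<iota> \<pi>"
    unfolding biproduct_def using Y \<iota> \<pi> by (simp add: \<delta>_def)
  then show ?thesis by blast
qed

text \<open>Arrows out of a biproduct are lifted one summand at a time.\<close>

lemma covers_biproduct:
  assumes a: "covers C P A t a" and I: "finite I"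
    and Y: "biproduct C I B Y \<iota> \<pi>" and B: "\<And>i. i \<in> I \<Longrightarrow> B i \<in> P"
  shows "covers C {Y} A t a"
  unfolding covers_def
proof (intro conjI ballI)
  show aH: "a \<in> Hom C A t" by (rule covers_Hom[OF a])
  fix y f assume "y \<in> {Y}" "f \<in> Hom C y t"
  then have y: "y = Y" and f: "f \<in> Hom C Y t" by simp_all
  have fi: "f \<cdot>\<^bsub>C\<^esub> \<iota> i \<in> Hom C (B i) t" if "i \<in> I" for i
    by (rule Comp_Hom[OF biproductD(2)[OF Y that] f])
  have "\<forall>i \<in> I. \<exists>l. l \<in> Hom C (B i) A \<and> a \<cdot>\<^bsub>C\<^esub> l = f \<cdot>\<^bsub>C\<^esub> \<iota> i"
  proof
    fix i assume i: "i \<in> I"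
    show "\<exists>l. l \<in> Hom C (B i) A \<and> a \<cdot>\<^bsub>C\<^esub> l = f \<cdot>\<^bsub>C\<^esub> \<iota> i"
      by (rule coversE[OF a B[OF i] fi[OF i]]) blast
  qed
  from bchoice[OF this]
  obtain l where "\<forall>i \<in> I. l i \<in> Hom C (B i) A \<and> a \<cdot>\<^bsub>C\<^esub> l i = f \<cdot>\<^bsub>C\<^esub> \<iota> i" ..
  then have l: "\<And>i. i \<in> I \<Longrightarrow> l i \<in> Hom C (B i) A"
    "\<And>i. i \<in> I \<Longrightarrow> a \<cdot>\<^bsub>C\<^esub> l i = f \<cdot>\<^bsub>C\<^esub> \<iota> i" by blast+
  have l\<pi>: "l i \<cdot>\<^bsub>C\<^esub> \<pi> i \<in> Hom C Y A" if "i \<in> I" for i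
    by (rule Comp_Hom[OF biproductD(3)[OF Y that] l(1)[OF that]])
  have \<iota>\<pi>: "\<iota> i \<cdot>\<^bsub>C\<^esub> \<pi> i \<in> Hom C Y Y" if "i \<in> I" for i
    by (rule Comp_Hom[OF biproductD(3)[OF Y that] biproductD(2)[OF Y that]])
  let ?k = "arrow_sum C Y A (\<lambda>i. l i \<cdot>\<^bsub>C\<^esub> \<pi> i) I"
  have AO: "A \<in> Obj C" and tO: "t \<in> Obj C" using Hom_Obj[OF aH] by simp_all
  have YO: "Y \<in> Obj C" by (rule biproductD(1)[OF Y])
  have kH: "?k \<in> Hom C Y A" by (rule arrow_sum_Hom[OF YO AO l\<pi>])
  have "a \<cdot>\<^bsub>C\<^esub> ?k = arrow_sum C Y t (\<lambda>i. a \<cdot>\<^bsub>C\<^esub> (l i \<cdot>\<^bsub>C\<^esub> \<pi> i)) I"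
    by (rule Comp_arrow_sum_right[OF I YO aH l\<pi>])
  also have "\<dots> = arrow_sum C Y t (\<lambda>i. f \<cdot>\<^bsub>C\<^esub> (\<iota> i \<cdot>\<^bsub>C\<^esub> \<pi> i)) I"
  proof (rule arrow_sum_cong[OF YO tO])
    fix i assume i: "i \<in> I"
    show "a \<cdot>\<^bsub>C\<^esub> (l i \<cdot>\<^bsub>C\<^esub> \<pi> i) = f \<cdot>\<^bsub>C\<^esub> (\<iota> i \<cdot>\<^bsub>C\<^esub> \<pi> i)"
      using Comp_assoc[OF biproductD(3)[OF Y i] l(1)[OF i] aH] l(2)[OF i]
        Comp_assoc[OF biproductD(3)[OF Y i] biproductD(2)[OF Y i] f] by simp
    show "f \<cdot>\<^bsub>C\<^esub> (\<iota> i \<cdot>\<^bsub>C\<^esub> \<pi> i) \<in> Hom C Y t" by (rule Comp_Hom[OF \<iota>\<pi>[OF i] f])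
  qed
  also have "\<dots> = f \<cdot>\<^bsub>C\<^esub> arrow_sum C Y Y (\<lambda>i. \<iota> i \<cdot>\<^bsub>C\<^esub> \<pi> i) I"
    by (rule Comp_arrow_sum_right[OF I YO f \<iota>\<pi>, symmetric])
  also have "\<dots> = f" using biproductD(6)[OF Y] Comp_Ident_right[OF f] by simp
  finally show "\<exists>l \<in> Hom C y A. a \<cdot>\<^bsub>C\<^esub> l = f"
    using kH y by blast
qed

text \<open>Arrows into a biproduct are lifted one component at a time.\<close>

lemma biproduct_covers:
  assumes I: "finite I" and Y: "biproduct C I A Y \<iota> \<pi>" and M: "biproduct C I A' M \<iota>' \<pi>'"
    and c: "\<And>i. i \<in> I \<Longrightarrow> covers C P (A' i) (A i) (c i)"
  shows "\<exists>m. covers C P M Y m"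
proof -
  have YO: "Y \<in> Obj C" and MO: "M \<in> Obj C" using biproductD(1)[OF Y] biproductD(1)[OF M] by simp_all
  note \<iota> = biproductD(2)[OF Y] and \<pi> = biproductD(3)[OF Y]
    and \<iota>' = biproductD(2)[OF M] and \<pi>' = biproductD(3)[OF M]
  have cH: "c i \<in> Hom C (A' i) (A i)" if "i \<in> I" for i by (rule covers_Hom[OF c[OF that]])
  have \<iota>c: "\<iota> i \<cdot>\<^bsub>C\<^esub> c i \<in> Hom C (A' i) Y" if "i \<in> I" for i by (rule Comp_Hom[OF cH[OF that] \<iota>[OF that]])
  have \<iota>c\<pi>: "(\<iota> i \<cdot>\<^bsub>C\<^esub> c i) \<cdot>\<^bsub>C\<^esub> \<pi>' i \<in> Hom C M Y" if "i \<in> I" for i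
    by (rule Comp_Hom[OF \<pi>'[OF that] \<iota>c[OF that]])
  let ?m = "arrow_sum C M Y (\<lambda>i. (\<iota> i \<cdot>\<^bsub>C\<^esub> c i) \<cdot>\<^bsub>C\<^esub> \<pi>' i) I"
  have mH: "?m \<in> Hom C M Y" by (rule arrow_sum_Hom[OF MO YO \<iota>c\<pi>])
  have "covers C P M Y ?m"
    unfolding covers_def
  proof (intro conjI ballI)
    show "?m \<in> Hom C M Y" by (rule mH)
    fix s f assume s: "s \<in> P" and f: "f \<in> Hom C s Y"
    have sO: "s \<in> Obj C" using Hom_Obj[OF f] by simp
    have "\<forall>i \<in> I. \<exists>l. l \<in> Hom C s (A' i) \<and> c i \<cdot>\<^bsub>C\<^esub> l = \<pi> i \<cdot>\<^bsub>C\<^esub> f"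
    proof
      fix i assume i: "i \<in> I"
      show "\<exists>l. l \<in> Hom C s (A' i) \<and> c i \<cdot>\<^bsub>C\<^esub> l = \<pi> i \<cdot>\<^bsub>C\<^esub> f"
        by (rule coversE[OF c[OF i] s Comp_Hom[OF f \<pi>[OF i]]]) blast
    qed
    from bchoice[OF this]
    obtain l where "\<forall>i \<in> I. l i \<in> Hom C s (A' i) \<and> c i \<cdot>\<^bsub>C\<^esub> l i = \<pi> i \<cdot>\<^bsub>C\<^esub> f" ..
    then have l: "\<And>i. i \<in> I \<Longrightarrow> l i \<in> Hom C s (A' i)"
      "\<And>i. i \<in> I \<Longrightarrow> c i \<cdot>\<^bsub>C\<^esub> l i = \<pi> i \<cdot>\<^bsub>C\<^esub> f" by blast+
    have \<iota>l: "\<iota>' i \<cdot>\<^bsub>C\<^esub> l i \<in> Hom C s M" if "i \<in> I" for i by (rule Comp_Hom[OF l(1)[OF that] \<iota>'[OF that]])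
    let ?k = "arrow_sum C s M (\<lambda>i. \<iota>' i \<cdot>\<^bsub>C\<^esub> l i) I"
    have kH: "?k \<in> Hom C s M" by (rule arrow_sum_Hom[OF sO MO \<iota>l])
    have \<pi>k: "\<pi>' i \<cdot>\<^bsub>C\<^esub> ?k = l i" if i: "i \<in> I" for i
    proof -
      have *: "\<pi>' i \<cdot>\<^bsub>C\<^esub> (\<iota>' j \<cdot>\<^bsub>C\<^esub> l j) = (\<pi>' i \<cdot>\<^bsub>C\<^esub> \<iota>' j) \<cdot>\<^bsub>C\<^esub> l j" if "j \<in> I" for j
        by (rule Comp_assoc[OF l(1)[OF that] \<iota>'[OF that] \<pi>'[OF i]])
      have "\<pi>' i \<cdot>\<^bsub>C\<^esub> ?k = arrow_sum C s (A' i) (\<lambda>j. \<pi>' i \<cdot>\<^bsub>C\<^esub> (\<iota>' j \<cdot>\<^bsub>C\<^esub> l j)) I"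
        by (rule Comp_arrow_sum_right[OF I sO \<pi>'[OF i] \<iota>l])
      also have "\<dots> = \<pi>' i \<cdot>\<^bsub>C\<^esub> (\<iota>' i \<cdot>\<^bsub>C\<^esub> l i)"
      proof (rule arrow_sum_single[where f = "\<lambda>j. \<pi>' i \<cdot>\<^bsub>C\<^esub> (\<iota>' j \<cdot>\<^bsub>C\<^esub> l j)", OF I i Comp_Hom[OF \<iota>l[OF i] \<pi>'[OF i]]])
        fix j assume j: "j \<in> I" "j \<noteq> i"
        show "\<pi>' i \<cdot>\<^bsub>C\<^esub> (\<iota>' j \<cdot>\<^bsub>C\<^esub> l j) = Zero C s (A' i)"
          using *[OF j(1)] biproductD(5)[OF M j(1) i j(2)] Comp_Zero_left[OF l(1)[OF j(1)]]
            Hom_Obj[OF \<pi>'[OF i]] by simp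
      qed
      also have "\<dots> = l i" using *[OF i] biproductD(4)[OF M i] Comp_Ident_left[OF l(1)[OF i]] by simp
      finally show ?thesis .
    qed
    have \<iota>\<pi>: "\<iota> i \<cdot>\<^bsub>C\<^esub> \<pi> i \<in> Hom C Y Y" if "i \<in> I" for i by (rule Comp_Hom[OF \<pi>[OF that] \<iota>[OF that]])
    have "?m \<cdot>\<^bsub>C\<^esub> ?k = arrow_sum C s Y (\<lambda>i. ((\<iota> i \<cdot>\<^bsub>C\<^esub> c i) \<cdot>\<^bsub>C\<^esub> \<pi>' i) \<cdot>\<^bsub>C\<^esub> ?k) I"
      by (rule Comp_arrow_sum_left[OF I YO kH \<iota>c\<pi>])
    also have "\<dots> = arrow_sum C s Y (\<lambda>i. (\<iota> i \<cdot>\<^bsub>C\<^esub> \<pi> i) \<cdot>\<^bsub>C\<^esub> f) I"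
    proof (rule arrow_sum_cong[OF sO YO])
      fix i assume i: "i \<in> I"
      have "((\<iota> i \<cdot>\<^bsub>C\<^esub> c i) \<cdot>\<^bsub>C\<^esub> \<pi>' i) \<cdot>\<^bsub>C\<^esub> ?k = (\<iota> i \<cdot>\<^bsub>C\<^esub> c i) \<cdot>\<^bsub>C\<^esub> l i"
        using Comp_assoc[OF kH \<pi>'[OF i] \<iota>c[OF i]] \<pi>k[OF i] by simp
      also have "\<dots> = \<iota> i \<cdot>\<^bsub>C\<^esub> (\<pi> i \<cdot>\<^bsub>C\<^esub> f)"
        using Comp_assoc[OF l(1)[OF i] cH[OF i] \<iota>[OF i]] l(2)[OF i] by simp
      finally show "((\<iota> i \<cdot>\<^bsub>C\<^esub> c i) \<cdot>\<^bsub>C\<^esub> \<pi>' i) \<cdot>\<^bsub>C\<^esub> ?k = (\<iota> i \<cdot>\<^bsub>C\<^esub> \<pi> i) \<cdot>\<^bsub>C\<^esub> f"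
        using Comp_assoc[OF f \<pi>[OF i] \<iota>[OF i]] by simp
      show "(\<iota> i \<cdot>\<^bsub>C\<^esub> \<pi> i) \<cdot>\<^bsub>C\<^esub> f \<in> Hom C s Y" by (rule Comp_Hom[OF f \<iota>\<pi>[OF i]])
    qed
    also have "\<dots> = arrow_sum C Y Y (\<lambda>i. \<iota> i \<cdot>\<^bsub>C\<^esub> \<pi> i) I \<cdot>\<^bsub>C\<^esub> f"
      by (rule Comp_arrow_sum_left[OF I YO f \<iota>\<pi>, symmetric])
    also have "\<dots> = f" using biproductD(6)[OF Y] Comp_Ident_left[OF f] by simp
    finally show "\<exists>l \<in> Hom C s M. ?m \<cdot>\<^bsub>C\<^esub> l = f" using kH by blast
  qed
  then show ?thesis by blast
qed

text \<open>The biproduct of the sources of finitely many arrows to \<open>t\<close>, taken with repetition over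
  all generators of the modules \<open>Hom(p, t)\<close>, maps to \<open>t\<close>; a linear combination of generators
  lifts to the same linear combination of injections.\<close>

lemma finitely_generated_cover:
  assumes P: "finite P" "P \<subseteq> Obj C" and t: "t \<in> Obj C"
    and fg: "\<And>p. p \<in> P \<Longrightarrow> finitely_generated_module R (hom_module C p t)"
    and bip: "\<And>n A. (\<And>i. i < n \<Longrightarrow> A i \<in> P) \<Longrightarrow> \<exists>Y \<in> S. \<exists>\<iota> \<pi>. biproduct C {..<n::nat} A Y \<iota> \<pi>"
  shows "\<exists>Y \<in> S. \<exists>a. covers C P Y t a"
proof -
  have "\<forall>p \<in> P. \<exists>D. finite D \<and> D \<subseteq> Hom C p t \<and> (\<forall>h \<in> Hom C p t. \<exists>c. c \<in> D \<rightarrow> carrier R \<and>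
      h = arrow_sum C p t (\<lambda>g. Scale C (c g) g) D)"
    using fg unfolding finitely_generated_module_def arrow_sum_def by (simp add: hom_module_def)
  from bchoice[OF this]
  obtain D where "\<forall>p \<in> P. finite (D p) \<and> D p \<subseteq> Hom C p t \<and> (\<forall>h \<in> Hom C p t.
      \<exists>c. c \<in> D p \<rightarrow> carrier R \<and> h = arrow_sum C p t (\<lambda>g. Scale C (c g) g) (D p))" ..
  then have D: "\<And>p. p \<in> P \<Longrightarrow> finite (D p)" "\<And>p. p \<in> P \<Longrightarrow> D p \<subseteq> Hom C p t"
    "\<And>p h. p \<in> P \<Longrightarrow> h \<in> Hom C p t \<Longrightarrow> \<exists>c. c \<in> D p \<rightarrow> carrier R \<and>
      h = arrow_sum C p t (\<lambda>g. Scale C (c g) g) (D p)" by blast+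
  have "finite (\<Union>p \<in> P. D p)" using P D by blast
  then obtain n :: nat and g where g: "bij_betw g {..<n} (\<Union>p \<in> P. D p)"
    using ex_bij_betw_nat_finite unfolding atLeast0LessThan by metis
  define A where "A j = Dom C (g j)" for j
  have gD: "\<exists>p \<in> P. g j \<in> D p" if "j < n" for j using g that by (auto simp: bij_betw_def)
  have gA: "g j \<in> Hom C (A j) t" "A j \<in> P" "g j \<in> D (A j)" if "j < n" for j
  proof -
    obtain p where p: "p \<in> P" "g j \<in> D p" using gD \<open>j < n\<close> by blast
    then have "g j \<in> Hom C p t" using D by blast
    moreover from this have "A j = p" by (simp add: A_def Hom_def)
    ultimately show "g j \<in> Hom C (A j) t" "A j \<in> P" "g j \<in> D (A j)" using p by simp_all
  qed
  obtain Y \<iota> \<pi> where Y: "Y \<in> S" and B: "biproduct C {..<n} A Y \<iota> \<pi>" using bip[of n A] gA by blast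
  note \<iota> = biproductD(2)[OF B] and \<pi> = biproductD(3)[OF B]
  have YO: "Y \<in> Obj C" by (rule biproductD(1)[OF B])
  let ?a = "arrow_sum C Y t (\<lambda>j. g j \<cdot>\<^bsub>C\<^esub> \<pi> j) {..<n}"
  have g\<pi>: "g j \<cdot>\<^bsub>C\<^esub> \<pi> j \<in> Hom C Y t" if "j \<in> {..<n}" for j
    using Comp_Hom[OF \<pi>[OF that] gA(1)] that by simp
  have aH: "?a \<in> Hom C Y t" by (rule arrow_sum_Hom[OF YO t g\<pi>])
  have a\<iota>: "?a \<cdot>\<^bsub>C\<^esub> \<iota> i = g i" if i: "i \<in> {..<n}" for i
  proof -
    have iO: "A i \<in> Obj C" using gA(2) i P by auto
    have *: "(g j \<cdot>\<^bsub>C\<^esub> \<pi> j) \<cdot>\<^bsub>C\<^esub> \<iota> i = g j \<cdot>\<^bsub>C\<^esub> (\<pi> j \<cdot>\<^bsub>C\<^esub> \<iota> i)" if "j \<in> {..<n}" for j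
      using Comp_assoc[OF \<iota>[OF i] \<pi>[OF that] gA(1)] that by simp
    have "?a \<cdot>\<^bsub>C\<^esub> \<iota> i = arrow_sum C (A i) t (\<lambda>j. (g j \<cdot>\<^bsub>C\<^esub> \<pi> j) \<cdot>\<^bsub>C\<^esub> \<iota> i) {..<n}"
      by (rule Comp_arrow_sum_left[OF _ t \<iota>[OF i] g\<pi>]) simp_all
    also have "\<dots> = (g i \<cdot>\<^bsub>C\<^esub> \<pi> i) \<cdot>\<^bsub>C\<^esub> \<iota> i"
    proof (rule arrow_sum_single[where f = "\<lambda>j. (g j \<cdot>\<^bsub>C\<^esub> \<pi> j) \<cdot>\<^bsub>C\<^esub> \<iota> i", OF _ i Comp_Hom[OF \<iota>[OF i] g\<pi>[OF i]]])
      fix j assume j: "j \<in> {..<n}" "j \<noteq> i"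
      show "(g j \<cdot>\<^bsub>C\<^esub> \<pi> j) \<cdot>\<^bsub>C\<^esub> \<iota> i = Zero C (A i) t"
        using *[OF j(1)] biproductD(5)[OF B i j(1)] j Comp_Zero_right[OF gA(1) iO] by auto
    qed simp
    also have "\<dots> = g i" using *[OF i] biproductD(4)[OF B i] Comp_Ident_right[OF gA(1)] i by simp
    finally show ?thesis .
  qed
  have "covers C P Y t ?a"
    unfolding covers_def
  proof (intro conjI ballI)
    show "?a \<in> Hom C Y t" by (rule aH)
    fix p h assume p: "p \<in> P" and h: "h \<in> Hom C p t"
    have pO: "p \<in> Obj C" using p P by blast
    obtain c where c: "c \<in> D p \<rightarrow> carrier R" "h = arrow_sum C p t (\<lambda>g. Scale C (c g) g) (D p)"
      using D(3)[OF p h] by blast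
    define J where "J = {j \<in> {..<n}. g j \<in> D p}"
    have J: "J \<subseteq> {..<n}" "finite J" by (auto simp: J_def)
    have Aj: "A j = p" if "j \<in> J" for j
      using that gA(1)[of j] D(2)[OF p] by (auto simp: J_def Hom_def)
    have gJ: "g ` J = D p" using g p by (auto simp: J_def bij_betw_def)
    have injJ: "inj_on g J" using g J(1) by (auto simp: bij_betw_def intro: inj_on_subset)
    have cJ: "c (g j) \<in> carrier R" if "j \<in> J" for j using c(1) gJ that by blast
    have \<iota>J: "\<iota> j \<in> Hom C p Y" if "j \<in> J" for j using \<iota>[of j] J Aj that by auto
    have sJ: "Scale C (c (g j)) (\<iota> j) \<in> Hom C p Y" if "j \<in> J" for j
      by (rule Scale_Hom[OF cJ[OF that] \<iota>J[OF that]])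
    let ?l = "arrow_sum C p Y (\<lambda>j. Scale C (c (g j)) (\<iota> j)) J"
    have lH: "?l \<in> Hom C p Y" by (rule arrow_sum_Hom[OF pO YO sJ])
    have "?a \<cdot>\<^bsub>C\<^esub> ?l = arrow_sum C p t (\<lambda>j. ?a \<cdot>\<^bsub>C\<^esub> Scale C (c (g j)) (\<iota> j)) J"
      by (rule Comp_arrow_sum_right[OF J(2) pO aH sJ])
    also have "\<dots> = arrow_sum C p t (\<lambda>j. Scale C (c (g j)) (g j)) J"
    proof (rule arrow_sum_cong[OF pO t])
      fix j assume j: "j \<in> J"
      then show "?a \<cdot>\<^bsub>C\<^esub> Scale C (c (g j)) (\<iota> j) = Scale C (c (g j)) (g j)"
        using Comp_Scale_right[OF cJ[OF j] \<iota>J[OF j] aH] a\<iota> J by auto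
      show "Scale C (c (g j)) (g j) \<in> Hom C p t"
        using j gJ D(2)[OF p] by (intro Scale_Hom cJ) auto
    qed
    also have "\<dots> = h"
    proof -
      interpret M: abelian_group "hom_module C p t" by (rule hom_abelian_group[OF pO t])
      have "Scale C (c x) x \<in> Hom C p t" if "x \<in> D p" for x
        using c(1) D(2)[OF p] that by (intro Scale_Hom) auto
      then show ?thesis
        using M.finsum_reindex[of "\<lambda>x. Scale C (c x) x" g J] injJ gJ c(2)
        by (auto simp: arrow_sum_def hom_module_def)
    qed
    finally show "\<exists>l \<in> Hom C p Y. ?a \<cdot>\<^bsub>C\<^esub> l = h" using lH by blast
  qed
  then show ?thesis using Y by blast
qed

end

section \<open>A self-dual fragment of the theory of triangulated categories\<close>

text \<open>A segment \<open>W \<rightarrow> X \<rightarrow> Y \<rightarrow> Z\<close> is meant to be a distinguished triangle with \<open>Z = \<Sigma>W\<close>, and \<open>S\<close> the set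
  of objects of a triangulated subcategory.  Reversed segments satisfy the same assumptions in
  the opposite category.  This is achieved by mentioning neither \<open>\<Sigma>\<close>, which the opposite category
  would replace by its inverse, nor the rotation of triangles with its signs: what is needed of
  them is exactness at the two inner objects and the existence of segments with a prescribed first
  or last arrow.  In \<open>S_second\<close> and \<open>S_third\<close>, where both end objects are prescribed, the given segment
  certifies that \<open>Z\<close> is the suspension of \<open>W\<close>.\<close>

locale triangle_pair = linear_category R C
  for R :: "'r ring" and C :: "('o, 'm, 'r, 'x) lin_cat_scheme" +
  fixes tri :: "'o \<Rightarrow> 'o \<Rightarrow> 'o \<Rightarrow> 'o \<Rightarrow> 'm \<Rightarrow> 'm \<Rightarrow> 'm \<Rightarrow> bool" and S :: "'o set"
  assumes tri_Hom: "tri W X Y Z f g h \<Longrightarrow> f \<in> Hom C W X \<and> g \<in> Hom C X Y \<and> h \<in> Hom C Y Z"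
    and exact_second: "tri W X Y Z f g h \<Longrightarrow> k \<in> Hom C V X \<Longrightarrow>
      g \<cdot>\<^bsub>C\<^esub> k = Zero C V Y \<longleftrightarrow> (\<exists>l \<in> Hom C V W. k = f \<cdot>\<^bsub>C\<^esub> l)"
    and exact_third: "tri W X Y Z f g h \<Longrightarrow> k \<in> Hom C V Y \<Longrightarrow>
      h \<cdot>\<^bsub>C\<^esub> k = Zero C V Z \<longleftrightarrow> (\<exists>l \<in> Hom C V X. k = g \<cdot>\<^bsub>C\<^esub> l)"
    and coexact_second: "tri W X Y Z f g h \<Longrightarrow> k \<in> Hom C X V \<Longrightarrow>
      k \<cdot>\<^bsub>C\<^esub> f = Zero C W V \<longleftrightarrow> (\<exists>l \<in> Hom C Y V. k = l \<cdot>\<^bsub>C\<^esub> g)"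
    and coexact_third: "tri W X Y Z f g h \<Longrightarrow> k \<in> Hom C Y V \<Longrightarrow>
      k \<cdot>\<^bsub>C\<^esub> g = Zero C X V \<longleftrightarrow> (\<exists>l \<in> Hom C Z V. k = l \<cdot>\<^bsub>C\<^esub> h)"
    and extend_first: "f \<in> Hom C A B \<Longrightarrow> \<exists>Y Z g h. tri A B Y Z f g h"
    and extend_last: "h \<in> Hom C A B \<Longrightarrow> \<exists>W X f g. tri W X A B f g h"
    and fill_second: "tri W X Y Z f g h \<Longrightarrow> tri W X' Y' Z f' g' h' \<Longrightarrow> b \<in> Hom C Y Y' \<Longrightarrow>
      h' \<cdot>\<^bsub>C\<^esub> b = h \<Longrightarrow> \<exists>a \<in> Hom C X X'. a \<cdot>\<^bsub>C\<^esub> f = f' \<and> g' \<cdot>\<^bsub>C\<^esub> a = b \<cdot>\<^bsub>C\<^esub> g"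
    and fill_third: "tri W X Y Z f g h \<Longrightarrow> tri W X' Y' Z f' g' h' \<Longrightarrow> a \<in> Hom C X X' \<Longrightarrow>
      a \<cdot>\<^bsub>C\<^esub> f = f' \<Longrightarrow> \<exists>b \<in> Hom C Y Y'. h' \<cdot>\<^bsub>C\<^esub> b = h \<and> g' \<cdot>\<^bsub>C\<^esub> a = b \<cdot>\<^bsub>C\<^esub> g"
    and S_Obj: "S \<subseteq> Obj C"
    and S_first: "f \<in> Hom C A B \<Longrightarrow> A \<in> S \<Longrightarrow> B \<in> S \<Longrightarrow>
      \<exists>Y Z g h. tri A B Y Z f g h \<and> Y \<in> S \<and> Z \<in> S"
    and S_last: "h \<in> Hom C A B \<Longrightarrow> A \<in> S \<Longrightarrow> B \<in> S \<Longrightarrow>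
      \<exists>W X f g. tri W X A B f g h \<and> W \<in> S \<and> X \<in> S"
    and S_second: "tri W X Y Z f g h \<Longrightarrow> W \<in> S \<Longrightarrow> B \<in> S \<Longrightarrow> k \<in> Hom C B Z \<Longrightarrow>
      \<exists>F \<in> S. \<exists>f' g'. tri W F B Z f' g' k"
    and S_third: "tri W X Y Z f g h \<Longrightarrow> Z \<in> S \<Longrightarrow> B \<in> S \<Longrightarrow> k \<in> Hom C W B \<Longrightarrow>
      \<exists>F \<in> S. \<exists>g' h'. tri W B F Z k g' h'"
begin

lemma opposite_pair: "triangle_pair R (opposite C) (\<lambda>W X Y Z f g h. tri Z Y X W h g f) S"
proof (intro triangle_pair.intro triangle_pair_axioms.intro, goal_cases)
  case 1 show ?case by (rule linear_category_opposite)
next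
  case 2 then show ?case using tri_Hom by simp
next
  case (3 W X Y Z f g h k V) then show ?case using coexact_third by simp
next
  case (4 W X Y Z f g h k V) then show ?case using coexact_second by simp
next
  case (5 W X Y Z f g h k V) then show ?case using exact_third by simp
next
  case (6 W X Y Z f g h k V) then show ?case using exact_second by simp
next
  case (7 f A B) then show ?case using extend_last[of f B A] by auto
next
  case (8 h A B) then show ?case using extend_first[of h B A] by auto
next
  case (9 W X Y Z f g h X' Y' f' g' h' b)
  then show ?case using fill_third[of Z Y' X' W h' g' f' Y X h g f b] by auto
next
  case (10 W X Y Z f g h X' Y' f' g' h' a)
  then show ?case using fill_second[of Z Y' X' W h' g' f' Y X h g f a] by auto
next
  case 11 then show ?case using S_Obj by simp
next
  case (12 f A B) then show ?case using S_last[of f B A] by auto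
next
  case (13 h A B) then show ?case using S_first[of h B A] by auto
next
  case (14 W X Y Z f g h B k) then show ?case using S_third[of Z Y X W h g f B k] by auto
next
  case (15 W X Y Z f g h B k) then show ?case using S_second[of Z Y X W h g f B k] by auto
qed

text \<open>The hypothesis on \<open>E\<close> says that each \<open>y\<close> in \<open>E\<close> is the middle term of some \<open>x \<rightarrow> y \<rightarrow> z\<close> for which
  arrows from \<open>y\<close> that vanish on \<open>x\<close> factor through \<open>z\<close>.  Cover \<open>t\<close> by \<open>A\<close> relative to \<open>P\<close>, let
  \<open>A \<rightarrow> t \<rightarrow> t1\<close> be the cone, cover \<open>t1\<close> by \<open>F1\<close> relative to \<open>Q\<close>, and let \<open>F\<close> be the extension
  \<open>A \<rightarrow> F \<rightarrow> F1\<close> pulled back from \<open>A \<rightarrow> t \<rightarrow> t1\<close>.  An arrow \<open>y \<rightarrow> t\<close> becomes zero on \<open>x\<close> after composition to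
  \<open>t1\<close>, hence factors through \<open>z\<close> there and lifts to \<open>F1\<close> and further to \<open>F\<close>; what remains to be lifted
  comes from \<open>A\<close>.\<close>

lemma covers_extension:
  assumes X: "\<And>t. t \<in> Obj C \<Longrightarrow> \<exists>A \<in> S. \<exists>a. covers C P A t a"
    and Z: "\<And>t. t \<in> Obj C \<Longrightarrow> \<exists>A \<in> S. \<exists>a. covers C Q A t a"
    and E: "\<And>y. y \<in> E \<Longrightarrow> \<exists>x \<in> P. \<exists>z \<in> Q. \<exists>i \<in> Hom C x y. \<exists>q \<in> Hom C y z.
      \<forall>V. \<forall>k \<in> Hom C y V. k \<cdot>\<^bsub>C\<^esub> i = Zero C x V \<longrightarrow> (\<exists>l \<in> Hom C z V. k = l \<cdot>\<^bsub>C\<^esub> q)"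
    and t: "t \<in> Obj C"
  shows "\<exists>F \<in> S. \<exists>b. covers C E F t b"
proof -
  obtain A a where A: "A \<in> S" and a: "covers C P A t a" using X[OF t] by blast
  note aH = covers_Hom[OF a]
  obtain t1 D g h where T: "tri A t t1 D a g h" using extend_first[OF aH] by blast
  have gH: "g \<in> Hom C t t1" and hH: "h \<in> Hom C t1 D" using tri_Hom[OF T] by simp_all
  have t1: "t1 \<in> Obj C" using Hom_Obj[OF gH] by simp
  obtain F1 b1 where F1: "F1 \<in> S" and b1: "covers C Q F1 t1 b1" using Z[OF t1] by blast
  note b1H = covers_Hom[OF b1]
  have kH: "h \<cdot>\<^bsub>C\<^esub> b1 \<in> Hom C F1 D" by (rule Comp_Hom[OF b1H hH])
  obtain F f' g' where F: "F \<in> S" and T': "tri A F F1 D f' g' (h \<cdot>\<^bsub>C\<^esub> b1)"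
    using S_second[OF T A F1 kH] by blast
  have f'H: "f' \<in> Hom C A F" and g'H: "g' \<in> Hom C F F1" using tri_Hom[OF T'] by simp_all
  obtain x where xH: "x \<in> Hom C F t" and xf': "x \<cdot>\<^bsub>C\<^esub> f' = a" and gx: "g \<cdot>\<^bsub>C\<^esub> x = b1 \<cdot>\<^bsub>C\<^esub> g'"
    using fill_second[OF T' T b1H] by blast
  have "covers C E F t x"
    unfolding covers_def
  proof (intro conjI ballI)
    show "x \<in> Hom C F t" by (rule xH)
    fix y \<phi> assume y: "y \<in> E" and \<phi>: "\<phi> \<in> Hom C y t"
    obtain x0 z0 i q where x0: "x0 \<in> P" and z0: "z0 \<in> Q" and i: "i \<in> Hom C x0 y"
      and q: "q \<in> Hom C y z0" and ex: "\<And>V k. k \<in> Hom C y V \<Longrightarrow> k \<cdot>\<^bsub>C\<^esub> i = Zero C x0 V \<Longrightarrow>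
        \<exists>l \<in> Hom C z0 V. k = l \<cdot>\<^bsub>C\<^esub> q"
      using E[OF y] by blast
    have \<phi>i: "\<phi> \<cdot>\<^bsub>C\<^esub> i \<in> Hom C x0 t" by (rule Comp_Hom[OF i \<phi>])
    have g\<phi>: "g \<cdot>\<^bsub>C\<^esub> \<phi> \<in> Hom C y t1" by (rule Comp_Hom[OF \<phi> gH])
    have "\<exists>l \<in> Hom C x0 A. \<phi> \<cdot>\<^bsub>C\<^esub> i = a \<cdot>\<^bsub>C\<^esub> l" by (rule coversE[OF a x0 \<phi>i]) (rule bexI, rule sym)
    then have "g \<cdot>\<^bsub>C\<^esub> (\<phi> \<cdot>\<^bsub>C\<^esub> i) = Zero C x0 t1" using exact_second[OF T \<phi>i] by simp
    then have "(g \<cdot>\<^bsub>C\<^esub> \<phi>) \<cdot>\<^bsub>C\<^esub> i = Zero C x0 t1" using Comp_assoc[OF i \<phi> gH] by simp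
    then obtain \<psi> where \<psi>: "\<psi> \<in> Hom C z0 t1" and g\<phi>q: "g \<cdot>\<^bsub>C\<^esub> \<phi> = \<psi> \<cdot>\<^bsub>C\<^esub> q"
      using ex[OF g\<phi>] by blast
    obtain \<chi> where \<chi>: "\<chi> \<in> Hom C z0 F1" and b\<chi>: "b1 \<cdot>\<^bsub>C\<^esub> \<chi> = \<psi>" by (rule coversE[OF b1 z0 \<psi>])
    have \<chi>q: "\<chi> \<cdot>\<^bsub>C\<^esub> q \<in> Hom C y F1" by (rule Comp_Hom[OF q \<chi>])
    have bq: "b1 \<cdot>\<^bsub>C\<^esub> (\<chi> \<cdot>\<^bsub>C\<^esub> q) = g \<cdot>\<^bsub>C\<^esub> \<phi>" using Comp_assoc[OF q \<chi> b1H] b\<chi> g\<phi>q by simp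
    have "h \<cdot>\<^bsub>C\<^esub> (g \<cdot>\<^bsub>C\<^esub> \<phi>) = Zero C y D" using exact_third[OF T g\<phi>] \<phi> by blast
    then have "(h \<cdot>\<^bsub>C\<^esub> b1) \<cdot>\<^bsub>C\<^esub> (\<chi> \<cdot>\<^bsub>C\<^esub> q) = Zero C y D"
      using Comp_assoc[OF \<chi>q b1H hH] bq by simp
    then obtain \<omega> where \<omega>: "\<omega> \<in> Hom C y F" and g'\<omega>: "\<chi> \<cdot>\<^bsub>C\<^esub> q = g' \<cdot>\<^bsub>C\<^esub> \<omega>"
      using exact_third[OF T' \<chi>q] by blast
    have x\<omega>: "x \<cdot>\<^bsub>C\<^esub> \<omega> \<in> Hom C y t" by (rule Comp_Hom[OF \<omega> xH])
    have eq: "g \<cdot>\<^bsub>C\<^esub> \<phi> = g \<cdot>\<^bsub>C\<^esub> (x \<cdot>\<^bsub>C\<^esub> \<omega>)"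
      using Comp_assoc[OF \<omega> xH gH] Comp_assoc[OF \<omega> g'H b1H] gx g'\<omega> bq by simp
    obtain d where d: "d \<in> Hom C y t" and \<phi>d: "\<phi> = Add C (x \<cdot>\<^bsub>C\<^esub> \<omega>) d"
      and "g \<cdot>\<^bsub>C\<^esub> d = Zero C y t1"
      by (rule difference_left[OF \<phi> x\<omega> gH eq])
    then obtain l where l: "l \<in> Hom C y A" and dl: "d = a \<cdot>\<^bsub>C\<^esub> l"
      using exact_second[OF T d] by blast
    have f'l: "f' \<cdot>\<^bsub>C\<^esub> l \<in> Hom C y F" by (rule Comp_Hom[OF l f'H])
    have "x \<cdot>\<^bsub>C\<^esub> Add C \<omega> (f' \<cdot>\<^bsub>C\<^esub> l) = \<phi>"
      using Comp_Add_right[OF \<omega> f'l xH] Comp_assoc[OF l f'H xH] xf' dl \<phi>d by simp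
    then show "\<exists>l \<in> Hom C y F. x \<cdot>\<^bsub>C\<^esub> l = \<phi>" using Add_Hom[OF \<omega> f'l] by blast
  qed
  then show ?thesis using F by blast
qed

text \<open>Let \<open>f: F \<rightarrow> t\<close> be an \<open>S\<close>-cover with fibre \<open>K\<close>, let \<open>F'\<close> be an \<open>S\<close>-cover of \<open>K\<close>, and let \<open>B\<close> be the cone
  of \<open>F' \<rightarrow> F\<close>.  For \<open>s\<close> in \<open>S\<close> the sequence \<open>Hom(s, F') \<rightarrow> Hom(s, F) \<rightarrow> Hom(s, t) \<rightarrow> 0\<close> is exact, so that
  \<open>Hom(s, F) \<rightarrow> Hom(s, B)\<close> factors through \<open>Hom(s, t)\<close>.  This splits the map induced by the extension
  \<open>c: B \<rightarrow> t\<close> of \<open>f\<close>, and \<open>t\<close> is represented on \<open>S\<close> by the image of the corresponding idempotent of \<open>B\<close>.\<close>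

lemma coreflection_if_covers:
  assumes split: "\<And>X e. X \<in> S \<Longrightarrow> e \<in> Hom C X X \<Longrightarrow> e \<cdot>\<^bsub>C\<^esub> e = e \<Longrightarrow>
      \<exists>Y \<in> S. \<exists>p \<in> Hom C X Y. \<exists>i \<in> Hom C Y X. i \<cdot>\<^bsub>C\<^esub> p = e \<and> p \<cdot>\<^bsub>C\<^esub> i = Ident C Y"
    and cov: "\<And>t. t \<in> Obj C \<Longrightarrow> \<exists>A \<in> S. \<exists>a. covers C S A t a"
    and t: "t \<in> Obj C"
  shows "\<exists>A c. coreflection C S A t c"
proof -
  obtain F f where F: "F \<in> S" and f: "covers C S F t f" using cov[OF t] by blast
  note fH = covers_Hom[OF f]
  obtain K' K u g where T: "tri K' K F t u g f" using extend_last[OF fH] by blast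
  have gH: "g \<in> Hom C K F" using tri_Hom[OF T] by simp
  have "K \<in> Obj C" using Hom_Obj[OF gH] by simp
  then obtain F' p where F': "F' \<in> S" and p: "covers C S F' K p" using cov by blast
  note pH = covers_Hom[OF p]
  have gpH: "g \<cdot>\<^bsub>C\<^esub> p \<in> Hom C F' F" by (rule Comp_Hom[OF pH gH])
  obtain B D q v where B: "B \<in> S" and T': "tri F' F B D (g \<cdot>\<^bsub>C\<^esub> p) q v"
    using S_first[OF gpH F' F] by blast
  have qH: "q \<in> Hom C F B" using tri_Hom[OF T'] by simp
  have "f \<cdot>\<^bsub>C\<^esub> (g \<cdot>\<^bsub>C\<^esub> p) = Zero C F' t" using exact_third[OF T gpH] pH by blast
  then obtain c where cH: "c \<in> Hom C B t" and fc: "f = c \<cdot>\<^bsub>C\<^esub> q"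
    using coexact_second[OF T' fH] by blast
  \<comment> \<open>Lifting to \<open>F\<close> and pushing to \<open>B\<close> is independent of the lift, hence is a natural section
    of composition with \<open>c\<close>.\<close>
  have well: "q \<cdot>\<^bsub>C\<^esub> k = q \<cdot>\<^bsub>C\<^esub> k'" if s: "s \<in> S" and k: "k \<in> Hom C s F" "k' \<in> Hom C s F"
    and eq: "f \<cdot>\<^bsub>C\<^esub> k = f \<cdot>\<^bsub>C\<^esub> k'" for s k k'
  proof -
    obtain d where d: "d \<in> Hom C s F" and kd: "k = Add C k' d" and "f \<cdot>\<^bsub>C\<^esub> d = Zero C s t"
      by (rule difference_left[OF k fH eq])
    then obtain l where l: "l \<in> Hom C s K" and dl: "d = g \<cdot>\<^bsub>C\<^esub> l" using exact_third[OF T d] by blast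
    obtain m where m: "m \<in> Hom C s F'" and pm: "p \<cdot>\<^bsub>C\<^esub> m = l" by (rule coversE[OF p s l])
    have "d = (g \<cdot>\<^bsub>C\<^esub> p) \<cdot>\<^bsub>C\<^esub> m" using dl pm Comp_assoc[OF m pH gH] by simp
    then have "q \<cdot>\<^bsub>C\<^esub> d = Zero C s B" using exact_second[OF T' d] m by blast
    then show ?thesis
      using Comp_Add_right[OF k(2) d qH] kd Add_Zero(2)[OF Comp_Hom[OF k(2) qH]] by simp
  qed
  define \<sigma> where "\<sigma> s h = q \<cdot>\<^bsub>C\<^esub> (SOME k. k \<in> Hom C s F \<and> f \<cdot>\<^bsub>C\<^esub> k = h)" for s h
  have \<sigma>: "\<sigma> s (f \<cdot>\<^bsub>C\<^esub> k) = q \<cdot>\<^bsub>C\<^esub> k" if s: "s \<in> S" and k: "k \<in> Hom C s F" for s k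
  proof -
    have "(SOME k'. k' \<in> Hom C s F \<and> f \<cdot>\<^bsub>C\<^esub> k' = f \<cdot>\<^bsub>C\<^esub> k) \<in> Hom C s F \<and>
      f \<cdot>\<^bsub>C\<^esub> (SOME k'. k' \<in> Hom C s F \<and> f \<cdot>\<^bsub>C\<^esub> k' = f \<cdot>\<^bsub>C\<^esub> k) = f \<cdot>\<^bsub>C\<^esub> k"
      by (rule someI[of _ k]) (simp add: k)
    then show ?thesis using well[OF s _ k] by (simp add: \<sigma>_def)
  qed
  have \<sigma>H: "\<sigma> s h \<in> Hom C s B" and c\<sigma>: "c \<cdot>\<^bsub>C\<^esub> \<sigma> s h = h"
    if s: "s \<in> S" and h: "h \<in> Hom C s t" for s h
  proof -
    obtain k where k: "k \<in> Hom C s F" and fk: "f \<cdot>\<^bsub>C\<^esub> k = h" by (rule coversE[OF f s h])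
    show "\<sigma> s h \<in> Hom C s B" using \<sigma>[OF s k] fk Comp_Hom[OF k qH] by simp
    show "c \<cdot>\<^bsub>C\<^esub> \<sigma> s h = h" using \<sigma>[OF s k] fk fc Comp_assoc[OF k qH cH] by simp
  qed
  have \<sigma>nat: "\<sigma> s' (h \<cdot>\<^bsub>C\<^esub> w) = \<sigma> s h \<cdot>\<^bsub>C\<^esub> w"
    if s: "s \<in> S" "s' \<in> S" and h: "h \<in> Hom C s t" and w: "w \<in> Hom C s' s" for s s' h w
  proof -
    obtain k where k: "k \<in> Hom C s F" and fk: "f \<cdot>\<^bsub>C\<^esub> k = h" by (rule coversE[OF f s(1) h])
    show ?thesis
      using \<sigma>[OF s(1) k] \<sigma>[OF s(2) Comp_Hom[OF w k]] fk Comp_assoc[OF w k fH] Comp_assoc[OF w k qH]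
      by simp
  qed
  define e where "e = \<sigma> B c"
  have eH: "e \<in> Hom C B B" using \<sigma>H[OF B cH] by (simp add: e_def)
  have ce: "c \<cdot>\<^bsub>C\<^esub> e = c" using c\<sigma>[OF B cH] by (simp add: e_def)
  have e: "e \<cdot>\<^bsub>C\<^esub> w = \<sigma> s (c \<cdot>\<^bsub>C\<^esub> w)" if "s \<in> S" "w \<in> Hom C s B" for s w
    using \<sigma>nat[OF B that(1) cH that(2)] by (simp add: e_def)
  have "e \<cdot>\<^bsub>C\<^esub> e = e" using e[OF B eH] ce by (simp add: e_def)
  then obtain A \<pi> \<iota> where A: "A \<in> S" and \<pi>: "\<pi> \<in> Hom C B A" and \<iota>: "\<iota> \<in> Hom C A B"
    and \<iota>\<pi>: "\<iota> \<cdot>\<^bsub>C\<^esub> \<pi> = e" and \<pi>\<iota>: "\<pi> \<cdot>\<^bsub>C\<^esub> \<iota> = Ident C A"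
    using split[OF B eH] by blast
  have c\<iota>: "c \<cdot>\<^bsub>C\<^esub> \<iota> \<in> Hom C A t" by (rule Comp_Hom[OF \<iota> cH])
  have "coreflection C S A t (c \<cdot>\<^bsub>C\<^esub> \<iota>)"
    unfolding coreflection_def covers_def
  proof (intro conjI ballI impI)
    show "A \<in> S" by (rule A)
    show "c \<cdot>\<^bsub>C\<^esub> \<iota> \<in> Hom C A t" by (rule c\<iota>)
  next
    fix s h assume s: "s \<in> S" and h: "h \<in> Hom C s t"
    note \<sigma>h = \<sigma>H[OF s h]
    have \<pi>\<sigma>: "\<pi> \<cdot>\<^bsub>C\<^esub> \<sigma> s h \<in> Hom C s A" by (rule Comp_Hom[OF \<sigma>h \<pi>])
    have "(c \<cdot>\<^bsub>C\<^esub> \<iota>) \<cdot>\<^bsub>C\<^esub> (\<pi> \<cdot>\<^bsub>C\<^esub> \<sigma> s h) = c \<cdot>\<^bsub>C\<^esub> (e \<cdot>\<^bsub>C\<^esub> \<sigma> s h)"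
      using Comp_assoc[OF \<pi>\<sigma> \<iota> cH] Comp_assoc[OF \<sigma>h \<pi> \<iota>] \<iota>\<pi> by simp
    also have "\<dots> = h" using Comp_assoc[OF \<sigma>h eH cH] ce c\<sigma>[OF s h] by simp
    finally show "\<exists>l \<in> Hom C s A. (c \<cdot>\<^bsub>C\<^esub> \<iota>) \<cdot>\<^bsub>C\<^esub> l = h" using \<pi>\<sigma> by blast
  next
    fix s k l assume s: "s \<in> S" and k: "k \<in> Hom C s A" and l: "l \<in> Hom C s A"
      and eq: "(c \<cdot>\<^bsub>C\<^esub> \<iota>) \<cdot>\<^bsub>C\<^esub> k = (c \<cdot>\<^bsub>C\<^esub> \<iota>) \<cdot>\<^bsub>C\<^esub> l"
    have *: "w = \<pi> \<cdot>\<^bsub>C\<^esub> \<sigma> s ((c \<cdot>\<^bsub>C\<^esub> \<iota>) \<cdot>\<^bsub>C\<^esub> w)" if w: "w \<in> Hom C s A" for w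
    proof -
      have \<iota>w: "\<iota> \<cdot>\<^bsub>C\<^esub> w \<in> Hom C s B" and \<pi>\<iota>w: "\<pi> \<cdot>\<^bsub>C\<^esub> (\<iota> \<cdot>\<^bsub>C\<^esub> w) = w"
        using Comp_Hom[OF w \<iota>] Comp_assoc[OF w \<iota> \<pi>] \<pi>\<iota> Comp_Ident_left[OF w] by simp_all
      have "\<sigma> s ((c \<cdot>\<^bsub>C\<^esub> \<iota>) \<cdot>\<^bsub>C\<^esub> w) = e \<cdot>\<^bsub>C\<^esub> (\<iota> \<cdot>\<^bsub>C\<^esub> w)"
        using e[OF s \<iota>w] Comp_assoc[OF w \<iota> cH] by simp
      also have "\<dots> = \<iota> \<cdot>\<^bsub>C\<^esub> w" using Comp_assoc[OF \<iota>w \<pi> \<iota>] \<iota>\<pi> \<pi>\<iota>w by simp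
      finally show ?thesis using \<pi>\<iota>w by simp
    qed
    show "k = l" using *[OF k] *[OF l] eq by simp
  qed
  then show ?thesis by blast
qed

text \<open>One of the two four lemmas, for the functors \<open>Hom(s, -)\<close>.\<close>

lemma covers_middle:
  assumes T: "tri x y z D f g h" and T': "tri x' M z' D' f' g' h'"
    and a: "covers C S x' x a" and b: "covers C S z' z b" and d: "d \<in> Hom C D' D"
    and d_mono: "\<And>s k. s \<in> S \<Longrightarrow> k \<in> Hom C s D' \<Longrightarrow> d \<cdot>\<^bsub>C\<^esub> k = Zero C s D \<Longrightarrow> k = Zero C s D'"
    and m: "m \<in> Hom C M y" and mf: "m \<cdot>\<^bsub>C\<^esub> f' = f \<cdot>\<^bsub>C\<^esub> a" and gm: "g \<cdot>\<^bsub>C\<^esub> m = b \<cdot>\<^bsub>C\<^esub> g'"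
    and hb: "h \<cdot>\<^bsub>C\<^esub> b = d \<cdot>\<^bsub>C\<^esub> h'"
  shows "covers C S M y m"
  unfolding covers_def
proof (intro conjI ballI)
  show "m \<in> Hom C M y" by (rule m)
  fix s \<phi> assume s: "s \<in> S" and \<phi>: "\<phi> \<in> Hom C s y"
  note aH = covers_Hom[OF a] and bH = covers_Hom[OF b]
  have fH: "f \<in> Hom C x y" and gH: "g \<in> Hom C y z" and hH: "h \<in> Hom C z D"
    using tri_Hom[OF T] by simp_all
  have f'H: "f' \<in> Hom C x' M" and g'H: "g' \<in> Hom C M z'" and h'H: "h' \<in> Hom C z' D'"
    using tri_Hom[OF T'] by simp_all
  have g\<phi>: "g \<cdot>\<^bsub>C\<^esub> \<phi> \<in> Hom C s z" by (rule Comp_Hom[OF \<phi> gH])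
  obtain l where l: "l \<in> Hom C s z'" and bl: "b \<cdot>\<^bsub>C\<^esub> l = g \<cdot>\<^bsub>C\<^esub> \<phi>" by (rule coversE[OF b s g\<phi>])
  have h'l: "h' \<cdot>\<^bsub>C\<^esub> l \<in> Hom C s D'" by (rule Comp_Hom[OF l h'H])
  have "h \<cdot>\<^bsub>C\<^esub> (g \<cdot>\<^bsub>C\<^esub> \<phi>) = Zero C s D" using exact_third[OF T g\<phi>] \<phi> by blast
  then have "d \<cdot>\<^bsub>C\<^esub> (h' \<cdot>\<^bsub>C\<^esub> l) = Zero C s D"
    using Comp_assoc[OF l h'H d] Comp_assoc[OF l bH hH] hb bl by simp
  then have "h' \<cdot>\<^bsub>C\<^esub> l = Zero C s D'" by (rule d_mono[OF s h'l])
  then obtain \<omega> where \<omega>: "\<omega> \<in> Hom C s M" and l\<omega>: "l = g' \<cdot>\<^bsub>C\<^esub> \<omega>" using exact_third[OF T' l] by blast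
  have m\<omega>: "m \<cdot>\<^bsub>C\<^esub> \<omega> \<in> Hom C s y" by (rule Comp_Hom[OF \<omega> m])
  have eq: "g \<cdot>\<^bsub>C\<^esub> \<phi> = g \<cdot>\<^bsub>C\<^esub> (m \<cdot>\<^bsub>C\<^esub> \<omega>)"
    using Comp_assoc[OF \<omega> m gH] Comp_assoc[OF \<omega> g'H bH] gm bl l\<omega> by simp
  obtain \<delta> where \<delta>: "\<delta> \<in> Hom C s y" and \<phi>\<delta>: "\<phi> = Add C (m \<cdot>\<^bsub>C\<^esub> \<omega>) \<delta>"
    and "g \<cdot>\<^bsub>C\<^esub> \<delta> = Zero C s z"
    by (rule difference_left[OF \<phi> m\<omega> gH eq])
  then obtain u where u: "u \<in> Hom C s x" and \<delta>u: "\<delta> = f \<cdot>\<^bsub>C\<^esub> u" using exact_second[OF T \<delta>] by blast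
  obtain v where v: "v \<in> Hom C s x'" and av: "a \<cdot>\<^bsub>C\<^esub> v = u" by (rule coversE[OF a s u])
  have f'v: "f' \<cdot>\<^bsub>C\<^esub> v \<in> Hom C s M" by (rule Comp_Hom[OF v f'H])
  have "m \<cdot>\<^bsub>C\<^esub> (f' \<cdot>\<^bsub>C\<^esub> v) = \<delta>"
    using Comp_assoc[OF v f'H m] Comp_assoc[OF v aH fH] mf av \<delta>u by simp
  then have "m \<cdot>\<^bsub>C\<^esub> Add C \<omega> (f' \<cdot>\<^bsub>C\<^esub> v) = \<phi>" using Comp_Add_right[OF \<omega> f'v m] \<phi>\<delta> by simp
  then show "\<exists>l \<in> Hom C s M. m \<cdot>\<^bsub>C\<^esub> l = \<phi>" using Add_Hom[OF \<omega> f'v] by blast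
qed

end

section \<open>Direct summands and retracts\<close>

lemma (in linear_category) direct_summand_retract:
  assumes "direct_summand C X Y"
  shows "retract C X Y"
proof -
  obtain X' \<iota> where c: "is_coproduct C UNIV (\<lambda>b. if b then X else X') Y \<iota>"
    using assms unfolding direct_summand_def by blast
  obtain \<pi> where b: "biproduct C UNIV (\<lambda>b. if b then X else X') Y \<iota> \<pi>"
    using coproduct_biproduct[OF _ c] by auto
  show ?thesis
    unfolding retract_def
    using biproductD(2)[OF b, of True] biproductD(3)[OF b, of True] biproductD(4)[OF b, of True] by auto
qed

text \<open>Splitting the complementary idempotent provides the other summand.\<close>

lemma (in linear_category) retract_direct_summand:
  assumes K: "karoubian C" and "retract C X Y"
  shows "direct_summand C X Y"
proof -
  obtain i r where i: "i \<in> Hom C X Y" and r: "r \<in> Hom C Y X" and ri: "r \<cdot>\<^bsub>C\<^esub> i = Ident C X"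
    using assms(2) unfolding retract_def by blast
  have Y: "Y \<in> Obj C" and X: "X \<in> Obj C" using Hom_Obj[OF i] by simp_all
  have ir: "i \<cdot>\<^bsub>C\<^esub> r \<in> Hom C Y Y" by (rule Comp_Hom[OF r i])
  have idH: "Ident C Y \<in> Hom C Y Y" by (rule Ident_Hom[OF Y])
  have r_ir: "r \<cdot>\<^bsub>C\<^esub> (i \<cdot>\<^bsub>C\<^esub> r) = r" using Comp_assoc[OF r i r] ri Comp_Ident_left[OF r] by simp
  have ir_i: "(i \<cdot>\<^bsub>C\<^esub> r) \<cdot>\<^bsub>C\<^esub> i = i" using Comp_assoc[OF i r i] ri Comp_Ident_right[OF i] by simp
  \<comment> \<open>\<open>e\<close> is the complementary idempotent \<open>1 - i r\<close>.\<close>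
  obtain e where e: "e \<in> Hom C Y Y" and 1: "Ident C Y = Add C (i \<cdot>\<^bsub>C\<^esub> r) e"
    and re: "r \<cdot>\<^bsub>C\<^esub> e = Zero C Y X" and ei: "e \<cdot>\<^bsub>C\<^esub> i = Zero C X Y"
  proof (rule difference[OF idH ir])
    fix e assume e: "e \<in> Hom C Y Y" "Ident C Y = Add C (i \<cdot>\<^bsub>C\<^esub> r) e"
      and l: "\<And>Z g. g \<in> Hom C Y Z \<Longrightarrow> g \<cdot>\<^bsub>C\<^esub> Ident C Y = g \<cdot>\<^bsub>C\<^esub> (i \<cdot>\<^bsub>C\<^esub> r) \<Longrightarrow> g \<cdot>\<^bsub>C\<^esub> e = Zero C Y Z"
      and r': "\<And>W g. g \<in> Hom C W Y \<Longrightarrow> Ident C Y \<cdot>\<^bsub>C\<^esub> g = (i \<cdot>\<^bsub>C\<^esub> r) \<cdot>\<^bsub>C\<^esub> g \<Longrightarrow> e \<cdot>\<^bsub>C\<^esub> g = Zero C W Y"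
    show thesis
      by (rule that[OF e l[OF r] r'[OF i]])
        (simp_all add: r_ir ir_i Comp_Ident_right[OF r] Comp_Ident_left[OF i])
  qed
  have "(i \<cdot>\<^bsub>C\<^esub> r) \<cdot>\<^bsub>C\<^esub> e = Zero C Y Y" using Comp_assoc[OF e r i] re Comp_Zero_right[OF i Y] by simp
  then have "e \<cdot>\<^bsub>C\<^esub> e = Ident C Y \<cdot>\<^bsub>C\<^esub> e"
    using 1 Comp_Add_left[OF e ir e] Add_Zero(1)[OF Comp_Hom[OF e e]] by simp
  then have "e \<cdot>\<^bsub>C\<^esub> e = e" using Comp_Ident_left[OF e] by simp
  then obtain X' p' i' where p': "p' \<in> Hom C Y X'" and i': "i' \<in> Hom C X' Y"
    and i'p': "i' \<cdot>\<^bsub>C\<^esub> p' = e" and p'i': "p' \<cdot>\<^bsub>C\<^esub> i' = Ident C X'"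
    using K Y e unfolding karoubian_def by blast
  have X': "X' \<in> Obj C" using Hom_Obj[OF i'] by simp
  have "r \<cdot>\<^bsub>C\<^esub> i' = (r \<cdot>\<^bsub>C\<^esub> i') \<cdot>\<^bsub>C\<^esub> (p' \<cdot>\<^bsub>C\<^esub> i')"
    using Comp_Ident_right[OF Comp_Hom[OF i' r]] p'i' by simp
  also have "\<dots> = (r \<cdot>\<^bsub>C\<^esub> e) \<cdot>\<^bsub>C\<^esub> i'"
    using Comp_assoc[OF i' p' Comp_Hom[OF i' r]] Comp_assoc[OF p' i' r] i'p' by simp
  also have "\<dots> = Zero C X' X" using re Comp_Zero_left[OF i' X] by simp
  finally have ri': "r \<cdot>\<^bsub>C\<^esub> i' = Zero C X' X" .
  have "p' \<cdot>\<^bsub>C\<^esub> i = (p' \<cdot>\<^bsub>C\<^esub> i') \<cdot>\<^bsub>C\<^esub> (p' \<cdot>\<^bsub>C\<^esub> i)"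
    using Comp_Ident_left[OF Comp_Hom[OF i p']] p'i' by simp
  also have "\<dots> = p' \<cdot>\<^bsub>C\<^esub> (e \<cdot>\<^bsub>C\<^esub> i)"
    using Comp_assoc[OF Comp_Hom[OF i p'] i' p'] Comp_assoc[OF i p' i'] i'p' by simp
  also have "\<dots> = Zero C X X'" using ei Comp_Zero_right[OF p' X] by simp
  finally have p'i: "p' \<cdot>\<^bsub>C\<^esub> i = Zero C X X'" .
  have "is_coproduct C (UNIV :: bool set) (\<lambda>b. if b then X else X') Y (\<lambda>b. if b then i else i')"
    unfolding is_coproduct_def
  proof (intro conjI ballI allI impI)
    fix Z f assume Z: "Z \<in> Obj C" and f: "\<forall>b \<in> UNIV. f b \<in> Hom C (if b then X else X') Z"
    have fT: "f True \<in> Hom C X Z" and fF: "f False \<in> Hom C X' Z"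
      using f[rule_format, of True] f[rule_format, of False] by simp_all
    note fr = Comp_Hom[OF r fT] and fp = Comp_Hom[OF p' fF]
    let ?u = "Add C (f True \<cdot>\<^bsub>C\<^esub> r) (f False \<cdot>\<^bsub>C\<^esub> p')"
    have "?u \<cdot>\<^bsub>C\<^esub> i = f True"
      using Comp_Add_left[OF i fr fp] Comp_assoc[OF i r fT] Comp_assoc[OF i p' fF] ri p'i
        Comp_Ident_right[OF fT] Comp_Zero_right[OF fF X] Add_Zero(2)[OF fT] by simp
    moreover have "?u \<cdot>\<^bsub>C\<^esub> i' = f False"
      using Comp_Add_left[OF i' fr fp] Comp_assoc[OF i' r fT] Comp_assoc[OF i' p' fF] ri' p'i'
        Comp_Ident_right[OF fF] Comp_Zero_right[OF fT X'] Add_Zero(1)[OF fF] by simp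
    moreover have "u = ?u" if u: "u \<in> Hom C Y Z" "u \<cdot>\<^bsub>C\<^esub> i = f True" "u \<cdot>\<^bsub>C\<^esub> i' = f False" for u
      using Comp_Add_right[OF ir e u(1)] 1 Comp_Ident_right[OF u(1)] Comp_assoc[OF r i u(1)]
        Comp_assoc[OF p' i' u(1)] i'p' u by simp
    ultimately have "\<exists>!u. u \<in> Hom C Y Z \<and> u \<cdot>\<^bsub>C\<^esub> i' = f False \<and> u \<cdot>\<^bsub>C\<^esub> i = f True"
      using Add_Hom[OF fr fp] by (intro ex1I[of _ ?u]) blast+
    then show "\<exists>!u. u \<in> Hom C Y Z \<and> (\<forall>b \<in> UNIV. u \<cdot>\<^bsub>C\<^esub> (if b then i else i') = f b)"
      by (simp add: UNIV_bool)
  next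
    fix b :: bool
    show "(if b then X else X') \<in> Obj C" using X X' by simp
    show "(if b then i else i') \<in> Hom C (if b then X else X') Y" using i i' by simp
  qed (rule Y)
  then show ?thesis unfolding direct_summand_def by blast
qed

section \<open>Exactness in triangulated categories\<close>

context linear_category
begin

abbreviation neg :: "'o \<Rightarrow> 'o \<Rightarrow> 'm \<Rightarrow> 'm" where
  "neg X Y f \<equiv> \<ominus>\<^bsub>hom_module C X Y\<^esub> f"

lemma neg_Hom: "f \<in> Hom C X Y \<Longrightarrow> neg X Y f \<in> Hom C X Y"
  using abelian_group.a_inv_closed[OF hom_abelian_group, of X Y f] Hom_Obj[of f X Y]
  by (simp add: hom_module_def)

lemma neg_neg: "f \<in> Hom C X Y \<Longrightarrow> neg X Y (neg X Y f) = f"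
  using abelian_group.minus_minus[OF hom_abelian_group, of X Y f] Hom_Obj[of f X Y]
  by (simp add: hom_module_def)

lemma Add_neg: "f \<in> Hom C X Y \<Longrightarrow> Add C (neg X Y f) f = Zero C X Y"
  using abelian_group.l_neg[OF hom_abelian_group, of X Y f] Hom_Obj[of f X Y]
  by (simp add: hom_module_def)

lemma neg_unique:
  assumes "f \<in> Hom C X Y" "g \<in> Hom C X Y" "Add C g f = Zero C X Y"
  shows "g = neg X Y f"
  using abelian_group.minus_equality[OF hom_abelian_group, of X Y g f] Hom_Obj[OF assms(1)] assms
  by (simp add: hom_module_def)

lemma Comp_neg_right:
  assumes f: "f \<in> Hom C X Y" and g: "g \<in> Hom C Y Z"
  shows "g \<cdot>\<^bsub>C\<^esub> neg X Y f = neg X Z (g \<cdot>\<^bsub>C\<^esub> f)"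
proof (rule neg_unique)
  show "g \<cdot>\<^bsub>C\<^esub> f \<in> Hom C X Z" "g \<cdot>\<^bsub>C\<^esub> neg X Y f \<in> Hom C X Z"
    using Comp_Hom[OF f g] Comp_Hom[OF neg_Hom[OF f] g] by simp_all
  show "Add C (g \<cdot>\<^bsub>C\<^esub> neg X Y f) (g \<cdot>\<^bsub>C\<^esub> f) = Zero C X Z"
    using Comp_Add_right[OF neg_Hom[OF f] f g] Add_neg[OF f] Comp_Zero_right[OF g] Hom_Obj[OF f]
    by simp
qed

lemma Comp_neg_left:
  assumes f: "f \<in> Hom C X Y" and g: "g \<in> Hom C Y Z"
  shows "neg Y Z g \<cdot>\<^bsub>C\<^esub> f = neg X Z (g \<cdot>\<^bsub>C\<^esub> f)"
proof (rule neg_unique)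
  show "g \<cdot>\<^bsub>C\<^esub> f \<in> Hom C X Z" "neg Y Z g \<cdot>\<^bsub>C\<^esub> f \<in> Hom C X Z"
    using Comp_Hom[OF f g] Comp_Hom[OF f neg_Hom[OF g]] by simp_all
  show "Add C (neg Y Z g \<cdot>\<^bsub>C\<^esub> f) (g \<cdot>\<^bsub>C\<^esub> f) = Zero C X Z"
    using Comp_Add_left[OF f neg_Hom[OF g] g] Add_neg[OF g] Comp_Zero_left[OF f] Hom_Obj[OF g]
    by simp
qed

lemma neg_inject:
  assumes "f \<in> Hom C X Y" "g \<in> Hom C X Y" "neg X Y f = neg X Y g"
  shows "f = g"
proof -
  have "f = neg X Y (neg X Y f)" by (rule neg_neg[OF assms(1), symmetric])
  also have "\<dots> = g" unfolding assms(3) by (rule neg_neg[OF assms(2)])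
  finally show ?thesis .
qed

end

context linear_triangulated_category
begin

lemma susp_Obj: "X \<in> Obj T \<Longrightarrow> susp_obj T X \<in> Obj T"
  using Susp_bij_Obj by (auto simp: bij_betw_def)

lemma susp_Hom:
  assumes f: "f \<in> Hom T X Y"
  shows "susp_arr T f \<in> Hom T (susp_obj T X) (susp_obj T Y)"
proof -
  have "X \<in> Obj T" "Y \<in> Obj T" using Hom_Obj[OF f] by simp_all
  then show ?thesis
    using Susp_functor[unfolded is_functor_def, THEN conjunct2, THEN conjunct1] f by simp
qed

lemma susp_Ident: "X \<in> Obj T \<Longrightarrow> susp_arr T (Ident T X) = Ident T (susp_obj T X)"
  using Susp_functor[unfolded is_functor_def, THEN conjunct1] by simp

lemma susp_Comp:
  assumes f: "f \<in> Hom T X Y" and g: "g \<in> Hom T Y Z"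
  shows "susp_arr T (g \<cdot> f) = susp_arr T g \<cdot> susp_arr T f"
  by (rule Susp_functor[unfolded is_functor_def, THEN conjunct2, THEN conjunct2, rule_format])
    (use Hom_Obj[OF f] Hom_Obj[OF g] f g in simp_all)

lemma susp_obj_inject: "X \<in> Obj T \<Longrightarrow> Y \<in> Obj T \<Longrightarrow> susp_obj T X = susp_obj T Y \<Longrightarrow> X = Y"
  using Susp_bij_Obj by (auto simp: bij_betw_def inj_on_def)

lemma susp_inject:
  assumes "f \<in> Hom T X Y" "g \<in> Hom T X' Y'" "susp_arr T f = susp_arr T g"
  shows "f = g"
  using Susp_bij_Arr assms by (auto simp: bij_betw_def inj_on_def Hom_def)

lemma susp_full:
  assumes "X \<in> Obj T" "Y \<in> Obj T" "g \<in> Hom T (susp_obj T X) (susp_obj T Y)"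
  obtains f where "f \<in> Hom T X Y" "susp_arr T f = g"
proof -
  have "g \<in> Arr T" using assms by (simp add: Hom_def)
  then have "g \<in> susp_arr T ` Arr T" using Susp_bij_Arr by (simp add: bij_betw_def)
  then obtain f where f: "f \<in> Arr T" "susp_arr T f = g" by blast
  then have fH: "f \<in> Hom T (Dom T f) (Cod T f)" by (simp add: Hom_def)
  have "susp_obj T (Dom T f) = susp_obj T X" "susp_obj T (Cod T f) = susp_obj T Y"
    using susp_Hom[OF fH] f assms by (auto simp: Hom_def)
  then have "Dom T f = X" "Cod T f = Y"
    using susp_obj_inject Hom_Obj[OF fH] assms by simp_all
  then show thesis using that[of f] fH f by simp
qed

lemma susp_bij_Hom:
  assumes "X \<in> Obj T" "Y \<in> Obj T"
  shows "bij_betw (susp_arr T) (Hom T X Y) (Hom T (susp_obj T X) (susp_obj T Y))"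
  unfolding bij_betw_def
proof
  show "inj_on (susp_arr T) (Hom T X Y)" by (rule inj_onI) (rule susp_inject)
  show "susp_arr T ` Hom T X Y = Hom T (susp_obj T X) (susp_obj T Y)"
  proof (intro equalityI subsetI)
    fix g assume "g \<in> Hom T (susp_obj T X) (susp_obj T Y)"
    then obtain f where "f \<in> Hom T X Y" "susp_arr T f = g" by (rule susp_full[OF assms])
    then show "g \<in> susp_arr T ` Hom T X Y" by blast
  next
    fix g assume "g \<in> susp_arr T ` Hom T X Y"
    then show "g \<in> Hom T (susp_obj T X) (susp_obj T Y)" by (elim imageE) (simp add: susp_Hom)
  qed
qed

lemma desuspend:
  assumes "X \<in> Obj T"
  obtains X' where "X' \<in> Obj T" "susp_obj T X' = X"
proof -
  have "X \<in> susp_obj T ` Obj T" using Susp_bij_Obj assms by (simp add: bij_betw_def)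
  then show thesis using that by (elim imageE) simp
qed

lemma dist_Hom:
  assumes "dist_triangle T X Y Z f g h"
  shows "f \<in> Hom T X Y" "g \<in> Hom T Y Z" "h \<in> Hom T Z (susp_obj T X)"
  using assms by (simp_all add: dist_triangle_def triangle_def)

lemma rotate:
  assumes "dist_triangle T X Y Z f g h"
  shows "dist_triangle T Y Z (susp_obj T X) g h (neg (susp_obj T X) (susp_obj T Y) (susp_arr T f))"
  using TR2[of X Y Z f g h] assms by (simp add: dist_triangle_def)

lemma unrotate:
  assumes d: "dist_triangle T A B (susp_obj T X) h u v" and X: "X \<in> Obj T"
  obtains g where "dist_triangle T X A B g h u"
    "v = neg (susp_obj T X) (susp_obj T A) (susp_arr T g)"
proof -
  note dH = dist_Hom[OF d]
  have A: "A \<in> Obj T" using Hom_Obj[OF dH(1)] by simp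
  obtain g where g: "g \<in> Hom T X A" "susp_arr T g = neg (susp_obj T X) (susp_obj T A) v"
    using susp_full[OF X A neg_Hom[OF dH(3)]] by blast
  then have v: "v = neg (susp_obj T X) (susp_obj T A) (susp_arr T g)"
    using neg_neg[OF dH(3)] by simp
  have "triangle T X A B g h u" using g dH by (simp add: triangle_def)
  then have "dist_triangle T X A B g h u" using TR2[of X A B g h u] d v by simp
  then show thesis using v by (rule that)
qed

lemma zero_object_exists: obtains N where "zero_object T N"
proof -
  obtain Z \<iota> where c: "is_coproduct T {..<0::nat} (\<lambda>_. undefined) Z \<iota>"
    using finite_coproducts unfolding has_finite_coproducts_def by (metis less_nat_zero_code)
  then have Z: "Z \<in> Obj T" and u: "\<exists>!u. u \<in> Hom T Z Z" by (simp_all add: is_coproduct_def)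
  then have "Ident T Z = Zero T Z Z" using Ident_Hom[OF Z] Zero_Hom[OF Z Z] by blast
  then show thesis using that zero_object_iff Z by blast
qed

lemma dist_Comp_Zero:
  assumes d: "dist_triangle T X Y Z f g h"
  shows "g \<cdot> f = Zero T X Z"
proof -
  note dH = dist_Hom[OF d]
  have X: "X \<in> Obj T" and Z: "Z \<in> Obj T" using Hom_Obj[OF dH(1)] Hom_Obj[OF dH(2)] by simp_all
  obtain N where N: "zero_object T N" by (rule zero_object_exists)
  then have NO: "N \<in> Obj T" and N0: "\<And>Y. Y \<in> Obj T \<Longrightarrow> \<exists>!f. f \<in> Hom T N Y"
    by (simp_all add: zero_object_def)
  obtain c where c: "c \<in> Hom T N Z" "c \<cdot> Zero T X N = g \<cdot> f"
    using TR3[OF TR1_Ident[OF X N] d Ident_Hom[OF X] dH(1)] by blast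
  show ?thesis using c(2) Comp_Zero_right[OF c(1) X] by simp
qed

text \<open>An arrow \<open>Y \<rightarrow> V\<close> that vanishes on \<open>X\<close> extends to a morphism from the given triangle to
  \<open>0 \<rightarrow> V \<rightarrow> V \<rightarrow> 0\<close>, whose third component is the factorization.\<close>

lemma dist_coexact:
  assumes d: "dist_triangle T X Y Z f g h" and k: "k \<in> Hom T Y V"
  shows "k \<cdot> f = Zero T X V \<longleftrightarrow> (\<exists>l \<in> Hom T Z V. k = l \<cdot> g)"
proof
  note dH = dist_Hom[OF d]
  have X: "X \<in> Obj T" and V: "V \<in> Obj T" using Hom_Obj[OF dH(1)] Hom_Obj[OF k] by simp_all
  assume kf: "k \<cdot> f = Zero T X V"
  obtain N where N: "zero_object T N" by (rule zero_object_exists)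
  then obtain N' where N': "N' \<in> Obj T" "susp_obj T N' = N"
    using desuspend by (auto simp: zero_object_def)
  obtain w where w: "dist_triangle T N' V V w (Ident T V) (Zero T V N)"
    using unrotate[of V V N' "Ident T V" "Zero T V N" "Zero T N (susp_obj T V)"] TR1_Ident[OF V N] N'
    by auto
  have "k \<cdot> f = w \<cdot> Zero T X N'" using kf Comp_Zero_right[OF dist_Hom(1)[OF w] X] by simp
  then obtain c where "c \<in> Hom T Z V" "c \<cdot> g = Ident T V \<cdot> k"
    using TR3[OF d w Zero_Hom[OF X N'(1)] k] by blast
  then show "\<exists>l \<in> Hom T Z V. k = l \<cdot> g" using Comp_Ident_left[OF k] by (metis)
next
  note dH = dist_Hom[OF d]
  assume "\<exists>l \<in> Hom T Z V. k = l \<cdot> g"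
  then obtain l where l: "l \<in> Hom T Z V" "k = l \<cdot> g" by blast
  have X: "X \<in> Obj T" using Hom_Obj[OF dH(1)] by simp
  show "k \<cdot> f = Zero T X V"
    using Comp_assoc[OF dH(1) dH(2) l(1)] l dist_Comp_Zero[OF d] Comp_Zero_right[OF l(1) X] by simp
qed

text \<open>Dually, \<open>k\<close> extends to a morphism of triangles starting at \<open>V \<rightarrow> 0 \<rightarrow> \<Sigma>V\<close>, and the arrow
  \<open>\<Sigma>V \<rightarrow> \<Sigma>X\<close> obtained is the suspension of the factorization.\<close>

lemma dist_exact:
  assumes d: "dist_triangle T X Y Z f g h" and k: "k \<in> Hom T V Y"
  shows "g \<cdot> k = Zero T V Z \<longleftrightarrow> (\<exists>l \<in> Hom T V X. k = f \<cdot> l)"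
proof
  note dH = dist_Hom[OF d]
  have X: "X \<in> Obj T" and V: "V \<in> Obj T" and Z: "Z \<in> Obj T"
    using Hom_Obj[OF dH(1)] Hom_Obj[OF dH(2)] Hom_Obj[OF k] by simp_all
  assume gk: "g \<cdot> k = Zero T V Z"
  obtain N where N: "zero_object T N" by (rule zero_object_exists)
  then have NO: "N \<in> Obj T" by (simp add: zero_object_def)
  have eq: "Zero T N Z \<cdot> Zero T V N = g \<cdot> k"
    using gk Comp_Zero_right[OF Zero_Hom[OF NO Z] V] by simp
  obtain c where c: "c \<in> Hom T (susp_obj T V) (susp_obj T X)"
    and "susp_arr T k \<cdot> neg (susp_obj T V) (susp_obj T V) (susp_arr T (Ident T V)) =
      neg (susp_obj T X) (susp_obj T Y) (susp_arr T f) \<cdot> c"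
    using TR3[OF rotate[OF TR1_Ident[OF V N]] rotate[OF d] k Zero_Hom[OF NO Z] eq] by blast
  then have *: "neg (susp_obj T V) (susp_obj T Y) (susp_arr T k \<cdot> susp_arr T (Ident T V)) =
      neg (susp_obj T V) (susp_obj T Y) (susp_arr T f \<cdot> c)"
    using Comp_neg_right[OF susp_Hom[OF Ident_Hom[OF V]] susp_Hom[OF k]]
      Comp_neg_left[OF c susp_Hom[OF dH(1)]] by simp
  have "susp_arr T k \<cdot> susp_arr T (Ident T V) = susp_arr T f \<cdot> c"
    by (rule neg_inject[OF Comp_Hom[OF susp_Hom[OF Ident_Hom[OF V]] susp_Hom[OF k]]
          Comp_Hom[OF c susp_Hom[OF dH(1)]] *])
  then have kc: "susp_arr T k = susp_arr T f \<cdot> c"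
    using susp_Comp[OF Ident_Hom[OF V] k] Comp_Ident_right[OF k] by simp
  obtain l where l: "l \<in> Hom T V X" "susp_arr T l = c" by (rule susp_full[OF V X c])
  have "k = f \<cdot> l"
    using susp_inject[OF k Comp_Hom[OF l(1) dH(1)]] susp_Comp[OF l(1) dH(1)] l kc by simp
  then show "\<exists>l \<in> Hom T V X. k = f \<cdot> l" using l by blast
next
  note dH = dist_Hom[OF d]
  assume "\<exists>l \<in> Hom T V X. k = f \<cdot> l"
  then obtain l where l: "l \<in> Hom T V X" "k = f \<cdot> l" by blast
  have Z: "Z \<in> Obj T" using Hom_Obj[OF dH(2)] by simp
  show "g \<cdot> k = Zero T V Z"
    using Comp_assoc[OF l(1) dH(1) dH(2)] l dist_Comp_Zero[OF d] Comp_Zero_left[OF l(1) Z] by simp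
qed

text \<open>This is the completion axiom after rotating both triangles twice; the signs occur on both sides
  of each equation and cancel.\<close>

lemma fill_middle:
  assumes d: "dist_triangle T W X Y f g h" and d': "dist_triangle T W' X' Y' f' g' h'"
    and a: "a \<in> Hom T W W'" and b: "b \<in> Hom T Y Y'" and eq: "susp_arr T a \<cdot> h = h' \<cdot> b"
  shows "\<exists>x \<in> Hom T X X'. x \<cdot> f = f' \<cdot> a \<and> g' \<cdot> x = b \<cdot> g"
proof -
  note dH = dist_Hom[OF d] and dH' = dist_Hom[OF d']
  let ?s = "susp_obj T" and ?S = "susp_arr T"
  have X: "X \<in> Obj T" and X': "X' \<in> Obj T" using Hom_Obj[OF dH(1)] Hom_Obj[OF dH'(1)] by simp_all
  obtain c where c: "c \<in> Hom T (?s X) (?s X')"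
    and c1: "c \<cdot> neg (?s W) (?s X) (?S f) = neg (?s W') (?s X') (?S f') \<cdot> ?S a"
    and c2: "?S b \<cdot> neg (?s X) (?s Y) (?S g) = neg (?s X') (?s Y') (?S g') \<cdot> c"
    using TR3[OF rotate[OF rotate[OF d]] rotate[OF rotate[OF d']] b susp_Hom[OF a] eq] by blast
  obtain x where x: "x \<in> Hom T X X'" "?S x = c" by (rule susp_full[OF X X' c])
  have 1: "neg (?s W) (?s X') (?S (x \<cdot> f)) = neg (?s W) (?s X') (?S (f' \<cdot> a))"
    using c1 Comp_neg_right[OF susp_Hom[OF dH(1)] c] Comp_neg_left[OF susp_Hom[OF a] susp_Hom[OF dH'(1)]]
      susp_Comp[OF dH(1) x(1)] susp_Comp[OF a dH'(1)] x(2) by simp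
  have 2: "neg (?s X) (?s Y') (?S (b \<cdot> g)) = neg (?s X) (?s Y') (?S (g' \<cdot> x))"
    using c2 Comp_neg_right[OF susp_Hom[OF dH(2)] susp_Hom[OF b]] Comp_neg_left[OF c susp_Hom[OF dH'(2)]]
      susp_Comp[OF dH(2) b] susp_Comp[OF x(1) dH'(2)] x(2) by simp
  note xf = Comp_Hom[OF dH(1) x(1)] and fa = Comp_Hom[OF a dH'(1)]
    and bg = Comp_Hom[OF dH(2) b] and gx = Comp_Hom[OF x(1) dH'(2)]
  have "x \<cdot> f = f' \<cdot> a"
    by (rule susp_inject[OF xf fa neg_inject[OF susp_Hom[OF xf] susp_Hom[OF fa] 1]])
  moreover have "b \<cdot> g = g' \<cdot> x"
    by (rule susp_inject[OF bg gx neg_inject[OF susp_Hom[OF bg] susp_Hom[OF gx] 2]])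
  ultimately show ?thesis using x by auto
qed

text \<open>Rotating a cone of \<open>h\<close> backwards twice puts \<open>h\<close> in the last position.\<close>

lemma complete_last:
  assumes d: "dist_triangle T A B D h u v" and W: "W \<in> Obj T" "susp_obj T W = B"
    and X: "X \<in> Obj T" "susp_obj T X = D"
  shows "\<exists>f g. dist_triangle T W X A f g h"
proof -
  obtain g where "dist_triangle T X A B g h u" by (rule unrotate[of A B X h u v]) (use d X in auto)
  then show ?thesis using unrotate[of X A W g h u] W by blast
qed

end

definition triangle_segment ::
    "('o, 'm, 'r, 'x) tri_cat_scheme \<Rightarrow> 'o \<Rightarrow> 'o \<Rightarrow> 'o \<Rightarrow> 'o \<Rightarrow> 'm \<Rightarrow> 'm \<Rightarrow> 'm \<Rightarrow> bool" where
  "triangle_segment T W X Y Z f g h \<longleftrightarrow> dist_triangle T W X Y f g h \<and> Z = susp_obj T W"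

lemma (in linear_triangulated_category) triangulated_subcategoryD:
  assumes "triangulated_subcategory T S"
  shows "S \<subseteq> Obj T" "susp_obj T ` S = S" "has_finite_coproducts (full_sub T S)"
    "X \<in> S \<Longrightarrow> X \<in> Obj T" "X \<in> S \<Longrightarrow> susp_obj T X \<in> S"
    "X \<in> Obj T \<Longrightarrow> susp_obj T X \<in> S \<Longrightarrow> X \<in> S"
    "X \<in> S \<Longrightarrow> Y \<in> S \<Longrightarrow> f \<in> Hom T X Y \<Longrightarrow> \<exists>Z \<in> S. \<exists>g h. dist_triangle T X Y Z f g h"
proof -
  show S: "S \<subseteq> Obj T" and im: "susp_obj T ` S = S" and "has_finite_coproducts (full_sub T S)"
    and "X \<in> S \<Longrightarrow> Y \<in> S \<Longrightarrow> f \<in> Hom T X Y \<Longrightarrow> \<exists>Z \<in> S. \<exists>g h. dist_triangle T X Y Z f g h"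
    using assms unfolding triangulated_subcategory_def by blast+
  show "X \<in> S \<Longrightarrow> X \<in> Obj T" using S by blast
  show "X \<in> S \<Longrightarrow> susp_obj T X \<in> S" using im by blast
  assume X: "X \<in> Obj T" "susp_obj T X \<in> S"
  then obtain X' where "X' \<in> S" "susp_obj T X' = susp_obj T X" using im by (metis imageE)
  then show "X \<in> S" using susp_obj_inject X S by blast
qed

text \<open>A segment of \<open>S\<close> with prescribed last arrow is a cone formed in \<open>S\<close> and rotated back by \<open>complete_last\<close>;
  \<open>S\<close> contains the desuspensions of its objects.\<close>

lemma (in linear_triangulated_category) triangle_pair_full_sub:
  assumes S: "triangulated_subcategory T S"
  shows "triangle_pair R T (triangle_segment T) S"
proof -
  note SD = triangulated_subcategoryD[OF S]
  have des: "\<exists>X' \<in> S. susp_obj T X' = X" if "X \<in> S" for X using that SD(2) by (metis imageE)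
  have last: "\<exists>W X f g. dist_triangle T W X A f g h \<and> B = susp_obj T W \<and> W \<in> S \<and> X \<in> S"
    if h: "h \<in> Hom T A B" "A \<in> S" "B \<in> S" for A B h
  proof -
    obtain D u v where d: "D \<in> S" "dist_triangle T A B D h u v" using SD(7)[OF h(2,3,1)] by blast
    obtain W X where "W \<in> S" "susp_obj T W = B" "X \<in> S" "susp_obj T X = D"
      using des[OF h(3)] des[OF d(1)] by blast
    then show ?thesis using complete_last[OF d(2)] SD(4) by metis
  qed
  show ?thesis
  proof (intro triangle_pair.intro triangle_pair_axioms.intro, unfold triangle_segment_def, goal_cases)
    case 1 show ?case by (rule linear_category_axioms)
  next
    case (2 W X Y Z f g h) then show ?case using dist_Hom by blast
  next
    case (3 W X Y Z f g h k V) then show ?case using dist_exact by blast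
  next
    case (4 W X Y Z f g h k V) then show ?case using dist_exact[OF rotate] by blast
  next
    case (5 W X Y Z f g h k V) then show ?case using dist_coexact by blast
  next
    case (6 W X Y Z f g h k V) then show ?case using dist_coexact[OF rotate] by blast
  next
    case (7 f A B) then show ?case using TR1_cone by blast
  next
    case (8 h A B)
    then obtain D u v where d: "dist_triangle T A B D h u v" using TR1_cone by blast
    have "B \<in> Obj T" "D \<in> Obj T" using Hom_Obj[OF dist_Hom(2)[OF d]] by simp_all
    then obtain W X where "W \<in> Obj T" "susp_obj T W = B" "X \<in> Obj T" "susp_obj T X = D"
      using desuspend by metis
    then show ?case using complete_last[OF d] by metis
  next
    case (9 W X Y Z f g h X' Y' f' g' h' b)
    then have d: "dist_triangle T W X Y f g h" "dist_triangle T W X' Y' f' g' h'" by simp_all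
    note dH = dist_Hom[OF d(1)] and dH' = dist_Hom[OF d(2)]
    have W: "W \<in> Obj T" using Hom_Obj[OF dH(1)] by simp
    have "susp_arr T (Ident T W) \<cdot> h = h' \<cdot> b"
      using 9 susp_Ident[OF W] Comp_Ident_left[OF dH(3)] by simp
    from fill_middle[OF d Ident_Hom[OF W] 9(3) this] show ?case
      using Comp_Ident_right[OF dH'(1)] by simp
  next
    case (10 W X Y Z f g h X' Y' f' g' h' a)
    then have d: "dist_triangle T W X Y f g h" "dist_triangle T W X' Y' f' g' h'" by simp_all
    note dH = dist_Hom[OF d(1)] and dH' = dist_Hom[OF d(2)]
    have W: "W \<in> Obj T" using Hom_Obj[OF dH(1)] by simp
    have "a \<cdot> f = f' \<cdot> Ident T W" using 10 Comp_Ident_right[OF dH'(1)] by simp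
    from TR3[OF d Ident_Hom[OF W] 10(3) this] obtain c where c: "c \<in> Hom T Y Y'" "c \<cdot> g = g' \<cdot> a"
      "susp_arr T (Ident T W) \<cdot> h = h' \<cdot> c" by blast
    then show ?case using susp_Ident[OF W] Comp_Ident_left[OF dH(3)] by auto
  next
    case 11 show ?case by (rule SD(1))
  next
    case (12 f A B)
    then obtain D g h where "D \<in> S" "dist_triangle T A B D f g h" using SD(7) by blast
    then show ?case using SD(5) 12 by blast
  next
    case (13 h A B) then show ?case using last by blast
  next
    case (14 W X Y Z f g h B k)
    then have k: "k \<in> Hom T B (susp_obj T W)" by simp
    obtain W' F f' g' where d: "dist_triangle T W' F B f' g' k" "susp_obj T W = susp_obj T W'"
      "W' \<in> S" "F \<in> S"
      using last[OF k] 14 SD(5) by blast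
    then have "W' = W" using susp_obj_inject 14 SD(4) by metis
    then show ?case using d 14 by blast
  next
    case (15 W X Y Z f g h B k)
    then have "W \<in> Obj T" using Hom_Obj by blast
    then have "W \<in> S" using 15 SD(6) by simp
    then show ?case using SD(7)[of W B k] 15 by blast
  qed
qed

section \<open>Adjoints of inclusions of full subcategories\<close>

lemma adjointE:
  assumes "adjoint C D F G"
  obtains \<phi> where "is_functor C D F" "is_functor D C G"
    "\<And>X Y. X \<in> Obj C \<Longrightarrow> Y \<in> Obj D \<Longrightarrow>
      bij_betw (\<phi> X Y) (Hom D (on_obj F X) Y) (Hom C X (on_obj G Y))"
    "\<And>X X' Y a f. X \<in> Obj C \<Longrightarrow> X' \<in> Obj C \<Longrightarrow> Y \<in> Obj D \<Longrightarrow> a \<in> Hom C X' X \<Longrightarrow>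
      f \<in> Hom D (on_obj F X) Y \<Longrightarrow> \<phi> X' Y (f \<cdot>\<^bsub>D\<^esub> on_arr F a) = \<phi> X Y f \<cdot>\<^bsub>C\<^esub> a"
    "\<And>X Y Y' b f. X \<in> Obj C \<Longrightarrow> Y \<in> Obj D \<Longrightarrow> Y' \<in> Obj D \<Longrightarrow> b \<in> Hom D Y Y' \<Longrightarrow>
      f \<in> Hom D (on_obj F X) Y \<Longrightarrow> \<phi> X Y' (b \<cdot>\<^bsub>D\<^esub> f) = on_arr G b \<cdot>\<^bsub>C\<^esub> \<phi> X Y f"
  using assms unfolding adjoint_def
proof (elim conjE exE, goal_cases)
  case (1 \<phi>)
  show ?case by (rule 1(1)[OF 1(2,3) 1(4)[rule_format] 1(5)[rule_format] 1(6)[rule_format]])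
qed

text \<open>The counits of the right adjoint are the coreflections; conversely the unique lifting along
  chosen coreflections makes them functorial.  The subcategory \<open>C\<close> is described by its properties
  since the statement is also applied to the opposite of a full subcategory of \<open>T\<close>, which as a
  record differs from a full subcategory of the opposite of \<open>T\<close>.\<close>

lemma has_right_adjoint_inclusion_iff:
  assumes "category D" and "category C" and S: "Obj C = S" "S \<subseteq> Obj D"
    and HomC: "\<And>X Y. X \<in> S \<Longrightarrow> Y \<in> S \<Longrightarrow> Hom C X Y = Hom D X Y"
    and CompC: "\<And>f g. g \<cdot>\<^bsub>C\<^esub> f = g \<cdot>\<^bsub>D\<^esub> f" and IdC: "\<And>X. Ident C X = Ident D X"
  shows "has_right_adjoint C D inclusion \<longleftrightarrow> (\<forall>t \<in> Obj D. \<exists>A c. coreflection D S A t c)"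
proof
  interpret D: category D by fact
  interpret C: category C by fact
  assume "has_right_adjoint C D inclusion"
  then obtain G where adj: "adjoint C D inclusion G" by (auto simp: has_right_adjoint_def)
  obtain \<phi> where "is_functor D C G"
    and bij: "\<And>X Y. X \<in> S \<Longrightarrow> Y \<in> Obj D \<Longrightarrow> bij_betw (\<phi> X Y) (Hom D X Y) (Hom C X (on_obj G Y))"
    and nat: "\<And>X X' Y a f. X \<in> S \<Longrightarrow> X' \<in> S \<Longrightarrow> Y \<in> Obj D \<Longrightarrow> a \<in> Hom C X' X \<Longrightarrow>
      f \<in> Hom D X Y \<Longrightarrow> \<phi> X' Y (f \<cdot>\<^bsub>D\<^esub> a) = \<phi> X Y f \<cdot>\<^bsub>D\<^esub> a"
    by (rule adjointE[OF adj]) (auto simp: inclusion_def S CompC)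
  then have GO: "\<And>t. t \<in> Obj D \<Longrightarrow> on_obj G t \<in> S" by (simp add: is_functor_def S)
  show "\<forall>t \<in> Obj D. \<exists>A c. coreflection D S A t c"
  proof
    fix t assume t: "t \<in> Obj D"
    let ?A = "on_obj G t"
    have A: "?A \<in> S" by (rule GO[OF t])
    have "Ident D ?A \<in> Hom C ?A ?A" using D.Ident_Hom[of ?A] HomC[OF A A] A S(2) by auto
    then have "Ident D ?A \<in> \<phi> ?A t ` Hom D ?A t" using bij[OF A t] by (simp add: bij_betw_def)
    then obtain c where c: "c \<in> Hom D ?A t" "\<phi> ?A t c = Ident D ?A" by auto
    have \<phi>c: "\<phi> s t (c \<cdot>\<^bsub>D\<^esub> k) = k" if s: "s \<in> S" and k: "k \<in> Hom D s ?A" for s k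
    proof -
      have "k \<in> Hom C s ?A" using k HomC[OF s A] by simp
      from nat[OF A s t this c(1)] show ?thesis using c(2) D.Comp_Ident_left[OF k] by simp
    qed
    have "coreflection D S ?A t c"
      unfolding coreflection_def covers_def
    proof (intro conjI ballI impI)
      fix s f assume s: "s \<in> S" and f: "f \<in> Hom D s t"
      have k: "\<phi> s t f \<in> Hom D s ?A"
        using bij_betwE[OF bij[OF s t], rule_format, OF f] HomC[OF s A] by simp
      have "c \<cdot>\<^bsub>D\<^esub> \<phi> s t f = f"
        by (rule inj_onD[OF bij_betw_imp_inj_on[OF bij[OF s t]] \<phi>c[OF s k] D.Comp_Hom[OF k c(1)] f])
      then show "\<exists>l \<in> Hom D s ?A. c \<cdot>\<^bsub>D\<^esub> l = f" using k by blast
    next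
      fix s k l assume s: "s \<in> S" and k: "k \<in> Hom D s ?A" and l: "l \<in> Hom D s ?A"
        and eq: "c \<cdot>\<^bsub>D\<^esub> k = c \<cdot>\<^bsub>D\<^esub> l"
      have "k = \<phi> s t (c \<cdot>\<^bsub>D\<^esub> k)" by (rule \<phi>c[OF s k, symmetric])
      also have "\<dots> = l" unfolding eq by (rule \<phi>c[OF s l])
      finally show "k = l" .
    qed (rule A, rule c(1))
    then show "\<exists>A c. coreflection D S A t c" by blast
  qed
next
  interpret D: category D by fact
  interpret C: category C by fact
  assume "\<forall>t \<in> Obj D. \<exists>A c. coreflection D S A t c"
  then obtain A c where cor: "\<And>t. t \<in> Obj D \<Longrightarrow> coreflection D S (A t) t (c t)" by metis
  have A: "A t \<in> S" "A t \<in> Obj D" and cov: "covers D S (A t) t (c t)" and cH: "c t \<in> Hom D (A t) t"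
    if "t \<in> Obj D" for t
    using cor[OF that] S by (auto simp: coreflection_def covers_def)
  define lift where "lift s t f = (THE k. k \<in> Hom D s (A t) \<and> c t \<cdot>\<^bsub>D\<^esub> k = f)" for s t f
  have lift_unique: "lift s t f = k"
    if "s \<in> S" "t \<in> Obj D" "k \<in> Hom D s (A t)" "c t \<cdot>\<^bsub>D\<^esub> k = f" for s t f k
    unfolding lift_def
  proof (rule the_equality)
    show "k \<in> Hom D s (A t) \<and> c t \<cdot>\<^bsub>D\<^esub> k = f" using that by simp
    fix k' assume "k' \<in> Hom D s (A t) \<and> c t \<cdot>\<^bsub>D\<^esub> k' = f"
    then show "k' = k" using coreflection_cancel[OF cor[OF that(2)] that(1) _ that(3)] that(4) by simp
  qed
  have lift: "lift s t f \<in> Hom D s (A t)" "c t \<cdot>\<^bsub>D\<^esub> lift s t f = f"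
    if s: "s \<in> S" and t: "t \<in> Obj D" and f: "f \<in> Hom D s t" for s t f
  proof -
    obtain k where k: "k \<in> Hom D s (A t)" "c t \<cdot>\<^bsub>D\<^esub> k = f" by (rule coversE[OF cov[OF t] s f])
    then show "lift s t f \<in> Hom D s (A t)" "c t \<cdot>\<^bsub>D\<^esub> lift s t f = f"
      using lift_unique[OF s t k] by simp_all
  qed
  define G :: "('a, 'b, 'a, 'b) fctr"
    where "G = \<lparr>on_obj = A, on_arr = (\<lambda>b. lift (A (Dom D b)) (Cod D b) (b \<cdot>\<^bsub>D\<^esub> c (Dom D b)))\<rparr>"
  have GA: "on_obj G t = A t" for t by (simp add: G_def)
  have Garr: "on_arr G b = lift (A X) Y (b \<cdot>\<^bsub>D\<^esub> c X)" if "b \<in> Hom D X Y" for b X Y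
    using that by (auto simp: G_def Hom_def)
  have GH: "on_arr G b \<in> Hom D (A X) (A Y)" "c Y \<cdot>\<^bsub>D\<^esub> on_arr G b = b \<cdot>\<^bsub>D\<^esub> c X"
    if X: "X \<in> Obj D" and Y: "Y \<in> Obj D" and b: "b \<in> Hom D X Y" for b X Y
    using lift[OF A(1)[OF X] Y D.Comp_Hom[OF cH[OF X] b]] Garr[OF b] by simp_all
  have Gfun: "is_functor D C G"
    unfolding is_functor_def GA CompC IdC S
  proof (intro conjI ballI)
    fix X assume X: "X \<in> Obj D"
    show "A X \<in> S" by (rule A(1)[OF X])
    show "on_arr G (Ident D X) = Ident D (A X)"
      unfolding Garr[OF D.Ident_Hom[OF X]]
      by (rule lift_unique[OF A(1)[OF X] X D.Ident_Hom[OF A(2)[OF X]]])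
        (simp add: D.Comp_Ident_left[OF cH[OF X]] D.Comp_Ident_right[OF cH[OF X]])
  next
    fix X Y f assume "X \<in> Obj D" "Y \<in> Obj D" "f \<in> Hom D X Y"
    then show "on_arr G f \<in> Hom C (A X) (A Y)" using GH(1) HomC A(1) by simp
  next
    fix X Y Z f g assume X: "X \<in> Obj D" and Y: "Y \<in> Obj D" and Z: "Z \<in> Obj D"
      and f: "f \<in> Hom D X Y" and g: "g \<in> Hom D Y Z"
    note Gf = GH[OF X Y f] and Gg = GH[OF Y Z g]
    have "c Z \<cdot>\<^bsub>D\<^esub> (on_arr G g \<cdot>\<^bsub>D\<^esub> on_arr G f) = (g \<cdot>\<^bsub>D\<^esub> f) \<cdot>\<^bsub>D\<^esub> c X"
      using D.Comp_assoc[OF Gf(1) Gg(1) cH[OF Z]] D.Comp_assoc[OF Gf(1) cH[OF Y] g]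
        D.Comp_assoc[OF cH[OF X] f g] Gf(2) Gg(2) by simp
    then show "on_arr G (g \<cdot>\<^bsub>D\<^esub> f) = on_arr G g \<cdot>\<^bsub>D\<^esub> on_arr G f"
      unfolding Garr[OF D.Comp_Hom[OF f g]]
      by (rule lift_unique[OF A(1)[OF X] Z D.Comp_Hom[OF Gf(1) Gg(1)]])
  qed
  have Ifun: "is_functor C D inclusion"
    unfolding is_functor_def inclusion_def using S HomC CompC IdC by auto
  have "adjoint C D inclusion G"
    unfolding adjoint_def
  proof (intro conjI exI[of _ lift] ballI Ifun Gfun, unfold S GA CompC)
    fix X Y assume X: "X \<in> S" and Y: "Y \<in> Obj D"
    note HC = HomC[OF X A(1)[OF Y]]
    show "bij_betw (lift X Y) (Hom D (on_obj inclusion X) Y) (Hom C X (A Y))"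
    proof (rule bij_betwI[where g = "\<lambda>k. c Y \<cdot>\<^bsub>D\<^esub> k"])
      show "lift X Y \<in> Hom D (on_obj inclusion X) Y \<rightarrow> Hom C X (A Y)"
        using lift(1)[OF X Y] by (auto simp: HC inclusion_def)
      show "(\<lambda>k. c Y \<cdot>\<^bsub>D\<^esub> k) \<in> Hom C X (A Y) \<rightarrow> Hom D (on_obj inclusion X) Y"
        using D.Comp_Hom[OF _ cH[OF Y]] by (auto simp: HC inclusion_def)
      show "\<And>f. f \<in> Hom D (on_obj inclusion X) Y \<Longrightarrow> c Y \<cdot>\<^bsub>D\<^esub> lift X Y f = f"
        using lift(2)[OF X Y] by (simp add: inclusion_def)
      show "\<And>k. k \<in> Hom C X (A Y) \<Longrightarrow> lift X Y (c Y \<cdot>\<^bsub>D\<^esub> k) = k"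
        using lift_unique[OF X Y] by (simp add: HC)
    qed
  next
    fix X X' Y a f assume X: "X \<in> S" and X': "X' \<in> S" and Y: "Y \<in> Obj D"
      and "a \<in> Hom C X' X" and "f \<in> Hom D (on_obj inclusion X) Y"
    then have a: "a \<in> Hom D X' X" and f: "f \<in> Hom D X Y"
      using HomC[OF X' X] by (simp_all add: inclusion_def)
    note l = lift[OF X Y f]
    have "lift X' Y (f \<cdot>\<^bsub>D\<^esub> a) = lift X Y f \<cdot>\<^bsub>D\<^esub> a"
      by (rule lift_unique[OF X' Y D.Comp_Hom[OF a l(1)]])
        (simp add: D.Comp_assoc[OF a l(1) cH[OF Y]] l(2))
    then show "lift X' Y (f \<cdot>\<^bsub>D\<^esub> on_arr inclusion a) = lift X Y f \<cdot>\<^bsub>D\<^esub> a"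
      by (simp add: inclusion_def)
  next
    fix X Y Y' b f assume X: "X \<in> S" and Y: "Y \<in> Obj D" and Y': "Y' \<in> Obj D"
      and b: "b \<in> Hom D Y Y'" and "f \<in> Hom D (on_obj inclusion X) Y"
    then have f: "f \<in> Hom D X Y" by (simp add: inclusion_def)
    note l = lift[OF X Y f] and Gb = GH[OF Y Y' b]
    show "lift X Y' (b \<cdot>\<^bsub>D\<^esub> f) = on_arr G b \<cdot>\<^bsub>D\<^esub> lift X Y f"
      by (rule lift_unique[OF X Y' D.Comp_Hom[OF l(1) Gb(1)]])
        (simp add: D.Comp_assoc[OF l(1) Gb(1) cH[OF Y']] Gb(2) l(2)
          flip: D.Comp_assoc[OF l(1) cH[OF Y] b])
  qed
  then show "has_right_adjoint C D inclusion" unfolding has_right_adjoint_def by blast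
qed

lemma opposite_opposite [simp]: "opposite (opposite C) = C"
  by (simp add: opposite_def)

lemma is_functor_opposite: "is_functor C D F \<Longrightarrow> is_functor (opposite C) (opposite D) F"
  unfolding is_functor_def by simp

text \<open>The new natural bijections are the inverses of the given ones.\<close>

lemma adjoint_opposite:
  assumes "category C" "category D" and adj: "adjoint C D F G"
  shows "adjoint (opposite D) (opposite C) G F"
proof (rule adjointE[OF adj])
  interpret C: category C by fact
  interpret D: category D by fact
  fix \<phi> assume F: "is_functor C D F" and G: "is_functor D C G"
    and bij: "\<And>X Y. X \<in> Obj C \<Longrightarrow> Y \<in> Obj D \<Longrightarrow>
      bij_betw (\<phi> X Y) (Hom D (on_obj F X) Y) (Hom C X (on_obj G Y))"
    and nat1: "\<And>X X' Y a f. X \<in> Obj C \<Longrightarrow> X' \<in> Obj C \<Longrightarrow> Y \<in> Obj D \<Longrightarrow> a \<in> Hom C X' X \<Longrightarrow>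
      f \<in> Hom D (on_obj F X) Y \<Longrightarrow> \<phi> X' Y (f \<cdot>\<^bsub>D\<^esub> on_arr F a) = \<phi> X Y f \<cdot>\<^bsub>C\<^esub> a"
    and nat2: "\<And>X Y Y' b f. X \<in> Obj C \<Longrightarrow> Y \<in> Obj D \<Longrightarrow> Y' \<in> Obj D \<Longrightarrow> b \<in> Hom D Y Y' \<Longrightarrow>
      f \<in> Hom D (on_obj F X) Y \<Longrightarrow> \<phi> X Y' (b \<cdot>\<^bsub>D\<^esub> f) = on_arr G b \<cdot>\<^bsub>C\<^esub> \<phi> X Y f"
  have FH: "on_arr F a \<in> Hom D (on_obj F X) (on_obj F Y)"
    if "X \<in> Obj C" "Y \<in> Obj C" "a \<in> Hom C X Y" for X Y a
    using F that unfolding is_functor_def by simp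
  define \<psi> where "\<psi> Y X = inv_into (Hom D (on_obj F X) Y) (\<phi> X Y)" for Y X
  have \<psi>: "bij_betw (\<psi> Y X) (Hom C X (on_obj G Y)) (Hom D (on_obj F X) Y)"
    if "X \<in> Obj C" "Y \<in> Obj D" for X Y
    unfolding \<psi>_def by (rule bij_betw_inv_into[OF bij[OF that]])
  have \<psi>H: "\<psi> Y X k \<in> Hom D (on_obj F X) Y" and \<phi>\<psi>: "\<phi> X Y (\<psi> Y X k) = k"
    if "X \<in> Obj C" "Y \<in> Obj D" "k \<in> Hom C X (on_obj G Y)" for X Y k
    using bij_betwE[OF \<psi>[OF that(1,2)]] bij_betw_inv_into_right[OF bij[OF that(1,2)]] that(3)
    by (simp_all add: \<psi>_def)
  have \<psi>_eq: "\<psi> Y X k = f"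
    if "X \<in> Obj C" "Y \<in> Obj D" "f \<in> Hom D (on_obj F X) Y" "\<phi> X Y f = k" for X Y f k
    using bij_betw_inv_into_left[OF bij[OF that(1,2)] that(3)] that(4) by (simp add: \<psi>_def)
  show ?thesis
    unfolding adjoint_def
  proof (intro conjI exI[of _ \<psi>] ballI is_functor_opposite F G, unfold opposite_simps)
    show "bij_betw (\<psi> Y X) (Hom C X (on_obj G Y)) (Hom D (on_obj F X) Y)"
      if "Y \<in> Obj D" "X \<in> Obj C" for X Y by (rule \<psi>[OF that(2,1)])
  next
    fix Y Y' X a k assume Y: "Y \<in> Obj D" and Y': "Y' \<in> Obj D" and X: "X \<in> Obj C"
      and a: "a \<in> Hom D Y Y'" and k: "k \<in> Hom C X (on_obj G Y)"
    show "\<psi> Y' X (on_arr G a \<cdot>\<^bsub>C\<^esub> k) = a \<cdot>\<^bsub>D\<^esub> \<psi> Y X k"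
      by (rule \<psi>_eq[OF X Y' D.Comp_Hom[OF \<psi>H[OF X Y k] a]])
        (simp add: nat2[OF X Y Y' a \<psi>H[OF X Y k]] \<phi>\<psi>[OF X Y k])
  next
    fix Y X X' b k assume Y: "Y \<in> Obj D" and X: "X \<in> Obj C" and X': "X' \<in> Obj C"
      and b: "b \<in> Hom C X' X" and k: "k \<in> Hom C X (on_obj G Y)"
    show "\<psi> Y X' (k \<cdot>\<^bsub>C\<^esub> b) = \<psi> Y X k \<cdot>\<^bsub>D\<^esub> on_arr F b"
      by (rule \<psi>_eq[OF X' Y D.Comp_Hom[OF FH[OF X' X b] \<psi>H[OF X Y k]]])
        (simp add: nat1[OF X X' Y b \<psi>H[OF X Y k]] \<phi>\<psi>[OF X Y k])
  qed
qed

lemma has_left_adjoint_iff_opposite: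
  assumes "linear_category R C" "linear_category R D"
  shows "has_left_adjoint C D F \<longleftrightarrow> has_right_adjoint (opposite C) (opposite D) F"
proof -
  have c: "category C" "category D" "category (opposite C)" "category (opposite D)"
    using assms linear_category.linear_category_opposite[OF assms(1)]
      linear_category.linear_category_opposite[OF assms(2)] by (auto simp: linear_category_def)
  show ?thesis
    unfolding has_left_adjoint_def has_right_adjoint_def
    using adjoint_opposite[OF c(2,1)] adjoint_opposite[OF c(3,4)] by (metis opposite_opposite)
qed

section \<open>Powers of the suspension\<close>

context linear_triangulated_category
begin

lemma susp_inv_into:
  assumes "X \<in> Obj T"
  shows "inv_into (Obj T) (susp_obj T) X \<in> Obj T" "susp_obj T (inv_into (Obj T) (susp_obj T) X) = X"
proof -
  have "X \<in> susp_obj T ` Obj T" using Susp_bij_Obj assms by (simp add: bij_betw_def)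
  then show "inv_into (Obj T) (susp_obj T) X \<in> Obj T"
    "susp_obj T (inv_into (Obj T) (susp_obj T) X) = X"
    by (rule inv_into_into, intro f_inv_into_f)
qed

lemma susp_pow_0 [simp]: "susp_pow T 0 X = X"
  by (simp add: susp_pow_def)

lemma susp_pow_Obj:
  assumes "X \<in> Obj T"
  shows "susp_pow T k X \<in> Obj T"
proof -
  have "(susp_obj T ^^ n) X \<in> Obj T" for n by (induction n) (simp_all add: assms susp_Obj)
  moreover have "(inv_into (Obj T) (susp_obj T) ^^ n) X \<in> Obj T" for n
    by (induction n) (simp_all add: assms susp_inv_into)
  ultimately show ?thesis by (simp add: susp_pow_def)
qed

lemma susp_pow_add_1:
  assumes X: "X \<in> Obj T"
  shows "susp_pow T (k + 1) X = susp_obj T (susp_pow T k X)"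
proof (cases "0 \<le> k")
  case True
  then have "nat (k + 1) = Suc (nat k)" by simp
  then show ?thesis using True by (simp add: susp_pow_def)
next
  case False
  define m where "m = nat (- (k + 1))"
  have m: "nat (- k) = Suc m" "- k = int (Suc m)" using False by (simp_all add: m_def)
  have "susp_pow T (k + 1) X = (inv_into (Obj T) (susp_obj T) ^^ m) X"
    using False by (cases "k = -1") (simp_all add: susp_pow_def m_def)
  moreover from this have "(inv_into (Obj T) (susp_obj T) ^^ m) X \<in> Obj T"
    using susp_pow_Obj[OF X, of "k + 1"] by simp
  moreover have "susp_pow T k X = inv_into (Obj T) (susp_obj T) ((inv_into (Obj T) (susp_obj T) ^^ m) X)"
    using False m by (simp add: susp_pow_def)
  ultimately show ?thesis using susp_inv_into(2) by simp
qed

text \<open>The negative powers in the subcategory are built from an inverse of the suspension chosen on \<open>S\<close>,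
  but both sides satisfy \<open>\<Sigma>\<^sup>k\<^sup>+\<^sup>1 = \<Sigma> \<Sigma>\<^sup>k\<close> and the suspension is injective.\<close>

lemma susp_pow_full_sub:
  assumes S: "triangulated_subcategory T S" and X: "X \<in> S"
  shows "susp_pow (full_sub T S) k X = susp_pow T k X" "susp_pow T k X \<in> S"
proof -
  interpret F: linear_triangulated_category R "full_sub T S"
    by (rule full_sub_linear_triangulated[OF linear_triangulated_category_axioms S])
  note SD = triangulated_subcategoryD[OF S]
  have "susp_pow (full_sub T S) k X = susp_pow T k X \<and> susp_pow T k X \<in> S"
  proof (induction k rule: int_induct[of _ 0])
    case base then show ?case using X by simp
  next
    case (step1 k)
    then show ?case using susp_pow_add_1[of X k] F.susp_pow_add_1[of X k] X SD(4,5) by simp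
  next
    case (step2 k)
    let ?p = "susp_pow T (k - 1) X" and ?q = "susp_pow (full_sub T S) (k - 1) X"
    have "susp_obj T ?p = susp_pow T k X" "susp_obj T ?q = susp_pow (full_sub T S) k X"
      using susp_pow_add_1[of X "k - 1"] F.susp_pow_add_1[of X "k - 1"] X SD(4) by simp_all
    moreover have "?p \<in> Obj T" "?q \<in> S" using susp_pow_Obj F.susp_pow_Obj[of X] X SD(4) by simp_all
    ultimately show ?case using step2 susp_obj_inject[of ?p ?q] SD(4,6) by metis
  qed
  then show "susp_pow (full_sub T S) k X = susp_pow T k X" "susp_pow T k X \<in> S" by simp_all
qed

text \<open>Being a singleton expresses that a group of arrows is zero.  Unlike finite generation over \<open>R\<close>,
  this is preserved by the suspension, which is merely additive.\<close>

lemma Hom_trivial_susp_pow: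
  assumes "X \<in> Obj T" "Y \<in> Obj T"
  shows "(\<exists>f. Hom T (susp_pow T (a + n) X) (susp_pow T (b + n) Y) = {f}) \<longleftrightarrow>
    (\<exists>f. Hom T (susp_pow T a X) (susp_pow T b Y) = {f})"
proof -
  have step: "(\<exists>f. Hom T (susp_pow T (a + 1) X) (susp_pow T (b + 1) Y) = {f}) \<longleftrightarrow>
    (\<exists>f. Hom T (susp_pow T a X) (susp_pow T b Y) = {f})" for a b
    using bij_betw_same_card[OF susp_bij_Hom[OF susp_pow_Obj[OF assms(1)] susp_pow_Obj[OF assms(2)]], of a b]
      susp_pow_add_1[OF assms(1)] susp_pow_add_1[OF assms(2)] by (simp flip: card_1_singleton_iff)
  show ?thesis
  proof (induction n rule: int_induct[of _ 0])
    case (step1 n) then show ?case using step[of "a + n" "b + n"] by (simp add: add.assoc)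
  next
    case (step2 n) then show ?case using step[of "a + (n - 1)" "b + (n - 1)"] by simp
  qed simp
qed

end

text \<open>Stated for an abstract automorphism so that it applies to the suspension acting on a
  category and on its opposite.\<close>

lemma (in category) coreflection_automorphism:
  assumes bij: "\<And>X Y. X \<in> Obj C \<Longrightarrow> Y \<in> Obj C \<Longrightarrow> bij_betw \<sigma> (Hom C X Y) (Hom C (s X) (s Y))"
    and comp: "\<And>X Y Z f g. f \<in> Hom C X Y \<Longrightarrow> g \<in> Hom C Y Z \<Longrightarrow> \<sigma> (g \<cdot> f) = \<sigma> g \<cdot> \<sigma> f"
    and inj: "inj_on s (Obj C)" and S: "S \<subseteq> Obj C" "s ` S = S"
    and A: "A \<in> Obj C" and x: "x \<in> Obj C" and c: "c \<in> Hom C A x"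
  shows "coreflection C S (s A) (s x) (\<sigma> c) \<longleftrightarrow> coreflection C S A x c"
proof -
  have eq: "\<sigma> f = \<sigma> g \<longleftrightarrow> f = g" if "X \<in> Obj C" "Y \<in> Obj C" "f \<in> Hom C X Y" "g \<in> Hom C X Y" for X Y f g
    using inj_on_eq_iff[OF bij_betw_imp_inj_on[OF bij[OF that(1,2)]] that(3,4)] .
  have img: "Hom C (s X) (s Y) = \<sigma> ` Hom C X Y" if "X \<in> Obj C" "Y \<in> Obj C" for X Y
    using bij[OF that] by (simp add: bij_betw_def)
  have SA: "s A \<in> S \<longleftrightarrow> A \<in> S"
    using inj_on_image_mem_iff[OF inj A S(1)] S(2) by simp
  have ball: "(\<forall>p \<in> S. Q p) \<longleftrightarrow> (\<forall>p \<in> S. Q (s p))" for Q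
    by (subst S(2)[symmetric]) simp
  have SO: "p \<in> Obj C" if "p \<in> S" for p using that S by blast
  have \<sigma>c: "\<sigma> c \<in> Hom C (s A) (s x)" using img[OF A x] c by blast
  have "covers C S (s A) (s x) (\<sigma> c) \<longleftrightarrow>
      (\<forall>p \<in> S. \<forall>f \<in> Hom C (s p) (s x). \<exists>l \<in> Hom C (s p) (s A). \<sigma> c \<cdot> l = f)"
    using ball[of "\<lambda>p. \<forall>f \<in> Hom C p (s x). \<exists>l \<in> Hom C p (s A). \<sigma> c \<cdot> l = f"] \<sigma>c
    by (simp add: covers_def)
  also have "\<dots> \<longleftrightarrow> (\<forall>p \<in> S. \<forall>f \<in> Hom C p x. \<exists>l \<in> Hom C p A. c \<cdot> l = f)"
  proof (rule ball_cong[OF refl])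
    fix p assume "p \<in> S"
    note p = SO[OF this]
    have "\<sigma> c \<cdot> \<sigma> l = \<sigma> f \<longleftrightarrow> c \<cdot> l = f" if "l \<in> Hom C p A" "f \<in> Hom C p x" for l f
      using comp[OF that(1) c] eq[OF p x Comp_Hom[OF that(1) c] that(2)] by simp
    then show "(\<forall>f \<in> Hom C (s p) (s x). \<exists>l \<in> Hom C (s p) (s A). \<sigma> c \<cdot> l = f) \<longleftrightarrow>
        (\<forall>f \<in> Hom C p x. \<exists>l \<in> Hom C p A. c \<cdot> l = f)"
      by (simp add: img[OF p x] img[OF p A])
  qed
  also have "\<dots> \<longleftrightarrow> covers C S A x c" using c by (simp add: covers_def)
  finally have 1: "covers C S (s A) (s x) (\<sigma> c) \<longleftrightarrow> covers C S A x c" .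
  have "(\<forall>p \<in> S. \<forall>k \<in> Hom C p (s A). \<forall>l \<in> Hom C p (s A). \<sigma> c \<cdot> k = \<sigma> c \<cdot> l \<longrightarrow> k = l) \<longleftrightarrow>
      (\<forall>p \<in> S. \<forall>k \<in> Hom C (s p) (s A). \<forall>l \<in> Hom C (s p) (s A). \<sigma> c \<cdot> k = \<sigma> c \<cdot> l \<longrightarrow> k = l)"
    by (rule ball)
  also have "\<dots> \<longleftrightarrow>
      (\<forall>p \<in> S. \<forall>k \<in> Hom C p A. \<forall>l \<in> Hom C p A. c \<cdot> k = c \<cdot> l \<longrightarrow> k = l)"
  proof (rule ball_cong[OF refl])
    fix p assume "p \<in> S"
    note p = SO[OF this]
    have "\<sigma> c \<cdot> \<sigma> k = \<sigma> c \<cdot> \<sigma> l \<longleftrightarrow> c \<cdot> k = c \<cdot> l" "\<sigma> k = \<sigma> l \<longleftrightarrow> k = l"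
      if "k \<in> Hom C p A" "l \<in> Hom C p A" for k l
      using comp[OF that(1) c] comp[OF that(2) c] eq[OF p A that]
        eq[OF p x Comp_Hom[OF that(1) c] Comp_Hom[OF that(2) c]] by simp_all
    then show "(\<forall>k \<in> Hom C (s p) (s A). \<forall>l \<in> Hom C (s p) (s A). \<sigma> c \<cdot> k = \<sigma> c \<cdot> l \<longrightarrow> k = l) \<longleftrightarrow>
        (\<forall>k \<in> Hom C p A. \<forall>l \<in> Hom C p A. c \<cdot> k = c \<cdot> l \<longrightarrow> k = l)"
      by (simp add: img[OF p A])
  qed
  finally show ?thesis unfolding coreflection_def using 1 SA by simp
qed

section \<open>Finitely generated direct sums\<close>

text \<open>Repetitions in a finite generating family are merged by adding their coefficients.\<close>

lemma (in module) linear_combination_image: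
  assumes "finite I" "g \<in> I \<rightarrow> carrier M" "c \<in> I \<rightarrow> carrier R"
  shows "\<exists>c'. c' \<in> g ` I \<rightarrow> carrier R \<and>
    (\<Oplus>\<^bsub>M\<^esub>i\<in>I. c i \<odot>\<^bsub>M\<^esub> g i) = (\<Oplus>\<^bsub>M\<^esub>x\<in>g ` I. c' x \<odot>\<^bsub>M\<^esub> x)"
  using assms
proof (induction I)
  case empty then show ?case by simp
next
  case (insert j I)
  then obtain c' where c': "c' \<in> g ` I \<rightarrow> carrier R"
    and eq: "(\<Oplus>\<^bsub>M\<^esub>i\<in>I. c i \<odot>\<^bsub>M\<^esub> g i) = (\<Oplus>\<^bsub>M\<^esub>x\<in>g ` I. c' x \<odot>\<^bsub>M\<^esub> x)" by auto
  have gj: "g j \<in> carrier M" and cj: "c j \<in> carrier R" using insert.prems by auto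
  have gI: "g ` I \<subseteq> carrier M" using insert.prems by auto
  define r where "r = (if g j \<in> g ` I then c' (g j) else \<zero>)"
  define J where "J = g ` I - {g j}"
  have r: "r \<in> carrier R" using c' by (auto simp: r_def)
  have J: "finite J" "g j \<notin> J" "J \<subseteq> carrier M" "c' \<in> J \<rightarrow> carrier R"
    using insert.hyps gI c' by (auto simp: J_def)
  have smult_J: "(\<lambda>x. c' x \<odot>\<^bsub>M\<^esub> x) \<in> J \<rightarrow> carrier M"
    using J(3,4) by (auto intro!: smult_closed)
  let ?rest = "\<Oplus>\<^bsub>M\<^esub>x\<in>J. c' x \<odot>\<^bsub>M\<^esub> x"
  have rest: "?rest \<in> carrier M" by (rule M.finsum_closed[OF smult_J])
  have split: "(\<Oplus>\<^bsub>M\<^esub>x\<in>g ` I. c' x \<odot>\<^bsub>M\<^esub> x) = r \<odot>\<^bsub>M\<^esub> g j \<oplus>\<^bsub>M\<^esub> ?rest"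
  proof (cases "g j \<in> g ` I")
    case True
    then have "g ` I = insert (g j) J" by (auto simp: J_def)
    moreover have "c' (g j) \<in> carrier R" using c' True by auto
    ultimately show ?thesis
      using M.finsum_insert[OF J(1,2) smult_J] gj True by (simp add: r_def)
  next
    case False
    then have "g ` I = J" by (auto simp: J_def)
    then show ?thesis using False rest gj by (simp add: r_def)
  qed
  define c'' where "c'' = c'(g j := c j \<oplus> r)"
  have c'': "c'' \<in> insert (g j) J \<rightarrow> carrier R" using J cj r by (auto simp: c''_def)
  have ins: "g ` insert j I = insert (g j) J" by (auto simp: J_def)
  have "(\<Oplus>\<^bsub>M\<^esub>i\<in>insert j I. c i \<odot>\<^bsub>M\<^esub> g i) = c j \<odot>\<^bsub>M\<^esub> g j \<oplus>\<^bsub>M\<^esub> (\<Oplus>\<^bsub>M\<^esub>i\<in>I. c i \<odot>\<^bsub>M\<^esub> g i)"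
    using insert.hyps insert.prems by (intro M.finsum_insert) auto
  also have "\<dots> = (c j \<odot>\<^bsub>M\<^esub> g j \<oplus>\<^bsub>M\<^esub> r \<odot>\<^bsub>M\<^esub> g j) \<oplus>\<^bsub>M\<^esub> ?rest"
    using eq split cj r gj rest by (simp add: M.a_assoc)
  also have "\<dots> = (c j \<oplus> r) \<odot>\<^bsub>M\<^esub> g j \<oplus>\<^bsub>M\<^esub> ?rest" using cj r gj by (simp add: smult_l_distr)
  also have "?rest = (\<Oplus>\<^bsub>M\<^esub>x\<in>J. c'' x \<odot>\<^bsub>M\<^esub> x)"
    using J(2) smult_J by (intro M.finsum_cong') (auto simp: c''_def Pi_def)
  also have "(c j \<oplus> r) \<odot>\<^bsub>M\<^esub> g j \<oplus>\<^bsub>M\<^esub> \<dots> = (\<Oplus>\<^bsub>M\<^esub>x\<in>insert (g j) J. c'' x \<odot>\<^bsub>M\<^esub> x)"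
  proof -
    have "(\<lambda>x. c'' x \<odot>\<^bsub>M\<^esub> x) \<in> J \<rightarrow> carrier M"
      using J(2) smult_J by (auto simp: c''_def Pi_def)
    moreover have "c'' (g j) = c j \<oplus> r" by (simp add: c''_def)
    ultimately show ?thesis
      using M.finsum_insert[OF J(1,2), of "\<lambda>x. c'' x \<odot>\<^bsub>M\<^esub> x"] cj r gj by simp
  qed
  finally show ?case using c'' ins by auto
qed

lemma direct_sum_module_simps:
  "\<zero>\<^bsub>direct_sum_module M\<^esub> = (\<lambda>i. \<zero>\<^bsub>M i\<^esub>)"
  "x \<oplus>\<^bsub>direct_sum_module M\<^esub> y = (\<lambda>i. x i \<oplus>\<^bsub>M i\<^esub> y i)"
  "r \<odot>\<^bsub>direct_sum_module M\<^esub> x = (\<lambda>i. r \<odot>\<^bsub>M i\<^esub> x i)"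
  "x \<in> carrier (direct_sum_module M) \<longleftrightarrow>
    (\<forall>i. x i \<in> carrier (M i)) \<and> finite {i. x i \<noteq> \<zero>\<^bsub>M i\<^esub>}"
  by (simp_all add: direct_sum_module_def)

lemma abelian_monoid_direct_sum:
  assumes M: "\<And>i. abelian_monoid (M i)"
  shows "abelian_monoid (direct_sum_module M)"
proof (rule abelian_monoidI, goal_cases)
  case (1 x y)
  then have fin: "finite ({i. x i \<noteq> \<zero>\<^bsub>M i\<^esub>} \<union> {i. y i \<noteq> \<zero>\<^bsub>M i\<^esub>})"
    and xy: "\<And>i. x i \<in> carrier (M i)" "\<And>i. y i \<in> carrier (M i)"
    by (simp_all add: direct_sum_module_simps)
  have "{i. x i \<oplus>\<^bsub>M i\<^esub> y i \<noteq> \<zero>\<^bsub>M i\<^esub>} \<subseteq> {i. x i \<noteq> \<zero>\<^bsub>M i\<^esub>} \<union> {i. y i \<noteq> \<zero>\<^bsub>M i\<^esub>}"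
    using abelian_monoid.l_zero[OF M abelian_monoid.zero_closed[OF M]] by auto
  then show ?case
    using finite_subset[OF _ fin] abelian_monoid.a_closed[OF M xy] by (simp add: direct_sum_module_simps)
next
  case 2
  show ?case using abelian_monoid.zero_closed[OF M] by (simp add: direct_sum_module_simps)
next
  case (3 x y z)
  then show ?case using abelian_monoid.a_assoc[OF M] by (simp add: direct_sum_module_simps)
next
  case (4 x)
  then show ?case using abelian_monoid.l_zero[OF M] by (simp add: direct_sum_module_simps)
next
  case (5 x y)
  then show ?case using abelian_monoid.a_comm[OF M] by (simp add: direct_sum_module_simps)
qed

lemma finsum_direct_sum:
  assumes M: "\<And>i. abelian_monoid (M i)" and "finite A" "f \<in> A \<rightarrow> carrier (direct_sum_module M)"
  shows "(\<Oplus>\<^bsub>direct_sum_module M\<^esub>a\<in>A. f a) i = (\<Oplus>\<^bsub>M i\<^esub>a\<in>A. f a i)"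
proof -
  interpret D: abelian_monoid "direct_sum_module M" by (rule abelian_monoid_direct_sum[OF M])
  interpret N: abelian_monoid "M i" by (rule M)
  show ?thesis
    using assms(2,3)
  proof (induction A)
    case empty then show ?case by (simp add: direct_sum_module_simps)
  next
    case (insert a A)
    then have "f \<in> A \<rightarrow> carrier (direct_sum_module M)" "f a \<in> carrier (direct_sum_module M)"
      "(\<lambda>a. f a i) \<in> A \<rightarrow> carrier (M i)" "f a i \<in> carrier (M i)"
      by (auto simp: direct_sum_module_simps(4) Pi_def)
    then show ?case using insert by (simp add: direct_sum_module_simps(2))
  qed
qed

text \<open>The coordinates of a generating family generate each summand, and outside the finitely many
  indices that occur in the supports of the generators all coordinates vanish.\<close>

lemma finitely_generated_direct_sum:
  assumes M: "\<And>i. module R (M i)" and fg: "finitely_generated_module R (direct_sum_module M)"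
  shows "finitely_generated_module R (M i)" "finite {i. carrier (M i) \<noteq> {\<zero>\<^bsub>M i\<^esub>}}"
proof -
  have N: "abelian_monoid (M i)" for i using M by (simp add: module_def abelian_group_def)
  obtain A where A: "finite A" "A \<subseteq> carrier (direct_sum_module M)"
    and gen: "\<And>x. x \<in> carrier (direct_sum_module M) \<Longrightarrow> \<exists>c. c \<in> A \<rightarrow> carrier R \<and>
      x = (\<Oplus>\<^bsub>direct_sum_module M\<^esub>a\<in>A. c a \<odot>\<^bsub>direct_sum_module M\<^esub> a)"
    using fg unfolding finitely_generated_module_def by blast
  have Ai: "a i \<in> carrier (M i)" if "a \<in> A" for a i
    using A that by (auto simp: direct_sum_module_simps(4))
  have comp: "\<exists>c. c \<in> A \<rightarrow> carrier R \<and> y = (\<Oplus>\<^bsub>M i\<^esub>a\<in>A. c a \<odot>\<^bsub>M i\<^esub> a i)"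
    if y: "y \<in> carrier (M i)" for y i
  proof -
    define x where "x j = (if j = i then y else \<zero>\<^bsub>M j\<^esub>)" for j
    have "{j. x j \<noteq> \<zero>\<^bsub>M j\<^esub>} \<subseteq> {i}" by (auto simp: x_def)
    then have "x \<in> carrier (direct_sum_module M)"
      using y abelian_monoid.zero_closed[OF N] finite_subset[of _ "{i}"]
      by (auto simp: direct_sum_module_simps(4) x_def)
    then obtain c where c: "c \<in> A \<rightarrow> carrier R"
      and x: "x = (\<Oplus>\<^bsub>direct_sum_module M\<^esub>a\<in>A. c a \<odot>\<^bsub>direct_sum_module M\<^esub> a)" using gen by blast
    have "(\<lambda>a. c a \<odot>\<^bsub>direct_sum_module M\<^esub> a) \<in> A \<rightarrow> carrier (direct_sum_module M)"
    proof
      fix a assume a: "a \<in> A"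
      then have ca: "c a \<in> carrier R" and aD: "a \<in> carrier (direct_sum_module M)" using c A by auto
      have "{i. c a \<odot>\<^bsub>M i\<^esub> a i \<noteq> \<zero>\<^bsub>M i\<^esub>} \<subseteq> {i. a i \<noteq> \<zero>\<^bsub>M i\<^esub>}"
        using module.smult_r_null[OF M ca] by auto
      then show "c a \<odot>\<^bsub>direct_sum_module M\<^esub> a \<in> carrier (direct_sum_module M)"
        using aD module.smult_closed[OF M ca] finite_subset by (auto simp: direct_sum_module_simps)
    qed
    note sum = finsum_direct_sum[where M = M, OF N A(1) this, of i]
    have "y = x i" by (simp add: x_def)
    also have "\<dots> = (\<Oplus>\<^bsub>M i\<^esub>a\<in>A. c a \<odot>\<^bsub>M i\<^esub> a i)"
      unfolding x sum by (simp add: direct_sum_module_simps)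
    finally show ?thesis using c by blast
  qed
  show "finitely_generated_module R (M i)"
    unfolding finitely_generated_module_def
  proof (intro exI[of _ "(\<lambda>a. a i) ` A"] conjI ballI)
    fix y assume "y \<in> carrier (M i)"
    then obtain c where c: "c \<in> A \<rightarrow> carrier R" "y = (\<Oplus>\<^bsub>M i\<^esub>a\<in>A. c a \<odot>\<^bsub>M i\<^esub> a i)"
      using comp by blast
    then show "\<exists>c. c \<in> (\<lambda>a. a i) ` A \<rightarrow> carrier R \<and>
        y = (\<Oplus>\<^bsub>M i\<^esub>a\<in>(\<lambda>a. a i) ` A. c a \<odot>\<^bsub>M i\<^esub> a)"
      using module.linear_combination_image[OF M A(1), of "\<lambda>a. a i" i c] Ai by auto
  qed (use A Ai in auto)
  have "finite (\<Union>a\<in>A. {i. a i \<noteq> \<zero>\<^bsub>M i\<^esub>})"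
    using A by (auto simp: direct_sum_module_simps(4))
  moreover have "{i. carrier (M i) \<noteq> {\<zero>\<^bsub>M i\<^esub>}} \<subseteq> (\<Union>a\<in>A. {i. a i \<noteq> \<zero>\<^bsub>M i\<^esub>})"
  proof (rule ccontr)
    assume "\<not> ?thesis"
    then obtain i where i: "carrier (M i) \<noteq> {\<zero>\<^bsub>M i\<^esub>}" "\<And>a. a \<in> A \<Longrightarrow> a i = \<zero>\<^bsub>M i\<^esub>" by auto
    interpret Mi: module R "M i" by (rule M)
    have "y = \<zero>\<^bsub>M i\<^esub>" if y: "y \<in> carrier (M i)" for y
    proof -
      obtain c where c: "c \<in> A \<rightarrow> carrier R" "y = (\<Oplus>\<^bsub>M i\<^esub>a\<in>A. c a \<odot>\<^bsub>M i\<^esub> a i)"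
        using comp[OF y] by blast
      have "(\<Oplus>\<^bsub>M i\<^esub>a\<in>A. c a \<odot>\<^bsub>M i\<^esub> a i) = (\<Oplus>\<^bsub>M i\<^esub>a\<in>A. \<zero>\<^bsub>M i\<^esub>)"
      proof (rule Mi.M.finsum_cong')
        fix a assume a: "a \<in> A"
        then have "c a \<in> carrier R" using c(1) by auto
        then show "c a \<odot>\<^bsub>M i\<^esub> a i = \<zero>\<^bsub>M i\<^esub>" using i(2)[OF a] by simp
      qed auto
      then show ?thesis using c(2) by simp
    qed
    then show False using i(1) Mi.M.zero_closed by blast
  qed
  ultimately show "finite {i. carrier (M i) \<noteq> {\<zero>\<^bsub>M i\<^esub>}}" by (rule rev_finite_subset)
qed

section \<open>Covers by sums of suspensions\<close>

text \<open>Only the finitely many \<open>k\<close> with \<open>Hom(X k, t)\<close> nonzero impose a condition; the zero arrow always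
  lifts.\<close>

lemma (in linear_category) cover_of_family:
  assumes X: "\<And>k. X k \<in> Obj C" and t: "t \<in> Obj C"
    and triv: "finite {k. \<nexists>f. Hom C (X k) t = {f}}"
    and fg: "\<And>k. finitely_generated_module R (hom_module C (X k) t)"
    and bip: "\<And>n A. (\<And>i. i < n \<Longrightarrow> A i \<in> range X) \<Longrightarrow>
      \<exists>Y \<in> S. \<exists>\<iota> \<pi>. biproduct C {..<n::nat} A Y \<iota> \<pi>"
  shows "\<exists>Y \<in> S. \<exists>a. covers C (range X) Y t a"
proof -
  let ?P = "X ` {k. \<nexists>f. Hom C (X k) t = {f}}"
  have fin: "finite ?P" and sub: "?P \<subseteq> Obj C" using triv X by auto
  have fgP: "finitely_generated_module R (hom_module C p t)" if "p \<in> ?P" for p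
    using that fg by auto
  have bipP: "\<exists>Y \<in> S. \<exists>\<iota> \<pi>. biproduct C {..<n::nat} A Y \<iota> \<pi>" if "\<And>i. i < n \<Longrightarrow> A i \<in> ?P" for n A
    by (rule bip) (use that in blast)
  obtain Y a where Y: "Y \<in> S" and a: "covers C ?P Y t a"
    using finitely_generated_cover[OF fin sub t fgP bipP] by blast
  note aH = covers_Hom[OF a]
  have YO: "Y \<in> Obj C" using Hom_Obj[OF aH] by simp
  have "covers C (range X) Y t a"
    unfolding covers_def
  proof (intro conjI ballI aH)
    fix p f assume "p \<in> range X" and f: "f \<in> Hom C p t"
    then obtain k where p: "p = X k" by blast
    show "\<exists>l \<in> Hom C p Y. a \<cdot>\<^bsub>C\<^esub> l = f"
    proof (cases "\<exists>f. Hom C (X k) t = {f}")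
      case True
      then have "f = Zero C p t" using f Zero_Hom[OF X[of k] t] unfolding p by auto
      then have "a \<cdot>\<^bsub>C\<^esub> Zero C p Y = f" using Comp_Zero_right[OF aH X[of k]] p by simp
      then show ?thesis using Zero_Hom[OF X[of k] YO] p by blast
    next
      case False
      then have "p \<in> ?P" using p by blast
      then show ?thesis using a f unfolding covers_def by blast
    qed
  qed
  then show ?thesis using Y by blast
qed

context linear_triangulated_category
begin

text \<open>Finite generation of \<open>Hom(\<Sigma>\<^sup>kX, Y)\<close> comes from properness for the pair \<open>\<Sigma>\<^sup>kX\<close>, \<open>Y\<close> and the
  summand of index \<open>0\<close>, not by shifting \<open>Hom(X, \<Sigma>\<^sup>-\<^sup>kY)\<close>, since \<open>\<Sigma>\<close> need not be \<open>R\<close>-linear on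
  arrows.  Vanishing can be shifted.\<close>

lemma proper_Hom:
  assumes "proper_over R T" and X: "X \<in> Obj T" and Y: "Y \<in> Obj T"
  shows "finitely_generated_module R (hom_module T X Y)"
    "finite {k. \<nexists>f. Hom T X (susp_pow T k Y) = {f}}"
    "finite {k. \<nexists>f. Hom T (susp_pow T k X) Y = {f}}"
proof -
  let ?M = "\<lambda>k. hom_module T X (susp_pow T k Y)"
  have M: "module R (?M k)" for k by (rule hom_module[OF X susp_pow_Obj[OF Y]])
  have fg: "finitely_generated_module R (direct_sum_module ?M)"
    using assms unfolding proper_over_def by blast
  show "finitely_generated_module R (hom_module T X Y)"
    using finitely_generated_direct_sum(1)[where M = ?M, OF M fg, of 0] by simp
  have "{k. \<nexists>f. Hom T X (susp_pow T k Y) = {f}} \<subseteq> {k. carrier (?M k) \<noteq> {\<zero>\<^bsub>?M k\<^esub>}}"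
    by (auto simp: hom_module_def)
  then show *: "finite {k. \<nexists>f. Hom T X (susp_pow T k Y) = {f}}"
    by (rule finite_subset[OF _ finitely_generated_direct_sum(2)[where M = ?M, OF M fg]])
  have "(\<exists>f. Hom T (susp_pow T k X) Y = {f}) \<longleftrightarrow> (\<exists>f. Hom T X (susp_pow T (- k) Y) = {f})" for k
    using Hom_trivial_susp_pow[OF X Y, of 0 k "- k"] by simp
  then have "{k. \<nexists>f. Hom T (susp_pow T k X) Y = {f}} =
      uminus -` {k. \<nexists>f. Hom T X (susp_pow T k Y) = {f}}" by auto
  then show "finite {k. \<nexists>f. Hom T (susp_pow T k X) Y = {f}}"
    using finite_vimageI[OF *, of uminus] by (simp add: inj_on_def)
qed

lemma coproduct_full_sub_biproduct:
  assumes S: "triangulated_subcategory T S" and I: "finite I"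
    and c: "is_coproduct (full_sub T S) I A Y \<iota>"
  shows "Y \<in> S" "\<exists>\<pi>. biproduct T I A Y \<iota> \<pi>"
proof -
  interpret F: linear_triangulated_category R "full_sub T S"
    by (rule full_sub_linear_triangulated[OF linear_triangulated_category_axioms S])
  show Y: "Y \<in> S" using c by (simp add: is_coproduct_def)
  obtain \<pi> where b: "biproduct (full_sub T S) I A Y \<iota> \<pi>" using F.coproduct_biproduct[OF I c] by blast
  have "arrow_sum (full_sub T S) Y Y f I = arrow_sum T Y Y f I" for f
    using Y by (simp add: arrow_sum_def hom_module_full_sub)
  then have "biproduct T I A Y \<iota> \<pi>"
    using b triangulated_subcategoryD(4)[OF S Y] unfolding biproduct_def
    by (auto dest: Hom_full_subD)
  then show "\<exists>\<pi>. biproduct T I A Y \<iota> \<pi>" by blast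
qed

lemma finite_biproducts_in_subcategory:
  assumes S: "triangulated_subcategory T S" and A: "\<And>i. i < n \<Longrightarrow> A i \<in> S"
  shows "\<exists>Y \<in> S. \<exists>\<iota> \<pi>. is_coproduct (full_sub T S) {..<n::nat} A Y \<iota> \<and> biproduct T {..<n} A Y \<iota> \<pi>"
proof -
  have "\<exists>Y \<iota>. is_coproduct (full_sub T S) {..<n} A Y \<iota>"
    by (rule triangulated_subcategoryD(3)[OF S, unfolded has_finite_coproducts_def, rule_format])
      (simp add: A)
  then obtain Y \<iota> where c: "is_coproduct (full_sub T S) {..<n} A Y \<iota>" by blast
  then show ?thesis using coproduct_full_sub_biproduct[OF S _ c] by auto
qed

lemma cover_by_suspensions:
  assumes S: "triangulated_subcategory T S" and pr: "proper_over R T" and G: "G \<in> S" and t: "t \<in> Obj T"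
  shows "\<exists>Y \<in> S. \<exists>a. covers T (range (\<lambda>k. susp_pow T k G)) Y t a"
    "\<exists>Y \<in> S. \<exists>a. covers (opposite T) (range (\<lambda>k. susp_pow T k G)) Y t a"
proof -
  interpret op: linear_category R "opposite T" by (rule linear_category_opposite)
  note GO = triangulated_subcategoryD(4)[OF S G]
  note pO = susp_pow_Obj[OF GO]
  have bip: "\<exists>Y \<in> S. \<exists>\<iota> \<pi>. biproduct T {..<n::nat} A Y \<iota> \<pi>"
    if "\<And>i. i < n \<Longrightarrow> A i \<in> range (\<lambda>k. susp_pow T k G)" for n A
  proof -
    have "A i \<in> S" if "i < n" for i
      using \<open>i < n \<Longrightarrow> A i \<in> range (\<lambda>k. susp_pow T k G)\<close>[OF that] susp_pow_full_sub(2)[OF S G] by auto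
    from finite_biproducts_in_subcategory[of S n A, OF S this] show ?thesis by blast
  qed
  have bip': "\<exists>Y \<in> S. \<exists>\<iota> \<pi>. biproduct (opposite T) {..<n::nat} A Y \<iota> \<pi>"
    if "\<And>i. i < n \<Longrightarrow> A i \<in> range (\<lambda>k. susp_pow T k G)" for n A
  proof -
    have "\<exists>Y \<in> S. \<exists>\<iota> \<pi>. biproduct T {..<n} A Y \<iota> \<pi>" by (rule bip) (rule that)
    then obtain Y \<iota> \<pi> where "Y \<in> S" and b: "biproduct T {..<n} A Y \<iota> \<pi>" by blast
    then show ?thesis using biproduct_opposite[OF b] by blast
  qed
  show "\<exists>Y \<in> S. \<exists>a. covers T (range (\<lambda>k. susp_pow T k G)) Y t a"
    by (rule cover_of_family[OF pO t proper_Hom(3)[OF pr GO t] proper_Hom(1)[OF pr pO t] bip])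
  show "\<exists>Y \<in> S. \<exists>a. covers (opposite T) (range (\<lambda>k. susp_pow T k G)) Y t a"
    by (rule op.cover_of_family[where X = "\<lambda>k. susp_pow T k G" and t = t])
      (use proper_Hom(2)[OF pr t GO] proper_Hom(1)[OF pr t pO] bip' in \<open>simp_all add: pO t\<close>)
qed

lemma gen_in_Obj: "gen_in T G n \<subseteq> Obj T"
  by (induction T G n rule: gen_in.induct) auto

lemma retract_full_sub:
  "X \<in> S \<Longrightarrow> Y \<in> S \<Longrightarrow> retract (full_sub T S) X Y \<longleftrightarrow> retract T X Y"
  by (simp add: retract_def Hom_full_sub)

lemma direct_summand_full_sub_retract:
  assumes S: "triangulated_subcategory T S" and d: "direct_summand (full_sub T S) X Y"
  shows "retract T X Y"
proof -
  interpret F: linear_triangulated_category R "full_sub T S"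
    by (rule full_sub_linear_triangulated[OF linear_triangulated_category_axioms S])
  show ?thesis
    using F.direct_summand_retract[OF d] unfolding retract_def by (auto dest: Hom_full_subD)
qed

text \<open>Liftability passes from the suspensions of \<open>G\<close> to their finite coproducts and to summands of
  these.\<close>

lemma covers_gen_in_1:
  assumes S: "triangulated_subcategory T S" and G: "G \<in> S" and K: "K = T \<or> K = opposite T"
    and a: "covers K (range (\<lambda>k. susp_pow T k G)) A t a"
  shows "covers K (gen_in (full_sub T S) G (Suc 0)) A t a"
proof -
  interpret K: linear_category R K
    using K linear_category_axioms linear_category_opposite by blast
  let ?Q = "{Y. suspension_coproduct (full_sub T S) G Y}"
  have "covers K ?Q A t a"
    unfolding covers_def
  proof (intro conjI ballI covers_Hom[OF a])
    fix Y f assume "Y \<in> ?Q" and f: "f \<in> Hom K Y t"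
    then obtain n :: nat and k \<iota>
      where c: "is_coproduct (full_sub T S) {..<n} (\<lambda>j. susp_pow (full_sub T S) (k j) G) Y \<iota>"
      unfolding suspension_coproduct_def by blast
    obtain \<pi> where b: "biproduct T {..<n} (\<lambda>j. susp_pow T (k j) G) Y \<iota> \<pi>"
      using coproduct_full_sub_biproduct(2)[OF S _ c] susp_pow_full_sub(1)[OF S G] by auto
    obtain \<iota>' \<pi>' where b': "biproduct K {..<n} (\<lambda>j. susp_pow T (k j) G) Y \<iota>' \<pi>'"
      using K b biproduct_opposite[OF b] by blast
    have "covers K {Y} A t a" by (rule K.covers_biproduct[OF a _ b']) auto
    then show "\<exists>l \<in> Hom K Y A. a \<cdot>\<^bsub>K\<^esub> l = f" using f unfolding covers_def by blast
  qed
  then show ?thesis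
  proof (rule K.covers_retracts)
    fix x assume "x \<in> gen_in (full_sub T S) G (Suc 0)"
    then obtain Y where "Y \<in> ?Q" "direct_summand (full_sub T S) x Y" by auto
    then show "\<exists>y \<in> ?Q. retract K x y"
      using direct_summand_full_sub_retract[OF S] K by auto
  qed
qed

text \<open>The two halves differ in the order in which the pieces of \<open>\<langle>G\<rangle>\<^sub>n\<^sub>+\<^sub>1\<close> are treated: reversing the
  arrows of \<open>x \<rightarrow> y \<rightarrow> z\<close> interchanges the roles of \<open>\<langle>G\<rangle>\<^sub>1\<close> and \<open>\<langle>G\<rangle>\<^sub>n\<close>, which is harmless since
  \<open>covers_extension\<close> is symmetric in its hypotheses on \<open>P\<close> and \<open>Q\<close>.\<close>

lemma cover_gen_in:
  assumes S: "triangulated_subcategory T S" and pr: "proper_over R T" and G: "G \<in> S"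
  shows "t \<in> Obj T \<Longrightarrow> \<exists>F \<in> S. \<exists>b. covers T (gen_in (full_sub T S) G (Suc n)) F t b"
    "t \<in> Obj T \<Longrightarrow> \<exists>F \<in> S. \<exists>b. covers (opposite T) (gen_in (full_sub T S) G (Suc n)) F t b"
proof -
  interpret P: triangle_pair R T "triangle_segment T" S by (rule triangle_pair_full_sub[OF S])
  interpret Q: triangle_pair R "opposite T" "\<lambda>W X Y Z f g h. triangle_segment T Z Y X W h g f" S
    by (rule P.opposite_pair)
  note SS = triangulated_subcategoryD(2)[OF S]
  let ?gen = "gen_in (full_sub T S) G"
  define E where "E n = {y. \<exists>x z f g h. x \<in> ?gen (Suc 0) \<and> z \<in> ?gen (Suc n) \<and>
      dist_triangle (full_sub T S) x y z f g h}" for n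
  have gen_retract: "\<exists>y \<in> E n. retract T x y" if x: "x \<in> ?gen (Suc (Suc n))" for x n
  proof -
    obtain u y z f g h where "u \<in> ?gen (Suc 0)" "z \<in> ?gen (Suc n)"
      "dist_triangle (full_sub T S) u y z f g h" and d: "direct_summand (full_sub T S) x y"
      using x unfolding gen_in.simps(3) by blast
    then have "y \<in> E n" unfolding E_def by blast
    then show ?thesis using direct_summand_full_sub_retract[OF S d] by blast
  qed
  have one: "\<exists>A \<in> S. \<exists>a. covers T (?gen (Suc 0)) A t a" if "t \<in> Obj T" for t
    using cover_by_suspensions(1)[OF S pr G that] covers_gen_in_1[OF S G, of T] by blast
  have one': "\<exists>A \<in> S. \<exists>a. covers (opposite T) (?gen (Suc 0)) A t a" if "t \<in> Obj T" for t
    using cover_by_suspensions(2)[OF S pr G that] covers_gen_in_1[OF S G, of "opposite T"] by blast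
  show "\<exists>F \<in> S. \<exists>b. covers T (?gen (Suc n)) F t b" if "t \<in> Obj T"
    using that
  proof (induction n arbitrary: t)
    case 0
    then show ?case by (rule one)
  next
    case (Suc n)
    have "\<exists>F \<in> S. \<exists>b. covers T (E n) F t b"
    proof (rule P.covers_extension[of "?gen (Suc 0)" "?gen (Suc n)"])
      fix y assume "y \<in> E n"
      then obtain x z f g h where x: "x \<in> ?gen (Suc 0)" and z: "z \<in> ?gen (Suc n)"
        and d: "dist_triangle T x y z f g h"
        unfolding E_def dist_triangle_full_sub[OF SS] by blast
      show "\<exists>x \<in> ?gen (Suc 0). \<exists>z \<in> ?gen (Suc n). \<exists>i \<in> Hom T x y. \<exists>q \<in> Hom T y z.
          \<forall>V. \<forall>k \<in> Hom T y V. k \<cdot> i = Zero T x V \<longrightarrow> (\<exists>l \<in> Hom T z V. k = l \<cdot> q)"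
        by (rule bexI[OF _ x], rule bexI[OF _ z], rule bexI[OF _ dist_Hom(1)[OF d]],
            rule bexI[OF _ dist_Hom(2)[OF d]]) (simp add: dist_coexact[OF d])
    qed (use one Suc in blast)+
    then obtain F b where "F \<in> S" "covers T (E n) F t b" by blast
    then show ?case using covers_retracts[OF _ gen_retract] by blast
  qed
  show "\<exists>F \<in> S. \<exists>b. covers (opposite T) (?gen (Suc n)) F t b" if "t \<in> Obj T"
    using that
  proof (induction n arbitrary: t)
    case 0
    then show ?case by (rule one')
  next
    case (Suc n)
    have "\<exists>F \<in> S. \<exists>b. covers (opposite T) (E n) F t b"
    proof (rule Q.covers_extension[of "?gen (Suc n)" "?gen (Suc 0)"])
      fix y assume "y \<in> E n"
      then obtain x z f g h where x: "x \<in> ?gen (Suc 0)" and z: "z \<in> ?gen (Suc n)"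
        and d: "dist_triangle T x y z f g h"
        unfolding E_def dist_triangle_full_sub[OF SS] by blast
      have gH: "g \<in> Hom (opposite T) z y" and fH: "f \<in> Hom (opposite T) y x"
        using dist_Hom[OF d] by simp_all
      show "\<exists>z \<in> ?gen (Suc n). \<exists>x \<in> ?gen (Suc 0). \<exists>i \<in> Hom (opposite T) z y.
          \<exists>q \<in> Hom (opposite T) y x. \<forall>V. \<forall>k \<in> Hom (opposite T) y V.
            k \<cdot>\<^bsub>opposite T\<^esub> i = Zero (opposite T) z V \<longrightarrow>
              (\<exists>l \<in> Hom (opposite T) x V. k = l \<cdot>\<^bsub>opposite T\<^esub> q)"
        by (rule bexI[OF _ z], rule bexI[OF _ x], rule bexI[OF _ gH], rule bexI[OF _ fH])
          (simp add: dist_exact[OF d])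
    qed (use one' Suc in simp)+
    then obtain F b where "F \<in> S" "covers (opposite T) (E n) F t b" by blast
    moreover have "\<exists>y \<in> E n. retract (opposite T) x y" if "x \<in> ?gen (Suc (Suc n))" for x
      using gen_retract[OF that] by simp
    ultimately show ?case using Q.covers_retracts[of "E n" F t b "?gen (Suc (Suc n))"] by blast
  qed
qed

text \<open>For a strong generator \<open>G\<close> of \<open>S\<close>, covers relative to \<open>\<langle>G\<rangle>\<^sub>n = S\<close> are \<open>S\<close>-covers, from which
  coreflections and reflections arise by splitting idempotents of \<open>S\<close>.\<close>

lemma coreflections_exist:
  assumes S: "triangulated_subcategory T S" and pr: "proper_over R T"
    and K: "karoubian (full_sub T S)" and reg: "regular (full_sub T S)" and t: "t \<in> Obj T"
  shows "\<exists>A c. coreflection T S A t c" "\<exists>A c. coreflection (opposite T) S A t c"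
proof -
  interpret P: triangle_pair R T "triangle_segment T" S by (rule triangle_pair_full_sub[OF S])
  interpret Q: triangle_pair R "opposite T" "\<lambda>W X Y Z f g h. triangle_segment T Z Y X W h g f" S
    by (rule P.opposite_pair)
  obtain G n where G: "G \<in> S" and "n \<ge> 1" "S = gen_in (full_sub T S) G n"
    using reg unfolding regular_def strong_generator_def by auto
  then obtain m where m: "gen_in (full_sub T S) G (Suc m) = S" by (cases n) auto
  have split: "\<exists>Y \<in> S. \<exists>p \<in> Hom T X Y. \<exists>i \<in> Hom T Y X. i \<cdot> p = e \<and> p \<cdot> i = Ident T Y"
    if "X \<in> S" "e \<in> Hom T X X" "e \<cdot> e = e" for X e
  proof -
    have "e \<in> Hom (full_sub T S) X X" using that by (simp add: Hom_full_sub)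
    from K[unfolded karoubian_def full_sub_simps, rule_format, OF that(1) this that(3)]
    show ?thesis using that(1) by (simp add: Hom_full_sub cong: bex_cong)
  qed
  show "\<exists>A c. coreflection T S A t c"
  proof (rule P.coreflection_if_covers[OF _ _ t])
    show "\<exists>A \<in> S. \<exists>a. covers T S A t a" if "t \<in> Obj T" for t
      using cover_gen_in(1)[OF S pr G that, of m] m by simp
  qed (rule split)
  show "\<exists>A c. coreflection (opposite T) S A t c"
  proof (rule Q.coreflection_if_covers)
    show "t \<in> Obj (opposite T)" using t by simp
    show "\<exists>A \<in> S. \<exists>a. covers (opposite T) S A t a" if "t \<in> Obj (opposite T)" for t
      using cover_gen_in(2)[OF S pr G, of t m] that m by simp
    show "\<exists>Y \<in> S. \<exists>p \<in> Hom (opposite T) X Y. \<exists>i \<in> Hom (opposite T) Y X.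
        i \<cdot>\<^bsub>opposite T\<^esub> p = e \<and> p \<cdot>\<^bsub>opposite T\<^esub> i = Ident (opposite T) Y"
      if "X \<in> S" "e \<in> Hom (opposite T) X X" "e \<cdot>\<^bsub>opposite T\<^esub> e = e" for X e
      using split[of X e] that by auto
  qed
qed

end

section \<open>Regularity of coreflective subcategories\<close>

lemma (in category) coreflection_self:
  assumes "s \<in> S" "S \<subseteq> Obj C"
  shows "coreflection C S s s (Ident C s)"
proof -
  have s: "s \<in> Obj C" using assms by blast
  show ?thesis
    unfolding coreflection_def covers_def
    using assms(1) Ident_Hom[OF s] Comp_Ident_left by (auto intro!: bexI)
qed

context linear_triangulated_category
begin

text \<open>The induction along \<open>\<langle>G\<rangle>\<^sub>n\<close> common to both cases: \<open>ref x x'\<close> relates \<open>x\<close> to its coreflections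
  or reflections \<open>x'\<close>, and \<open>cov y M\<close> relates \<open>y\<close> to the objects \<open>M\<close> of \<open>S\<close> that cover it in the category or
  in its opposite.  Coreflections of summands have to be compared with covers only, so that the
  object constructed over the middle term of a triangle need not be its coreflection.\<close>

lemma gen_in_transfer:
  assumes ex: "\<And>x. x \<in> Obj T \<Longrightarrow> \<exists>x'. ref x x'" and in_S: "\<And>x x'. ref x x' \<Longrightarrow> x' \<in> S"
    and base: "\<And>Y. suspension_coproduct T G Y \<Longrightarrow>
      \<exists>M. suspension_coproduct (full_sub T S) G' M \<and> cov Y M"
    and step: "\<And>x y z f g h x' z'. dist_triangle T x y z f g h \<Longrightarrow> ref x x' \<Longrightarrow> ref z z' \<Longrightarrow>
      \<exists>M f g h. dist_triangle (full_sub T S) x' M z' f g h \<and> cov y M"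
    and summand: "\<And>x x' y M. direct_summand T x y \<Longrightarrow> cov y M \<Longrightarrow> ref x x' \<Longrightarrow>
      direct_summand (full_sub T S) x' M"
    and "x \<in> gen_in T G (Suc n)" "ref x x'"
  shows "x' \<in> gen_in (full_sub T S) G' (Suc n)"
proof -
  have one: "x' \<in> gen_in (full_sub T S) G' (Suc 0)" if x: "x \<in> gen_in T G (Suc 0)" and r: "ref x x'" for x x'
  proof -
    obtain Y where Y: "suspension_coproduct T G Y" "direct_summand T x Y" using x by auto
    obtain M where "suspension_coproduct (full_sub T S) G' M" "cov Y M" using base[OF Y(1)] by blast
    then show ?thesis using summand[OF Y(2) _ r] in_S[OF r] by auto
  qed
  show ?thesis
    using assms(6,7)
  proof (induction n arbitrary: x x')
    case 0 then show ?case by (rule one)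
  next
    case (Suc n)
    obtain u y z f g h where u: "u \<in> gen_in T G (Suc 0)" and z: "z \<in> gen_in T G (Suc n)"
      and d: "dist_triangle T u y z f g h" and s: "direct_summand T x y"
      using Suc.prems(1) unfolding gen_in.simps(3) by blast
    obtain u' z' where ru: "ref u u'" and rz: "ref z z'"
      using ex gen_in_Obj u z by (meson subsetD)
    obtain M f' g' h' where d': "dist_triangle (full_sub T S) u' M z' f' g' h'" and c: "cov y M"
      using step[OF d ru rz] by blast
    have "u' \<in> gen_in (full_sub T S) G' (Suc 0)" "z' \<in> gen_in (full_sub T S) G' (Suc n)"
      using one[OF u ru] Suc.IH[OF z rz] .
    moreover have "direct_summand (full_sub T S) x' M" by (rule summand[OF s c Suc.prems(2)])
    ultimately show ?case
      unfolding gen_in.simps(3) full_sub_simps using d' in_S[OF Suc.prems(2)] by blast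
  qed
qed

lemma coreflection_susp:
  assumes S: "triangulated_subcategory T S" and A: "A \<in> Obj T" and x: "x \<in> Obj T"
  shows "c \<in> Hom T A x \<Longrightarrow>
      coreflection T S (susp_obj T A) (susp_obj T x) (susp_arr T c) \<longleftrightarrow> coreflection T S A x c"
    "c \<in> Hom T x A \<Longrightarrow> coreflection (opposite T) S (susp_obj T A) (susp_obj T x) (susp_arr T c) \<longleftrightarrow>
      coreflection (opposite T) S A x c"
proof -
  interpret op: linear_category R "opposite T" by (rule linear_category_opposite)
  note SD = triangulated_subcategoryD[OF S]
  have inj: "inj_on (susp_obj T) (Obj T)" using Susp_bij_Obj by (simp add: bij_betw_def)
  show "coreflection T S (susp_obj T A) (susp_obj T x) (susp_arr T c) \<longleftrightarrow> coreflection T S A x c"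
    if "c \<in> Hom T A x"
    by (rule coreflection_automorphism[OF susp_bij_Hom susp_Comp inj SD(1,2) A x that])
  show "coreflection (opposite T) S (susp_obj T A) (susp_obj T x) (susp_arr T c) \<longleftrightarrow>
      coreflection (opposite T) S A x c" if c: "c \<in> Hom T x A"
    by (rule op.coreflection_automorphism[of "susp_arr T" "susp_obj T"])
      (simp_all add: susp_bij_Hom susp_Comp inj SD(1,2) A x c)
qed

lemma coreflection_susp_pow:
  assumes S: "triangulated_subcategory T S" and A: "A \<in> S" and x: "x \<in> Obj T"
    and K: "K = T \<or> K = opposite T" and c: "\<exists>c. coreflection K S A x c"
  shows "\<exists>c. coreflection K S (susp_pow T k A) (susp_pow T k x) c"
proof -
  note AO = triangulated_subcategoryD(4)[OF S A]
  have susp: "(\<exists>c. coreflection K S (susp_obj T B) (susp_obj T y) c) \<longleftrightarrow> (\<exists>c. coreflection K S B y c)"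
    (is "?l \<longleftrightarrow> ?r") if B: "B \<in> Obj T" and y: "y \<in> Obj T" for B y
    using K
  proof
    assume KT: "K = T"
    have "c' \<in> susp_arr T ` Hom T B y" if "coreflection K S (susp_obj T B) (susp_obj T y) c'" for c'
      using that susp_bij_Hom[OF B y] by (simp add: KT coreflection_def covers_def bij_betw_def)
    moreover have "c \<in> Hom T B y" if "coreflection K S B y c" for c
      using that by (simp add: KT coreflection_def covers_def)
    ultimately show ?thesis using coreflection_susp(1)[OF S B y] KT by blast
  next
    assume KT: "K = opposite T"
    have "c' \<in> susp_arr T ` Hom T y B" if "coreflection K S (susp_obj T B) (susp_obj T y) c'" for c'
      using that susp_bij_Hom[OF y B] by (simp add: KT coreflection_def covers_def bij_betw_def)
    moreover have "c \<in> Hom T y B" if "coreflection K S B y c" for c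
      using that by (simp add: KT coreflection_def covers_def)
    ultimately show ?thesis using coreflection_susp(2)[OF S B y] KT by blast
  qed
  note pO = susp_pow_Obj[OF AO] susp_pow_Obj[OF x] and p1 = susp_pow_add_1[OF AO] susp_pow_add_1[OF x]
  show ?thesis
  proof (induction k rule: int_induct[of _ 0])
    case base then show ?case using c by simp
  next
    case (step1 k) then show ?case using susp[OF pO, of k k] p1[of k] by simp
  next
    case (step2 k)
    then show ?case using susp[OF pO, of "k - 1" "k - 1"] p1(1)[of "k - 1"] p1(2)[of "k - 1"] by simp
  qed
qed

text \<open>Since \<open>\<Sigma>x'\<close> is the coreflection of \<open>\<Sigma>x\<close>, the connecting arrow lifts to \<open>z' \<rightarrow> \<Sigma>x'\<close>, and \<open>M\<close> is the
  corresponding extension in \<open>S\<close>.\<close>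

lemma coreflection_covers_middle:
  assumes S: "triangulated_subcategory T S" and d: "dist_triangle T x y z f g h"
    and c: "coreflection T S x' x c" and e: "coreflection T S z' z e"
  shows "\<exists>M f g h m. dist_triangle (full_sub T S) x' M z' f g h \<and> M \<in> S \<and> covers T S M y m"
proof -
  interpret P: triangle_pair R T "triangle_segment T" S by (rule triangle_pair_full_sub[OF S])
  note SD = triangulated_subcategoryD[OF S]
  note dH = dist_Hom[OF d]
  have x: "x \<in> Obj T" using Hom_Obj[OF dH(1)] by simp
  have x': "x' \<in> S" "x' \<in> Obj T" and z': "z' \<in> S" and cc: "covers T S x' x c" and ce: "covers T S z' z e"
    using c e SD(4) by (auto simp: coreflection_def)
  note cH = covers_Hom[OF cc] and eH = covers_Hom[OF ce]
  let ?s = "susp_obj T" and ?S = "susp_arr T"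
  have sc: "coreflection T S (?s x') (?s x) (?S c)"
    using coreflection_susp(1)[OF S x'(2) x cH] c by simp
  have scc: "covers T S (?s x') (?s x) (?S c)" using sc by (simp add: coreflection_def)
  note he = Comp_Hom[OF eH dH(3)]
  obtain k where k: "k \<in> Hom T z' (?s x')" and sk: "?S c \<cdot> k = h \<cdot> e"
    by (rule coversE[OF scc z' he])
  obtain W M f' g' where t: "triangle_segment T W M z' (?s x') f' g' k" and WM: "W \<in> S" "M \<in> S"
    using P.S_last[OF k z' SD(5)[OF x'(1)]] by blast
  then have "W = x'" using susp_obj_inject[of x' W] SD(4) x' by (simp add: triangle_segment_def)
  then have t': "triangle_segment T x' M z' (?s x') f' g' k" and d': "dist_triangle T x' M z' f' g' k"
    using t by (simp_all add: triangle_segment_def)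
  obtain m where m: "m \<in> Hom T M y" "m \<cdot> f' = f \<cdot> c" "g \<cdot> m = e \<cdot> g'"
    using fill_middle[OF d' d cH eH sk] by blast
  have ts: "triangle_segment T x y z (?s x) f g h" using d by (simp add: triangle_segment_def)
  have "covers T S M y m"
  proof (rule P.covers_middle[OF ts t' cc ce susp_Hom[OF cH] _ m(1,2,3) sk[symmetric]])
    fix s l assume s: "s \<in> S" and l: "l \<in> Hom T s (?s x')" and "?S c \<cdot> l = Zero T s (?s x)"
    then have "?S c \<cdot> l = ?S c \<cdot> Zero T s (?s x')"
      using Comp_Zero_right[OF susp_Hom[OF cH] SD(4)[OF s]] by simp
    then show "l = Zero T s (?s x')"
      by (rule coreflection_cancel[OF sc s l Zero_Hom[OF SD(4)[OF s] susp_Obj[OF x'(2)]]])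
  qed
  moreover have "dist_triangle (full_sub T S) x' M z' f' g' k"
    unfolding dist_triangle_full_sub[OF SD(2)] using d' x' z' WM by simp
  ultimately show ?thesis using WM by blast
qed

text \<open>Dually, the connecting arrow has to be extended to the reflections.  It is used in the rotated form
  \<open>w \<rightarrow> x\<close> with \<open>\<Sigma>w = z\<close>, which puts it into the last position when the segment \<open>w \<rightarrow> x \<rightarrow> y \<rightarrow> z\<close> is read in
  the opposite category.\<close>

lemma reflection_covers_middle:
  assumes S: "triangulated_subcategory T S" and d: "dist_triangle T x y z f g h"
    and c: "coreflection (opposite T) S x' x c" and e: "coreflection (opposite T) S z' z e"
  shows "\<exists>M f g h m. dist_triangle (full_sub T S) x' M z' f g h \<and> M \<in> S \<and>
    covers (opposite T) S M y m"
proof -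
  interpret P: triangle_pair R T "triangle_segment T" S by (rule triangle_pair_full_sub[OF S])
  interpret Q: triangle_pair R "opposite T" "\<lambda>W X Y Z f g h. triangle_segment T Z Y X W h g f" S
    by (rule P.opposite_pair)
  note SD = triangulated_subcategoryD[OF S]
  note dH = dist_Hom[OF d]
  have z: "z \<in> Obj T" using Hom_Obj[OF dH(2)] by simp
  have x': "x' \<in> S" and z': "z' \<in> S" "z' \<in> Obj T" and cc: "covers (opposite T) S x' x c"
    and ce: "covers (opposite T) S z' z e"
    using c e SD(4) by (auto simp: coreflection_def)
  have cH: "c \<in> Hom T x x'" and eH: "e \<in> Hom T z z'" using covers_Hom[OF cc] covers_Hom[OF ce] by simp_all
  let ?s = "susp_obj T" and ?S = "susp_arr T"
  obtain w where w: "w \<in> Obj T" "?s w = z" by (rule desuspend[OF z])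
  obtain w' where w': "w' \<in> Obj T" "?s w' = z'" by (rule desuspend[OF z'(2)])
  have w'S: "w' \<in> S" using SD(6)[OF w'(1)] w'(2) z'(1) by simp
  obtain r where rH: "r \<in> Hom T w w'" and sr: "?S r = e"
    using susp_full[OF w(1) w'(1)] eH w(2) w'(2) by blast
  have r: "coreflection (opposite T) S w' w r"
    using coreflection_susp(2)[OF S w'(1) w(1) rH] w w' sr e by simp
  then have cr: "covers (opposite T) S w' w r" by (simp add: coreflection_def)
  obtain u where du: "dist_triangle T w x y u f g"
    using unrotate[of x y w f g h] d w by blast
  have uH: "u \<in> Hom T w x" using dist_Hom[OF du] by simp
  have "c \<cdot> u \<in> Hom (opposite T) x' w" using Comp_Hom[OF uH cH] by simp
  then obtain u' where "u' \<in> Hom (opposite T) x' w'" "r \<cdot>\<^bsub>opposite T\<^esub> u' = c \<cdot> u"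
    by (rule coversE[OF cr x'])
  then have u'H: "u' \<in> Hom T w' x'" and ur: "u' \<cdot> r = c \<cdot> u" by simp_all
  obtain M D f' g' where t: "triangle_segment T w' x' M D u' f' g'" and M: "M \<in> S"
    using P.S_first[OF u'H w'S x'] by blast
  then have t': "triangle_segment T w' x' M z' u' f' g'" and d': "dist_triangle T w' x' M u' f' g'"
    using w'(2) by (simp_all add: triangle_segment_def)
  obtain m where m: "m \<in> Hom T y M" "m \<cdot> f = f' \<cdot> c" "?S r \<cdot> g = g' \<cdot> m"
    using TR3[OF du d' rH cH ur[symmetric]] by blast
  have ts: "triangle_segment T w x y z u f g" using du w(2) by (simp add: triangle_segment_def)
  have "covers (opposite T) S M y m"
  proof (rule Q.covers_middle[OF ts t' ce cc])
    fix s l assume s: "s \<in> S" and l: "l \<in> Hom (opposite T) s w'"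
      and 0: "r \<cdot>\<^bsub>opposite T\<^esub> l = Zero (opposite T) s w"
    have "Zero T w' s \<cdot> r = Zero T w s" by (rule Comp_Zero_left[OF rH SD(4)[OF s]])
    with 0 have eq: "r \<cdot>\<^bsub>opposite T\<^esub> l = r \<cdot>\<^bsub>opposite T\<^esub> Zero (opposite T) s w'" by simp
    have "Zero (opposite T) s w' \<in> Hom (opposite T) s w'"
      using Zero_Hom[OF w'(1) SD(4)[OF s]] by simp
    then show "l = Zero (opposite T) s w'" by (rule coreflection_cancel[OF r s l _ eq])
  qed (use m sr ur rH in simp_all)
  moreover have "dist_triangle T x' M z' f' g' (neg z' (?s x') (?S u'))"
    using rotate[OF d'] w'(2) by simp
  then have "dist_triangle (full_sub T S) x' M z' f' g' (neg z' (?s x') (?S u'))"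
    unfolding dist_triangle_full_sub[OF SD(2)] using x' z' M by simp
  ultimately show ?thesis using M by blast
qed

text \<open>The coreflection (or reflection) \<open>G'\<close> of a strong generator of \<open>T\<close> strongly generates \<open>S\<close> in the same
  number of steps, each object of \<open>S\<close> being its own coreflection.\<close>

lemma regular_subcategory:
  assumes S: "triangulated_subcategory T S" and reg: "regular T" and kar: "karoubian (full_sub T S)"
    and K: "K = T \<or> K = opposite T" and ex: "\<And>t. t \<in> Obj T \<Longrightarrow> \<exists>A c. coreflection K S A t c"
  shows "regular (full_sub T S)"
proof -
  interpret F: linear_triangulated_category R "full_sub T S"
    by (rule full_sub_linear_triangulated[OF linear_triangulated_category_axioms S])
  interpret K: linear_category R K
    using K linear_category_axioms linear_category_opposite by blast
  note SD = triangulated_subcategoryD[OF S]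
  have KO: "Obj K = Obj T" using K by auto
  have Kret: "retract K u v \<longleftrightarrow> retract T u v" for u v using K by auto
  obtain G n where G: "G \<in> Obj T" and "n \<ge> 1" "Obj T = gen_in T G n"
    using reg unfolding regular_def strong_generator_def by auto
  then obtain m where m: "gen_in T G (Suc m) = Obj T" by (cases n) auto
  obtain G' c where c: "coreflection K S G' G c" using ex[OF G] by blast
  then have G': "G' \<in> S" by (simp add: coreflection_def)
  define ref where "ref x x' \<longleftrightarrow> (\<exists>c. coreflection K S x' x c)" for x x'
  define cov where "cov y M \<longleftrightarrow> M \<in> S \<and> (\<exists>m. covers K S M y m)" for y M
  have susp: "\<exists>c. coreflection K S (susp_pow T k G') (susp_pow T k G) c" for k
    by (rule coreflection_susp_pow[OF S G' G K]) (use c in blast)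
  have base: "\<exists>M. suspension_coproduct (full_sub T S) G' M \<and> cov Y M"
    if Y: "suspension_coproduct T G Y" for Y
  proof -
    obtain n :: nat and k \<iota> where "is_coproduct T {..<n} (\<lambda>j. susp_pow T (k j) G) Y \<iota>"
      using Y unfolding suspension_coproduct_def by blast
    then obtain \<pi> where b: "biproduct T {..<n} (\<lambda>j. susp_pow T (k j) G) Y \<iota> \<pi>"
      using coproduct_biproduct[OF finite_lessThan] by blast
    obtain M \<iota>' \<pi>' where M: "M \<in> S"
      and c': "is_coproduct (full_sub T S) {..<n} (\<lambda>j. susp_pow T (k j) G') M \<iota>'"
      and b': "biproduct T {..<n} (\<lambda>j. susp_pow T (k j) G') M \<iota>' \<pi>'"
      using finite_biproducts_in_subcategory[of S n "\<lambda>j. susp_pow T (k j) G'"]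
        susp_pow_full_sub(2)[OF S G'] S by blast
    obtain i p where bK: "biproduct K {..<n} (\<lambda>j. susp_pow T (k j) G) Y i p"
      using K b biproduct_opposite[OF b] by blast
    obtain i' p' where b'K: "biproduct K {..<n} (\<lambda>j. susp_pow T (k j) G') M i' p'"
      using K b' biproduct_opposite[OF b'] by blast
    have "\<forall>j. \<exists>c. coreflection K S (susp_pow T (k j) G') (susp_pow T (k j) G) c" using susp by simp
    from choice[OF this] obtain d
      where "\<forall>j. coreflection K S (susp_pow T (k j) G') (susp_pow T (k j) G) (d j)" ..
    then have "\<exists>m. covers K S M Y m"
      using K.biproduct_covers[OF finite_lessThan bK b'K, of S d] by (simp add: coreflection_def)
    moreover have "suspension_coproduct (full_sub T S) G' M"
      unfolding suspension_coproduct_def using c' susp_pow_full_sub(1)[OF S G'] by auto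
    ultimately show ?thesis using M by (auto simp: cov_def)
  qed
  have step: "\<exists>M f g h. dist_triangle (full_sub T S) x' M z' f g h \<and> cov y M"
    if d: "dist_triangle T x y z f g h" and rx: "ref x x'" and rz: "ref z z'" for x y z f g h x' z'
  proof -
    obtain a b where ab: "coreflection K S x' x a" "coreflection K S z' z b"
      using rx rz by (auto simp: ref_def)
    show ?thesis
      using K
    proof
      assume KT: "K = T"
      from coreflection_covers_middle[OF S d] ab show ?thesis unfolding cov_def KT by blast
    next
      assume KT: "K = opposite T"
      from reflection_covers_middle[OF S d] ab show ?thesis unfolding cov_def KT by blast
    qed
  qed
  have summand: "direct_summand (full_sub T S) x' M"
    if s: "direct_summand T x y" and cv: "cov y M" and r: "ref x x'" for x x' y M
  proof -
    obtain a where a: "coreflection K S x' x a" using r by (auto simp: ref_def)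
    obtain m where M: "M \<in> S" and m: "covers K S M y m" using cv by (auto simp: cov_def)
    have "retract K x y" using direct_summand_retract[OF s] Kret by simp
    then have "retract K x' M" by (rule K.coreflection_retract[OF a _ m M])
    moreover have "x' \<in> S" using a by (simp add: coreflection_def)
    ultimately have "retract (full_sub T S) x' M" using Kret M by (simp add: retract_full_sub)
    then show ?thesis by (rule F.retract_direct_summand[OF kar])
  qed
  have "s \<in> gen_in (full_sub T S) G' (Suc m)" if s: "s \<in> S" for s
  proof (rule gen_in_transfer[of ref S G G' cov])
    show "\<exists>x'. ref x x'" if "x \<in> Obj T" for x using ex[OF that] by (auto simp: ref_def)
    show "x' \<in> S" if "ref x x'" for x x' using that by (auto simp: ref_def coreflection_def)
    show "s \<in> gen_in T G (Suc m)" using m SD(4)[OF s] by simp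
    have "coreflection K S s s (Ident K s)"
      by (rule K.coreflection_self[OF s]) (simp add: KO SD(1))
    then show "ref s s" unfolding ref_def by blast
  qed (fact base, fact step, fact summand)
  then have "S = gen_in (full_sub T S) G' (Suc m)" using F.gen_in_Obj[of G' "Suc m"] by auto
  then show ?thesis
    unfolding regular_def strong_generator_def using G' by (intro exI[of _ G']) (auto intro!: exI[of _ "Suc m"])
qed

lemma karoubian_subcategory:
  assumes S: "triangulated_subcategory T S" and kar: "karoubian T"
    and K: "K = T \<or> K = opposite T" and ex: "\<And>t. t \<in> Obj T \<Longrightarrow> \<exists>A c. coreflection K S A t c"
  shows "karoubian (full_sub T S)"
  unfolding karoubian_def full_sub_simps
proof (intro ballI impI)
  interpret op: linear_category R "opposite T" by (rule linear_category_opposite)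
  fix X e assume X: "X \<in> S" and e: "e \<in> Hom (full_sub T S) X X" and ee: "e \<cdot> e = e"
  have "X \<in> Obj T" "e \<in> Hom T X X" using X e triangulated_subcategoryD(4)[OF S] by (auto dest: Hom_full_subD)
  then obtain Y p i where p: "p \<in> Hom T X Y" and i: "i \<in> Hom T Y X"
    and ip: "i \<cdot> p = e" and pi: "p \<cdot> i = Ident T Y"
    using kar[unfolded karoubian_def, rule_format, OF _ _ ee] by blast
  obtain A c where c: "coreflection K S A Y c" using ex Hom_Obj[OF p] by blast
  then have A: "A \<in> S" by (simp add: coreflection_def)
  have "\<exists>p' \<in> Hom T X A. \<exists>i' \<in> Hom T A X. i' \<cdot> p' = i \<cdot> p \<and> p' \<cdot> i' = Ident T A"
    using K
  proof
    assume "K = T"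
    then show ?thesis using coreflection_splits_idempotent[OF _ X i p pi, of A c] c by simp
  next
    assume "K = opposite T"
    then show ?thesis using op.coreflection_splits_idempotent[OF _ X, of A Y c p i] c i p pi by auto
  qed
  then show "\<exists>Y \<in> S. \<exists>p \<in> Hom (full_sub T S) X Y. \<exists>i \<in> Hom (full_sub T S) Y X.
      i \<cdot> p = e \<and> p \<cdot> i = Ident T Y"
    using A X ip by (auto simp: Hom_full_sub)
qed

lemma proper_full_sub:
  assumes S: "triangulated_subcategory T S" and pr: "proper_over R T"
  shows "proper_over R (full_sub T S)"
  unfolding proper_over_def full_sub_simps
proof (intro ballI)
  fix X Y assume X: "X \<in> S" and Y: "Y \<in> S"
  have "hom_module (full_sub T S) X (susp_pow (full_sub T S) i Y) = hom_module T X (susp_pow T i Y)" for i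
    using susp_pow_full_sub[OF S Y] X by (simp add: hom_module_full_sub)
  then show "finitely_generated_module R
      (direct_sum_module (\<lambda>i. hom_module (full_sub T S) X (susp_pow (full_sub T S) i Y)))"
    using pr triangulated_subcategoryD(4)[OF S] X Y unfolding proper_over_def by simp
qed

lemma adjoints_iff:
  assumes S: "triangulated_subcategory T S"
  shows "has_right_adjoint (full_sub T S) T inclusion \<longleftrightarrow>
      (\<forall>t \<in> Obj T. \<exists>A c. coreflection T S A t c)"
    "has_left_adjoint (full_sub T S) T inclusion \<longleftrightarrow>
      (\<forall>t \<in> Obj T. \<exists>A c. coreflection (opposite T) S A t c)"
proof -
  interpret F: linear_triangulated_category R "full_sub T S"
    by (rule full_sub_linear_triangulated[OF linear_triangulated_category_axioms S])
  interpret op: linear_category R "opposite T" by (rule linear_category_opposite)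
  interpret opF: linear_category R "opposite (full_sub T S)" by (rule F.linear_category_opposite)
  note SO = triangulated_subcategoryD(1)[OF S]
  show "has_right_adjoint (full_sub T S) T inclusion \<longleftrightarrow>
      (\<forall>t \<in> Obj T. \<exists>A c. coreflection T S A t c)"
    by (rule has_right_adjoint_inclusion_iff[OF category_axioms F.category_axioms _ SO])
      (simp_all add: Hom_full_sub)
  have "has_right_adjoint (opposite (full_sub T S)) (opposite T) inclusion \<longleftrightarrow>
      (\<forall>t \<in> Obj (opposite T). \<exists>A c. coreflection (opposite T) S A t c)"
    by (rule has_right_adjoint_inclusion_iff[OF op.category_axioms opF.category_axioms])
      (simp_all add: Hom_full_sub SO)
  then show "has_left_adjoint (full_sub T S) T inclusion \<longleftrightarrow>
      (\<forall>t \<in> Obj T. \<exists>A c. coreflection (opposite T) S A t c)"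
    using has_left_adjoint_iff_opposite[OF F.linear_category_axioms linear_category_axioms] by simp
qed

end

theorem corollary0p8:
  fixes R :: "'r ring" and T :: "('o, 'm, 'r) tri_cat" and S :: "'o set"
  assumes "cring R" and "noetherian_ring R"
    and "linear_triangulated_category R T"
    and "regular T" and "karoubian T" and "proper_over R T"
    and "triangulated_subcategory T S"
    and "has_right_adjoint (full_sub T S) T inclusion \<or> has_left_adjoint (full_sub T S) T inclusion"
  shows "has_right_adjoint (full_sub T S) T inclusion \<and> has_left_adjoint (full_sub T S) T inclusion \<and>
    karoubian (full_sub T S) \<and> regular (full_sub T S) \<and> proper_over R (full_sub T S)"
proof -
  interpret linear_triangulated_category R T by fact
  note S = assms(7) and adj = adjoints_iff[OF assms(7)]
  obtain K where K: "K = T \<or> K = opposite T"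
    and ex: "\<And>t. t \<in> Obj T \<Longrightarrow> \<exists>A c. coreflection K S A t c"
    using assms(8) unfolding adj by blast
  have kar: "karoubian (full_sub T S)" by (rule karoubian_subcategory[OF S assms(5) K ex])
  have reg: "regular (full_sub T S)" by (rule regular_subcategory[OF S assms(4) kar K ex])
  show ?thesis
    unfolding adj
    using coreflections_exist[OF S assms(6) kar reg] kar reg proper_full_sub[OF S assms(6)] by simp
qed

end
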